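(* Let $k$ be a commutative ring. For any discrete group $G$ there is a graded isomorphism $$HC_*(kG)\cong\bigoplus_{\langle\pi\rangle\in\langle G\rangle}HC_*^{\pi,\varepsilon,\varepsilon}(kG_\pi),$$ where $HC_*(kG)$ is the classical cyclic homology of the algebra $kG$, $\langle G\rangle$ is the set of conjugacy classes of $G$, $\langle\pi\rangle$ is the conjugacy class of $\pi$, $G_\pi$ is the centralizer of $\pi$ in $G$, and $\varepsilon$ is the counit of $kG_\pi$.
   Context: For a group $L$ and a central element $\pi\in L$, $HC_*^{\pi,\varepsilon,\varepsilon}(kL)$ is the cyclic homology of the cyclic $k$-module $C_n^{(\pi,\varepsilon,\varepsilon)}(kL)=(kL)^{\otimes n}$ ($n\ge0$) given on group elements by: $d_0(g_1\otimes\cdots\otimes g_n)=g_2\otimes\cdots\otimes g_n$; $d_i(g_1\otimes\cdots\otimes g_n)=g_1\otimes\cdots\otimes g_ig_{i+1}\otimes\cdots\otimes g_n$ for $1\le i\le n-1$; $d_n(g_1\otimes\cdots\otimes g_n)=g_1\otimes\cdots\otimes g_{n-1}$; degeneracies $s_i$ ($0\le i\le n$) inserting $1$ after $g_i$ (at the front if $i=0$); $t_n(g_1\otimes\cdots\otimes g_n)=\pi(g_1\cdots g_n)^{-1}\otimes g_1\otimes\cdots\otimes g_{n-1}$, $t_0=\mathrm{id}_k$. (This is the Connes–Moscovici cyclic homology of the Hopf algebra $kL$ for the grouplike $\pi$ and both characters equal to the counit $\varepsilon$.) The cyclic homology of a cyclic module $(C_n,d_i,s_i,t_n)$ is the homology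 of the total complex of the first-quadrant bicomplex whose columns are alternately $(C_*,b)$ and $(C_*,-b')$, $b=\sum_{i=0}^n(-1)^id_i$, $b'=\sum_{i=0}^{n-1}(-1)^id_i$, with horizontal maps alternately $1-\tau_n$ and $\sum_{i=0}^n\tau_n^i$, where $\tau_n=(-1)^nt_n$. *)

theory Defs
  imports "HOL-Algebra.Module" "HOL-Algebra.AbelCoset" "HOL-Algebra.Group_Action"
begin

section \<open>Modules over a commutative ring\<close>

text \<open>
  Modules are records of the type from \<open>HOL-Algebra.Module\<close>.  That record type extends rings, so
  it also has fields for a multiplication and a unit.  They are meaningful only for algebras and
  are filled with \<open>undefined\<close> for plain modules.
\<close>

definition mod_hom ::
  "('r, 'k) ring_scheme \<Rightarrow> ('r, 'a, 'm) module_scheme \<Rightarrow> ('r, 'b, 'n) module_scheme \<Rightarrow> ('a \<Rightarrow> 'b) set"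
  where "mod_hom R M N =
    {h \<in> carrier M \<rightarrow> carrier N.
      (\<forall>x\<in>carrier M. \<forall>y\<in>carrier M. h (x \<oplus>\<^bsub>M\<^esub> y) = h x \<oplus>\<^bsub>N\<^esub> h y) \<and>
      (\<forall>r\<in>carrier R. \<forall>x\<in>carrier M. h (r \<odot>\<^bsub>M\<^esub> x) = r \<odot>\<^bsub>N\<^esub> h x)}"

definition mod_iso ::
  "('r, 'k) ring_scheme \<Rightarrow> ('r, 'a, 'm) module_scheme \<Rightarrow> ('r, 'b, 'n) module_scheme \<Rightarrow> ('a \<Rightarrow> 'b) set"
  where "mod_iso R M N = {h \<in> mod_hom R M N. bij_betw h (carrier M) (carrier N)}"

definition span_submodule ::
  "('r, 'k) ring_scheme \<Rightarrow> ('r, 'a, 'm) module_scheme \<Rightarrow> 'a set \<Rightarrow> 'a set"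
  where "span_submodule R M S = \<Inter>{N. submodule N R M \<and> S \<subseteq> N}"

definition quot_module :: "('r, 'a, 'm) module_scheme \<Rightarrow> 'a set \<Rightarrow> ('r, 'a set) module"
  where "quot_module M N =
    \<lparr>carrier = a_rcosets\<^bsub>M\<^esub> N, monoid.mult = undefined, one = undefined,
     zero = N, add = set_add M,
     smult = (\<lambda>r X. \<Union>x\<in>X. N +>\<^bsub>M\<^esub> (r \<odot>\<^bsub>M\<^esub> x))\<rparr>"

text \<open>External direct sum.\<close>

definition dsum_module ::
  "'i set \<Rightarrow> ('i \<Rightarrow> ('r, 'a, 'm) module_scheme) \<Rightarrow> ('r, 'i \<Rightarrow> 'a) module"
  where "dsum_module I M =
    \<lparr>carrier = {x \<in> (\<Pi>\<^sub>E i\<in>I. carrier (M i)). finite {i \<in> I. x i \<noteq> \<zero>\<^bsub>M i\<^esub>}},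
     monoid.mult = undefined, one = undefined,
     zero = (\<lambda>i\<in>I. \<zero>\<^bsub>M i\<^esub>),
     add = (\<lambda>x y. \<lambda>i\<in>I. x i \<oplus>\<^bsub>M i\<^esub> y i),
     smult = (\<lambda>r x. \<lambda>i\<in>I. r \<odot>\<^bsub>M i\<^esub> x i)\<rparr>"

definition free_module :: "('r, 'k) ring_scheme \<Rightarrow> 'x set \<Rightarrow> ('r, 'x \<Rightarrow> 'r) module"
  where "free_module R X =
    \<lparr>carrier = {f. (\<forall>x\<in>X. f x \<in> carrier R) \<and> (\<forall>x. x \<notin> X \<longrightarrow> f x = \<zero>\<^bsub>R\<^esub>) \<and>
                   finite {x. f x \<noteq> \<zero>\<^bsub>R\<^esub>}},
     monoid.mult = undefined, one = undefined,
     zero = (\<lambda>x. \<zero>\<^bsub>R\<^esub>),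
     add = (\<lambda>f h x. f x \<oplus>\<^bsub>R\<^esub> h x),
     smult = (\<lambda>r f x. r \<otimes>\<^bsub>R\<^esub> f x)\<rparr>"

definition gen :: "('r, 'k) ring_scheme \<Rightarrow> 'x \<Rightarrow> 'x \<Rightarrow> 'r"
  where "gen R x = (\<lambda>y. if y = x then \<one>\<^bsub>R\<^esub> else \<zero>\<^bsub>R\<^esub>)"

text \<open>
  The linear map \<open>M \<rightarrow> N\<close> with \<open>e i \<mapsto> v i\<close> for all \<open>i \<in> I\<close>.  It is used only where the \<open>e i\<close> span
  \<open>M\<close> and such a map exists, so that it is unique as a function that is \<open>undefined\<close> off \<open>carrier M\<close>.
\<close>

definition linear_extension ::
  "('r, 'k) ring_scheme \<Rightarrow> ('r, 'a, 'm) module_scheme \<Rightarrow> ('r, 'b, 'n) module_scheme \<Rightarrow>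
   'i set \<Rightarrow> ('i \<Rightarrow> 'a) \<Rightarrow> ('i \<Rightarrow> 'b) \<Rightarrow> 'a \<Rightarrow> 'b"
  where "linear_extension R M N I e v =
    (THE h. h \<in> mod_hom R M N \<and> h \<in> extensional (carrier M) \<and> (\<forall>i\<in>I. h (e i) = v i))"

section \<open>Tensor powers\<close>

definition tuples :: "nat \<Rightarrow> 'a set \<Rightarrow> 'a list set"
  where "tuples n A = {xs. set xs \<subseteq> A \<and> length xs = n}"

definition tensor_relations ::
  "('r, 'k) ring_scheme \<Rightarrow> ('r, 'a, 'm) module_scheme \<Rightarrow> nat \<Rightarrow> ('a list \<Rightarrow> 'r) set"
  where "tensor_relations R M n =
    (let F = free_module R (tuples n (carrier M)) in
      {gen R (as[i := x \<oplus>\<^bsub>M\<^esub> y]) \<ominus>\<^bsub>F\<^esub> (gen R (as[i := x]) \<oplus>\<^bsub>F\<^esub> gen R (as[i := y])) | as i x y.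
         as \<in> tuples n (carrier M) \<and> i < n \<and> x \<in> carrier M \<and> y \<in> carrier M} \<union>
      {gen R (as[i := r \<odot>\<^bsub>M\<^esub> x]) \<ominus>\<^bsub>F\<^esub> (r \<odot>\<^bsub>F\<^esub> gen R (as[i := x])) | as i r x.
         as \<in> tuples n (carrier M) \<and> i < n \<and> r \<in> carrier R \<and> x \<in> carrier M})"

definition tensor_null ::
  "('r, 'k) ring_scheme \<Rightarrow> ('r, 'a, 'm) module_scheme \<Rightarrow> nat \<Rightarrow> ('a list \<Rightarrow> 'r) set"
  where "tensor_null R M n =
    span_submodule R (free_module R (tuples n (carrier M))) (tensor_relations R M n)"

text \<open>\<open>M \<otimes> \<dots> \<otimes> M\<close> over \<open>R\<close> with \<open>n\<close> factors; for \<open>n = 0\<close> this is free of rank one on the empty tuple.\<close>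

definition tensor_power ::
  "('r, 'k) ring_scheme \<Rightarrow> ('r, 'a, 'm) module_scheme \<Rightarrow> nat \<Rightarrow> ('r, ('a list \<Rightarrow> 'r) set) module"
  where "tensor_power R M n =
    quot_module (free_module R (tuples n (carrier M))) (tensor_null R M n)"

definition pure_tensor ::
  "('r, 'k) ring_scheme \<Rightarrow> ('r, 'a, 'm) module_scheme \<Rightarrow> 'a list \<Rightarrow> ('a list \<Rightarrow> 'r) set"
  where "pure_tensor R M as =
    tensor_null R M (length as) +>\<^bsub>free_module R (tuples (length as) (carrier M))\<^esub> gen R as"

section \<open>Cyclic homology of a cyclic module\<close>

text \<open>
  \<open>Face C n i\<close> is \<open>d\<^sub>i\<close> on degree \<open>n\<close> (for \<open>n \<ge> 1\<close>, \<open>i \<le> n\<close>), \<open>Degen C n i\<close> is \<open>s\<^sub>i\<close> on degree \<open>n\<close>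
  (for \<open>i \<le> n\<close>), and \<open>Cyc C n\<close> is \<open>t\<^sub>n\<close>.
\<close>

record ('r, 'c) cyclic_module =
  Deg :: "nat \<Rightarrow> ('r, 'c) module"
  Face :: "nat \<Rightarrow> nat \<Rightarrow> 'c \<Rightarrow> 'c"
  Degen :: "nat \<Rightarrow> nat \<Rightarrow> 'c \<Rightarrow> 'c"
  Cyc :: "nat \<Rightarrow> 'c \<Rightarrow> 'c"

definition sign :: "('r, 'k) ring_scheme \<Rightarrow> nat \<Rightarrow> 'r"
  where "sign R i = (\<ominus>\<^bsub>R\<^esub> \<one>\<^bsub>R\<^esub>) [^]\<^bsub>R\<^esub> i"

definition bd :: "('r, 'k) ring_scheme \<Rightarrow> ('r, 'c) cyclic_module \<Rightarrow> nat \<Rightarrow> 'c \<Rightarrow> 'c"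
  where "bd R C n x =
    finsum (Deg C (n - 1)) (\<lambda>i. sign R i \<odot>\<^bsub>Deg C (n - 1)\<^esub> Face C n i x) {..n}"

definition bd' :: "('r, 'k) ring_scheme \<Rightarrow> ('r, 'c) cyclic_module \<Rightarrow> nat \<Rightarrow> 'c \<Rightarrow> 'c"
  where "bd' R C n x =
    finsum (Deg C (n - 1)) (\<lambda>i. sign R i \<odot>\<^bsub>Deg C (n - 1)\<^esub> Face C n i x) {..<n}"

definition signed_cyc :: "('r, 'k) ring_scheme \<Rightarrow> ('r, 'c) cyclic_module \<Rightarrow> nat \<Rightarrow> 'c \<Rightarrow> 'c"
  where "signed_cyc R C n x = sign R n \<odot>\<^bsub>Deg C n\<^esub> Cyc C n x"

definition cyc_norm :: "('r, 'k) ring_scheme \<Rightarrow> ('r, 'c) cyclic_module \<Rightarrow> nat \<Rightarrow> 'c \<Rightarrow> 'c"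
  where "cyc_norm R C n x = finsum (Deg C n) (\<lambda>i. (signed_cyc R C n ^^ i) x) {..n}"

text \<open>
  The bicomplex has \<open>Deg C q\<close> in position \<open>(p, q)\<close>, where \<open>p\<close> is the column.  \<open>vert R C p q\<close> maps it
  to position \<open>(p, q - 1)\<close> (for \<open>q \<ge> 1\<close>) and \<open>horiz R C p q\<close> to \<open>(p - 1, q)\<close> (for \<open>p \<ge> 1\<close>).
\<close>

definition vert :: "('r, 'k) ring_scheme \<Rightarrow> ('r, 'c) cyclic_module \<Rightarrow> nat \<Rightarrow> nat \<Rightarrow> 'c \<Rightarrow> 'c"
  where "vert R C p q x = (if even p then bd R C q x else \<ominus>\<^bsub>Deg C (q - 1)\<^esub> bd' R C q x)"

definition horiz :: "('r, 'k) ring_scheme \<Rightarrow> ('r, 'c) cyclic_module \<Rightarrow> nat \<Rightarrow> nat \<Rightarrow> 'c \<Rightarrow> 'c"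
  where "horiz R C p q x =
    (if odd p then x \<ominus>\<^bsub>Deg C q\<^esub> signed_cyc R C q x else cyc_norm R C q x)"

text \<open>A total chain \<open>x\<close> of degree \<open>n\<close> has its component \<open>x p\<close> in position \<open>(p, n - p)\<close>.\<close>

definition Tot :: "('r, 'c) cyclic_module \<Rightarrow> nat \<Rightarrow> ('r, nat \<Rightarrow> 'c) module"
  where "Tot C n = dsum_module {..n} (\<lambda>p. Deg C (n - p))"

text \<open>The differential from degree \<open>n\<close> to degree \<open>n - 1\<close>, for \<open>n \<ge> 1\<close>.\<close>

definition tot_diff ::
  "('r, 'k) ring_scheme \<Rightarrow> ('r, 'c) cyclic_module \<Rightarrow> nat \<Rightarrow> (nat \<Rightarrow> 'c) \<Rightarrow> (nat \<Rightarrow> 'c)"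
  where "tot_diff R C n x =
    (\<lambda>p\<in>{..n - 1}. vert R C p (n - p) (x p) \<oplus>\<^bsub>Deg C (n - 1 - p)\<^esub>
                    horiz R C (p + 1) (n - 1 - p) (x (p + 1)))"

definition tot_cycles :: "('r, 'k) ring_scheme \<Rightarrow> ('r, 'c) cyclic_module \<Rightarrow> nat \<Rightarrow> (nat \<Rightarrow> 'c) set"
  where "tot_cycles R C n =
    {z \<in> carrier (Tot C n). n = 0 \<or> tot_diff R C n z = \<zero>\<^bsub>Tot C (n - 1)\<^esub>}"

definition tot_boundaries ::
  "('r, 'k) ring_scheme \<Rightarrow> ('r, 'c) cyclic_module \<Rightarrow> nat \<Rightarrow> (nat \<Rightarrow> 'c) set"
  where "tot_boundaries R C n = tot_diff R C (n + 1) ` carrier (Tot C (n + 1))"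

definition cyclic_homology ::
  "('r, 'k) ring_scheme \<Rightarrow> ('r, 'c) cyclic_module \<Rightarrow> nat \<Rightarrow> ('r, (nat \<Rightarrow> 'c) set) module"
  where "cyclic_homology R C n =
    quot_module ((Tot C n)\<lparr>carrier := tot_cycles R C n\<rparr>) (tot_boundaries R C n)"

section \<open>The cyclic module of an algebra\<close>

text \<open>Replaces the entries at the adjacent list positions \<open>j\<close> and \<open>j + 1\<close> by their product.\<close>

definition merge_at :: "('a, 'm) monoid_scheme \<Rightarrow> nat \<Rightarrow> 'a list \<Rightarrow> 'a list"
  where "merge_at A j xs = take j xs @ [xs ! j \<otimes>\<^bsub>A\<^esub> xs ! (j + 1)] @ drop (j + 2) xs"

definition insert_at :: "nat \<Rightarrow> 'a \<Rightarrow> 'a list \<Rightarrow> 'a list"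
  where "insert_at j a xs = take j xs @ [a] @ drop j xs"

definition alg_face :: "('a, 'm) monoid_scheme \<Rightarrow> nat \<Rightarrow> nat \<Rightarrow> 'a list \<Rightarrow> 'a list"
  where "alg_face A n i as =
    (if i < n then merge_at A i as else (as ! n \<otimes>\<^bsub>A\<^esub> as ! 0) # butlast (tl as))"

definition alg_cyc :: "'a list \<Rightarrow> 'a list"
  where "alg_cyc as = last as # butlast as"

text \<open>
  The cyclic module of a unital associative (not necessarily commutative) \<open>R\<close>-algebra \<open>A\<close>, with
  \<open>n + 1\<close> tensor factors in degree \<open>n\<close>;
  \<open>a\<^sub>0 \<otimes> \<dots> \<otimes> a\<^sub>n\<close> is \<open>pure_tensor R A [a\<^sub>0, \<dots>, a\<^sub>n]\<close>.
\<close>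

definition algebra_cyclic ::
  "('r, 'k) ring_scheme \<Rightarrow> ('r, 'a, 'm) module_scheme \<Rightarrow> ('r, ('a list \<Rightarrow> 'r) set) cyclic_module"
  where "algebra_cyclic R A =
    (let
       C = (\<lambda>n. tensor_power R A (n + 1));
       op = (\<lambda>n m \<phi>. linear_extension R (C n) (C m) (tuples (n + 1) (carrier A))
               (pure_tensor R A) (pure_tensor R A \<circ> \<phi>))
     in
       \<lparr>Deg = C,
        Face = (\<lambda>n i. op n (n - 1) (alg_face A n i)),
        Degen = (\<lambda>n i. op n (n + 1) (insert_at (i + 1) \<one>\<^bsub>A\<^esub>)),
        Cyc = (\<lambda>n. op n n alg_cyc)\<rparr>)"

section \<open>Group algebras and the Connes-Moscovici cyclic module\<close>

definition group_algebra ::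
  "('r, 'k) ring_scheme \<Rightarrow> ('g, 'l) monoid_scheme \<Rightarrow> ('r, 'g \<Rightarrow> 'r) module"
  where "group_algebra R G = (free_module R (carrier G))
    \<lparr>monoid.mult := (\<lambda>f h g. finsum R (\<lambda>(x, y). f x \<otimes>\<^bsub>R\<^esub> h y)
        {(x, y). x \<in> carrier G \<and> y \<in> carrier G \<and> f x \<noteq> \<zero>\<^bsub>R\<^esub> \<and> h y \<noteq> \<zero>\<^bsub>R\<^esub> \<and> x \<otimes>\<^bsub>G\<^esub> y = g}),
     one := gen R \<one>\<^bsub>G\<^esub>\<rparr>"

definition group_tensor ::
  "('r, 'k) ring_scheme \<Rightarrow> ('g, 'l) monoid_scheme \<Rightarrow> 'g list \<Rightarrow> (('g \<Rightarrow> 'r) list \<Rightarrow> 'r) set"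
  where "group_tensor R L gs = pure_tensor R (group_algebra R L) (map (gen R) gs)"

definition hopf_face :: "('g, 'l) monoid_scheme \<Rightarrow> nat \<Rightarrow> nat \<Rightarrow> 'g list \<Rightarrow> 'g list"
  where "hopf_face L n i gs =
    (if i = 0 then tl gs else if i < n then merge_at L (i - 1) gs else butlast gs)"

definition hopf_cyc :: "('g, 'l) monoid_scheme \<Rightarrow> 'g \<Rightarrow> nat \<Rightarrow> 'g list \<Rightarrow> 'g list"
  where "hopf_cyc L \<pi> n gs =
    (if n = 0 then gs
     else (\<pi> \<otimes>\<^bsub>L\<^esub> inv\<^bsub>L\<^esub> (foldr (\<otimes>\<^bsub>L\<^esub>) gs \<one>\<^bsub>L\<^esub>)) # butlast gs)"

text \<open>
  The Connes-Moscovici cyclic module of the Hopf algebra of a group \<open>L\<close>, for the grouplike element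
  given by a central \<open>\<pi> \<in> L\<close> and with both characters equal to the counit.  The operators are the
  linear extensions from tensors \<open>g\<^sub>1 \<otimes> \<dots> \<otimes> g\<^sub>n\<close> of group elements; \<open>g\<^sub>i\<close> is at list position \<open>i - 1\<close>.
\<close>

definition hopf_cyclic ::
  "('r, 'k) ring_scheme \<Rightarrow> ('g, 'l) monoid_scheme \<Rightarrow> 'g \<Rightarrow>
   ('r, (('g \<Rightarrow> 'r) list \<Rightarrow> 'r) set) cyclic_module"
  where "hopf_cyclic R L \<pi> =
    (let
       C = (\<lambda>n. tensor_power R (group_algebra R L) n);
       op = (\<lambda>n m \<phi>. linear_extension R (C n) (C m) (tuples n (carrier L))
               (group_tensor R L) (group_tensor R L \<circ> \<phi>))
     in
       \<lparr>Deg = C,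
        Face = (\<lambda>n i. op n (n - 1) (hopf_face L n i)),
        Degen = (\<lambda>n i. op n (n + 1) (insert_at i \<one>\<^bsub>L\<^esub>)),
        Cyc = (\<lambda>n. op n n (hopf_cyc L \<pi> n))\<rparr>)"

definition conj_classes :: "('g, 'l) monoid_scheme \<Rightarrow> 'g set set"
  where "conj_classes G =
    orbits G (carrier G) (\<lambda>g. \<lambda>h\<in>carrier G. g \<otimes>\<^bsub>G\<^esub> h \<otimes>\<^bsub>G\<^esub> inv\<^bsub>G\<^esub> g)"

definition centralizer :: "('g, 'l) monoid_scheme \<Rightarrow> 'g \<Rightarrow> ('g, 'l) monoid_scheme"
  where "centralizer G \<pi> = G\<lparr>carrier := {g \<in> carrier G. g \<otimes>\<^bsub>G\<^esub> \<pi> = \<pi> \<otimes>\<^bsub>G\<^esub> g}\<rparr>"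

end

theory Submission
  imports Defs "HOL-Algebra.Free_Abelian_Groups"
begin

text \<open>
  The degree \<open>n\<close> part of the cyclic module of \<open>kG\<close> is free on the tuples \<open>(g\<^sub>0, \<dots>, g\<^sub>n)\<close> of group
  elements, and faces and rotation send tuples to tuples: it is the linearization of a cyclic set.
  These operations change the product \<open>g\<^sub>0 \<cdots> g\<^sub>n\<close> at most by conjugation, so the cyclic set splits
  into one piece for each conjugacy class.

  Fix a class with representative \<open>\<pi>\<close> and consider the groupoid with the elements of the class as
  objects and with an arrow \<open>g\<close> from \<open>h\<close> to \<open>g\<^sup>-\<^sup>1 h g\<close> for every group element \<open>g\<close>.  A tuple with
  product in the class is a closed path \<open>h\<^sub>0 \<rightarrow> h\<^sub>1 \<rightarrow> \<dots> \<rightarrow> h\<^sub>n \<rightarrow> h\<^sub>0\<close> with arrows \<open>g\<^sub>0, \<dots>, g\<^sub>n\<close>, where \<open>h\<^sub>i\<close>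
  is the product of the tuple read cyclically from position \<open>i\<close>.  The groupoid is connected and \<open>\<pi>\<close>
  has automorphism group \<open>G\<^sub>\<pi>\<close>.  Choosing \<open>\<gamma>(h)\<close> with \<open>\<gamma>(h) h \<gamma>(h)\<^sup>-\<^sup>1 = \<pi>\<close> for every \<open>h\<close>, and \<open>\<gamma>(\<pi>) = 1\<close>,
  yields the retraction \<open>g\<^sub>i \<mapsto> \<gamma>(h\<^sub>i) g\<^sub>i \<gamma>(h\<^sub>i\<^sub>+\<^sub>1)\<^sup>-\<^sup>1\<close> onto the closed paths at \<open>\<pi>\<close>.  The formula treats all
  positions alike, so that it is a retraction of cyclic sets (\<open>retract_alg_face\<close>, \<open>retract_alg_cyc\<close>).
  Its image consists of the tuples in \<open>G\<^sub>\<pi>\<close> with product \<open>\<pi>\<close>.  Dropping the first entry, which is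
  determined by the others, turns their faces and rotation into those of the Connes-Moscovici cyclic
  module of \<open>kG\<^sub>\<pi>\<close> (\<open>tl_alg_face\<close>, \<open>tl_alg_cyc\<close>).

  Hence the cyclic modules of the \<open>kG\<^sub>\<pi>\<close> together form a direct summand, and it remains to show that
  the common kernel of the projections has no homology.  The arrows \<open>\<gamma>(h)\<close> form a natural
  transformation from the identity to the retraction, which induces a prism homotopy for \<open>b\<close>
  (\<open>prism_homotopy\<close>), and putting a unit in front is a contracting homotopy for \<open>b'\<close>
  (\<open>unit_homotopy\<close>).  So all columns of the bicomplex of the kernel are exact.  The prism homotopy
  does not commute with rotation, but in a first-quadrant bicomplex exactness of the columns alone
  forces exactness of the total complex (\<open>total_exact_if_columns_exact\<close>).  The passage to homology is
  \<open>homology_decomposition\<close>.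

  Two devices connect this with the modules at hand.  Tensor powers of a module with a basis again
  have a basis (\<open>tensor_based_basis\<close>), so that linear maps are determined by, and can be prescribed on,
  tuples of group elements.  Identities between alternating sums of such maps are proved once for
  integral combinations of tuples, in a free abelian group, and are transferred to the modules by the
  relation \<open>represents\<close>.
\<close>

section \<open>Linear maps, quotients and direct sums\<close>

context abelian_group
begin

lemma diff_zero: "x \<in> carrier G \<Longrightarrow> x \<ominus> \<zero> = x"
  using minus_equality[of \<zero> \<zero>] by (simp add: a_minus_def)

lemma diff_add_cancel:
  assumes "x \<in> carrier G" "y \<in> carrier G" shows "(x \<ominus> y) \<oplus> y = x"
  using assms by (simp add: a_minus_def a_assoc l_neg)

lemma diff_self: "x \<in> carrier G \<Longrightarrow> x \<ominus> x = \<zero>"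
  by (simp add: a_minus_def r_neg)

lemma eq_if_diff_zero:
  assumes "x \<in> carrier G" "y \<in> carrier G" "x \<ominus> y = \<zero>" shows "x = y"
  using diff_add_cancel[OF assms(1,2)] assms by simp

end

lemma (in abelian_monoid) finsum_delta:
  assumes "finite F" "v \<in> carrier G"
  shows "finsum G (\<lambda>j. if j = i then v else \<zero>) F = (if i \<in> F then v else \<zero>)"
proof (cases "i \<in> F")
  case True
  then show ?thesis using add.finprod_singleton_swap[OF True assms(1), of "\<lambda>_. v"] assms(2) by simp
next
  case False
  then have "finsum G (\<lambda>j. if j = i then v else \<zero>) F = \<zero>" by (intro add.finprod_one_eqI) auto
  then show ?thesis using False by simp
qed

lemma mod_homI:
  assumes "\<And>x. x \<in> carrier M \<Longrightarrow> h x \<in> carrier N"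
    and "\<And>x y. x \<in> carrier M \<Longrightarrow> y \<in> carrier M \<Longrightarrow> h (x \<oplus>\<^bsub>M\<^esub> y) = h x \<oplus>\<^bsub>N\<^esub> h y"
    and "\<And>r x. r \<in> carrier R \<Longrightarrow> x \<in> carrier M \<Longrightarrow> h (r \<odot>\<^bsub>M\<^esub> x) = r \<odot>\<^bsub>N\<^esub> h x"
  shows "h \<in> mod_hom R M N"
  using assms by (auto simp: mod_hom_def)

lemma mod_homD:
  assumes "h \<in> mod_hom R M N"
  shows "x \<in> carrier M \<Longrightarrow> h x \<in> carrier N"
    and "x \<in> carrier M \<Longrightarrow> y \<in> carrier M \<Longrightarrow> h (x \<oplus>\<^bsub>M\<^esub> y) = h x \<oplus>\<^bsub>N\<^esub> h y"
    and "r \<in> carrier R \<Longrightarrow> x \<in> carrier M \<Longrightarrow> h (r \<odot>\<^bsub>M\<^esub> x) = r \<odot>\<^bsub>N\<^esub> h x"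
  using assms by (auto simp: mod_hom_def)

lemma mod_hom_cong:
  assumes "h \<in> mod_hom R M N" "module R M" "\<And>x. x \<in> carrier M \<Longrightarrow> g x = h x"
  shows "g \<in> mod_hom R M N"
proof -
  interpret M: module R M by fact
  show ?thesis using assms by (auto simp: mod_hom_def)
qed

lemma mod_hom_zero:
  assumes "module R M" "module R N" "h \<in> mod_hom R M N"
  shows "h \<zero>\<^bsub>M\<^esub> = \<zero>\<^bsub>N\<^esub>"
proof -
  interpret M: module R M by fact
  interpret N: module R N by fact
  have "h \<zero>\<^bsub>M\<^esub> = h (\<zero>\<^bsub>R\<^esub> \<odot>\<^bsub>M\<^esub> \<zero>\<^bsub>M\<^esub>)" by simp
  also have "\<dots> = \<zero>\<^bsub>N\<^esub>"
    using mod_homD[OF assms(3)] by (metis M.M.zero_closed M.R.zero_closed N.smult_l_null)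
  finally show ?thesis .
qed

lemma (in module) minus_one_smult:
  assumes "x \<in> carrier M" shows "(\<ominus> \<one>) \<odot>\<^bsub>M\<^esub> x = \<ominus>\<^bsub>M\<^esub> x"
  using assms by (simp add: smult_l_minus)

lemma mod_hom_minus:
  assumes "module R M" "module R N" "h \<in> mod_hom R M N" "x \<in> carrier M"
  shows "h (\<ominus>\<^bsub>M\<^esub> x) = \<ominus>\<^bsub>N\<^esub> h x"
proof -
  interpret M: module R M by fact
  interpret N: module R N by fact
  show ?thesis
    using mod_homD[OF assms(3)] assms(4) M.minus_one_smult N.minus_one_smult
    by (metis M.R.add.inv_closed M.R.one_closed)
qed

lemma mod_hom_diff:
  assumes "module R M" "module R N" "h \<in> mod_hom R M N" "x \<in> carrier M" "y \<in> carrier M"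
  shows "h (x \<ominus>\<^bsub>M\<^esub> y) = h x \<ominus>\<^bsub>N\<^esub> h y"
proof -
  interpret M: module R M by fact
  show ?thesis
    using assms mod_homD[OF assms(3)] by (simp add: a_minus_def mod_hom_minus)
qed

lemma mod_hom_finsum:
  assumes "module R M" "module R N" "h \<in> mod_hom R M N" "finite A" "f \<in> A \<rightarrow> carrier M"
  shows "h (finsum M f A) = finsum N (\<lambda>i. h (f i)) A"
proof -
  interpret M: module R M by fact
  interpret N: module R N by fact
  note h = mod_homD[OF assms(3)]
  show ?thesis using assms(4,5)
  proof (induction A)
    case empty then show ?case using mod_hom_zero[OF assms(1-3)] by simp
  next
    case (insert a A)
    then have "h (finsum M f (insert a A)) = h (f a) \<oplus>\<^bsub>N\<^esub> h (finsum M f A)"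
      by (simp add: h Pi_iff)
    also have "\<dots> = finsum N (\<lambda>i. h (f i)) (insert a A)"
      using insert h(1) by (simp add: Pi_iff)
    finally show ?case .
  qed
qed

lemma mod_hom_id: "(\<lambda>x. x) \<in> mod_hom R M M"
  by (auto simp: mod_hom_def)

lemma mod_hom_comp:
  assumes "g \<in> mod_hom R M N" "h \<in> mod_hom R N P"
  shows "(\<lambda>x. h (g x)) \<in> mod_hom R M P"
  using assms by (auto simp: mod_hom_def Pi_iff)

lemma mod_hom_const_zero:
  assumes "module R N" shows "(\<lambda>x. \<zero>\<^bsub>N\<^esub>) \<in> mod_hom R M N"
proof -
  interpret N: module R N by fact
  show ?thesis by (auto simp: mod_hom_def)
qed

lemma mod_hom_plus:
  assumes "module R N" "g \<in> mod_hom R M N" "h \<in> mod_hom R M N"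
  shows "(\<lambda>x. g x \<oplus>\<^bsub>N\<^esub> h x) \<in> mod_hom R M N"
proof -
  interpret N: module R N by fact
  show ?thesis
    using mod_homD[OF assms(2)] mod_homD[OF assms(3)]
    by (intro mod_homI) (auto simp: N.smult_r_distr N.M.a_ac)
qed

lemma mod_hom_scale:
  assumes "module R N" "g \<in> mod_hom R M N" "r \<in> carrier R"
  shows "(\<lambda>x. r \<odot>\<^bsub>N\<^esub> g x) \<in> mod_hom R M N"
proof -
  interpret N: module R N by fact
  show ?thesis
    using mod_homD[OF assms(2)] assms(3)
    by (intro mod_homI) (auto simp: N.smult_r_distr N.smult_assoc1[symmetric] N.R.m_comm)
qed

lemma mod_hom_neg:
  assumes "module R N" "g \<in> mod_hom R M N"
  shows "(\<lambda>x. \<ominus>\<^bsub>N\<^esub> g x) \<in> mod_hom R M N"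
proof -
  interpret N: module R N by fact
  show ?thesis
    using mod_homD[OF assms(2)]
    by (intro mod_homI) (auto simp: N.M.minus_add N.smult_r_minus)
qed

lemma mod_hom_sub:
  assumes "module R N" "g \<in> mod_hom R M N" "h \<in> mod_hom R M N"
  shows "(\<lambda>x. g x \<ominus>\<^bsub>N\<^esub> h x) \<in> mod_hom R M N"
  unfolding a_minus_def by (intro mod_hom_plus mod_hom_neg assms)

lemma mod_hom_sum:
  assumes "module R N" "finite A" "\<And>i. i \<in> A \<Longrightarrow> g i \<in> mod_hom R M N"
  shows "(\<lambda>x. finsum N (\<lambda>i. g i x) A) \<in> mod_hom R M N"
proof -
  interpret N: module R N by fact
  note g = mod_homD[OF assms(3)]
  show ?thesis
  proof (rule mod_homI)
    fix x y assume x: "x \<in> carrier M" and y: "y \<in> carrier M"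
    have "finsum N (\<lambda>i. g i (x \<oplus>\<^bsub>M\<^esub> y)) A = finsum N (\<lambda>i. g i x \<oplus>\<^bsub>N\<^esub> g i y) A"
      using g x y by (intro N.M.finsum_cong') auto
    also have "\<dots> = finsum N (\<lambda>i. g i x) A \<oplus>\<^bsub>N\<^esub> finsum N (\<lambda>i. g i y) A"
      using g x y by (intro N.M.finsum_addf) auto
    finally show "finsum N (\<lambda>i. g i (x \<oplus>\<^bsub>M\<^esub> y)) A =
      finsum N (\<lambda>i. g i x) A \<oplus>\<^bsub>N\<^esub> finsum N (\<lambda>i. g i y) A" .
  next
    fix r x assume r: "r \<in> carrier R" and x: "x \<in> carrier M"
    have "finsum N (\<lambda>i. g i (r \<odot>\<^bsub>M\<^esub> x)) A = finsum N (\<lambda>i. r \<odot>\<^bsub>N\<^esub> g i x) A"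
      using g r x by (intro N.M.finsum_cong') auto
    also have "\<dots> = r \<odot>\<^bsub>N\<^esub> finsum N (\<lambda>i. g i x) A"
      using g r x assms(2) by (subst N.finsum_smult_ldistr) auto
    finally show "finsum N (\<lambda>i. g i (r \<odot>\<^bsub>M\<^esub> x)) A = r \<odot>\<^bsub>N\<^esub> finsum N (\<lambda>i. g i x) A" .
  qed (use g in \<open>auto intro!: N.M.finsum_closed\<close>)
qed

lemma mod_hom_restrict_submodule:
  assumes "h \<in> mod_hom R M N" "H \<subseteq> carrier M" "\<And>x. x \<in> H \<Longrightarrow> h x \<in> K"
  shows "h \<in> mod_hom R (M\<lparr>carrier := H\<rparr>) (N\<lparr>carrier := K\<rparr>)"
  using assms by (auto simp: mod_hom_def subset_iff)

lemma submodule_kernel: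
  assumes "module R M" "module R N" "h \<in> mod_hom R M N"
  shows "submodule {x \<in> carrier M. h x = \<zero>\<^bsub>N\<^esub>} R M"
proof -
  interpret M: module R M by fact
  interpret N: module R N by fact
  note h = mod_homD[OF assms(3)]
  show ?thesis
    by (rule M.submoduleI) (auto simp: h mod_hom_zero[OF assms] mod_hom_minus[OF assms])
qed

lemma submodule_image:
  assumes "module R M" "module R N" "h \<in> mod_hom R M N"
  shows "submodule (h ` carrier M) R N"
proof -
  interpret M: module R M by fact
  interpret N: module R N by fact
  note h = mod_homD[OF assms(3)]
  show ?thesis
  proof (rule N.submoduleI)
    show "\<zero>\<^bsub>N\<^esub> \<in> h ` carrier M"
      by (metis M.M.zero_closed assms image_eqI mod_hom_zero)
  qed (auto simp: h(1) simp flip: mod_hom_minus[OF assms] h(2,3))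
qed

subsection \<open>Quotient modules\<close>

context
  fixes R :: "('r, 'k) ring_scheme" and M :: "('r, 'a, 'm) module_scheme" and N
  assumes M: "module R M" and N: "submodule N R M"
begin

interpretation M: module R M by (fact M)

interpretation N: abelian_subgroup N M
  using N M.abelian_group_axioms
  by (auto simp: submodule_def intro!: abelian_subgroupI3 additive_subgroup.intro)

lemma quot_module_zero: "\<zero>\<^bsub>quot_module M N\<^esub> = N"
  by (simp add: quot_module_def)

lemma quot_module_carrier: "carrier (quot_module M N) = (\<lambda>x. N +>\<^bsub>M\<^esub> x) ` carrier M"
  by (auto simp: quot_module_def A_RCOSETS_def')

lemma coset_zero: "N +>\<^bsub>M\<^esub> \<zero>\<^bsub>M\<^esub> = N"
  by (simp add: N.a_subset)

lemma coset_add: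
  "x \<in> carrier M \<Longrightarrow> y \<in> carrier M \<Longrightarrow>
    (N +>\<^bsub>M\<^esub> x) \<oplus>\<^bsub>quot_module M N\<^esub> (N +>\<^bsub>M\<^esub> y) = N +>\<^bsub>M\<^esub> (x \<oplus>\<^bsub>M\<^esub> y)"
  by (simp add: quot_module_def N.a_rcos_sum)

lemma coset_self: "x \<in> carrier M \<Longrightarrow> x \<in> N +>\<^bsub>M\<^esub> x"
  by (rule N.a_rcos_self)

lemma coset_eq_iff:
  assumes "x \<in> carrier M" "y \<in> carrier M"
  shows "N +>\<^bsub>M\<^esub> x = N +>\<^bsub>M\<^esub> y \<longleftrightarrow> x \<ominus>\<^bsub>M\<^esub> y \<in> N"
  using assms N.a_repr_independence' N.a_repr_independenceD N.a_rcos_module coset_self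
  unfolding a_minus_def by metis

lemma coset_smult:
  assumes r: "r \<in> carrier R" and x: "x \<in> carrier M"
  shows "r \<odot>\<^bsub>quot_module M N\<^esub> (N +>\<^bsub>M\<^esub> x) = N +>\<^bsub>M\<^esub> (r \<odot>\<^bsub>M\<^esub> x)"
proof -
  have "N +>\<^bsub>M\<^esub> (r \<odot>\<^bsub>M\<^esub> y) = N +>\<^bsub>M\<^esub> (r \<odot>\<^bsub>M\<^esub> x)" if y: "y \<in> N +>\<^bsub>M\<^esub> x" for y
  proof -
    have yM: "y \<in> carrier M" using y x N.a_elemrcos_carrier by blast
    have "y \<ominus>\<^bsub>M\<^esub> x \<in> N" using y x yM N.a_rcos_module by (simp add: a_minus_def)
    then have "r \<odot>\<^bsub>M\<^esub> (y \<ominus>\<^bsub>M\<^esub> x) \<in> N" using r N submodule.smult_closed by fast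
    then have "r \<odot>\<^bsub>M\<^esub> y \<ominus>\<^bsub>M\<^esub> r \<odot>\<^bsub>M\<^esub> x \<in> N"
      using r x yM by (simp add: a_minus_def M.smult_r_distr M.smult_r_minus)
    then show ?thesis using r x yM by (simp add: coset_eq_iff)
  qed
  then have "(\<Union>y\<in>N +>\<^bsub>M\<^esub> x. N +>\<^bsub>M\<^esub> (r \<odot>\<^bsub>M\<^esub> y)) = N +>\<^bsub>M\<^esub> (r \<odot>\<^bsub>M\<^esub> x)"
    using coset_self[OF x] by blast
  then show ?thesis by (simp add: quot_module_def)
qed

lemma quot_module_module: "module R (quot_module M N)"
proof (intro moduleI abelian_groupI)
  show "cring R" by (rule M.R.cring_axioms)
  fix x assume "x \<in> carrier (quot_module M N)"
  then obtain a where a: "a \<in> carrier M" "x = N +>\<^bsub>M\<^esub> a" by (auto simp: quot_module_carrier)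
  have "(N +>\<^bsub>M\<^esub> (\<ominus>\<^bsub>M\<^esub> a)) \<oplus>\<^bsub>quot_module M N\<^esub> x = \<zero>\<^bsub>quot_module M N\<^esub>"
    using a by (simp add: coset_add M.M.l_neg coset_zero quot_module_zero)
  then show "\<exists>y\<in>carrier (quot_module M N). y \<oplus>\<^bsub>quot_module M N\<^esub> x = \<zero>\<^bsub>quot_module M N\<^esub>"
    using a by (auto simp: quot_module_carrier)
  have "(N +>\<^bsub>M\<^esub> \<zero>\<^bsub>M\<^esub>) \<oplus>\<^bsub>quot_module M N\<^esub> x = x"
    using a coset_add[of "\<zero>\<^bsub>M\<^esub>" a] by simp
  then show "\<zero>\<^bsub>quot_module M N\<^esub> \<oplus>\<^bsub>quot_module M N\<^esub> x = x"
    unfolding coset_zero quot_module_zero .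
qed (auto simp: quot_module_carrier coset_add coset_smult M.M.a_ac M.smult_l_distr M.smult_r_distr
        M.smult_assoc1, metis coset_zero imageI M.M.zero_closed quot_module_zero)

lemma coset_hom: "(\<lambda>x. N +>\<^bsub>M\<^esub> x) \<in> mod_hom R M (quot_module M N)"
  by (intro mod_homI) (auto simp: quot_module_carrier coset_add coset_smult)

lemma coset_eq_zero_iff:
  assumes "x \<in> carrier M"
  shows "N +>\<^bsub>M\<^esub> x = \<zero>\<^bsub>quot_module M N\<^esub> \<longleftrightarrow> x \<in> N"
  using coset_eq_iff[OF assms M.M.zero_closed] M.M.diff_zero[OF assms]
  unfolding coset_zero quot_module_zero by simp

text \<open>
  The value at any element of a coset will do, because the map is constant on cosets of its kernel.
\<close>

lemma quot_module_lift:
  assumes P: "module R P" and h: "h \<in> mod_hom R M P" and null: "\<And>x. x \<in> N \<Longrightarrow> h x = \<zero>\<^bsub>P\<^esub>"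
  shows "\<exists>g \<in> mod_hom R (quot_module M N) P. \<forall>x\<in>carrier M. g (N +>\<^bsub>M\<^esub> x) = h x"
proof -
  interpret P: module R P by fact
  note hh = mod_homD[OF h]
  define g where "g = (\<lambda>X. h (SOME x. x \<in> X))"
  have g: "g (N +>\<^bsub>M\<^esub> x) = h x" if x: "x \<in> carrier M" for x
  proof -
    define y where "y = (SOME y. y \<in> N +>\<^bsub>M\<^esub> x)"
    have y: "y \<in> N +>\<^bsub>M\<^esub> x" unfolding y_def using coset_self[OF x] by (rule someI)
    have yM: "y \<in> carrier M" using y x N.a_elemrcos_carrier by blast
    have "y \<ominus>\<^bsub>M\<^esub> x \<in> N" using y x yM N.a_rcos_module by (simp add: a_minus_def)
    then have "h y \<ominus>\<^bsub>P\<^esub> h x = \<zero>\<^bsub>P\<^esub>" using null mod_hom_diff[OF M P h yM x] by metis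
    then have "h y = h x" using hh(1)[OF x] hh(1)[OF yM] P.M.eq_if_diff_zero by blast
    then show ?thesis by (simp add: g_def y_def)
  qed
  have "g \<in> mod_hom R (quot_module M N) P"
    using g hh by (intro mod_homI) (auto simp: quot_module_carrier coset_add coset_smult)
  with g show ?thesis by blast
qed

end

lemma submodule_restrict:
  assumes "module R M" "submodule Z R M" "submodule B R M" "B \<subseteq> Z"
  shows "submodule B R (M\<lparr>carrier := Z\<rparr>)"
proof -
  interpret M: module R M by fact
  interpret Z: module R "M\<lparr>carrier := Z\<rparr>"
    using submodule.submodule_is_module assms by blast
  interpret M1: module R "M\<lparr>carrier := B\<rparr>"
    using submodule.submodule_is_module assms by blast
  show ?thesis
    by (rule Z.module_incl_imp_submodule) (use assms(4) M1.module_axioms in auto)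
qed

subsection \<open>Direct sums\<close>

lemma dsum_module_simps:
  "\<zero>\<^bsub>dsum_module I M\<^esub> = (\<lambda>i\<in>I. \<zero>\<^bsub>M i\<^esub>)"
  "x \<oplus>\<^bsub>dsum_module I M\<^esub> y = (\<lambda>i\<in>I. x i \<oplus>\<^bsub>M i\<^esub> y i)"
  "r \<odot>\<^bsub>dsum_module I M\<^esub> x = (\<lambda>i\<in>I. r \<odot>\<^bsub>M i\<^esub> x i)"
  by (simp_all add: dsum_module_def)

lemma dsum_module_carrier_iff:
  "x \<in> carrier (dsum_module I M) \<longleftrightarrow>
    x \<in> (\<Pi>\<^sub>E i\<in>I. carrier (M i)) \<and> finite {i \<in> I. x i \<noteq> \<zero>\<^bsub>M i\<^esub>}"
  by (simp add: dsum_module_def)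

lemma dsum_module_finite_carrier:
  "finite I \<Longrightarrow> carrier (dsum_module I M) = (\<Pi>\<^sub>E i\<in>I. carrier (M i))"
  by (simp add: dsum_module_def)

lemma dsum_module_module:
  assumes "cring R" "finite I" "\<And>i. i \<in> I \<Longrightarrow> module R (M i)"
  shows "module R (dsum_module I M)"
proof -
  have M: "abelian_group (M i)" if "i \<in> I" for i using assms(3)[OF that] by (simp add: module_def)
  note ab = abelian_groupE[OF M]
  note md = module.smult_closed[OF assms(3)] module.smult_l_distr[OF assms(3)]
    module.smult_r_distr[OF assms(3)] module.smult_assoc1[OF assms(3)] module.smult_one[OF assms(3)]
  have c: "x \<in> carrier (dsum_module I M) \<Longrightarrow> i \<in> I \<Longrightarrow> x i \<in> carrier (M i)" for x i
    by (auto simp: dsum_module_carrier_iff)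
  have e: "x \<in> carrier (dsum_module I M) \<Longrightarrow> x \<in> extensional I" for x
    by (auto simp: dsum_module_carrier_iff PiE_def)
  have "abelian_group (dsum_module I M)"
  proof (rule abelian_groupI)
    fix x assume x: "x \<in> carrier (dsum_module I M)"
    have "(\<lambda>i\<in>I. \<ominus>\<^bsub>M i\<^esub> x i) \<oplus>\<^bsub>dsum_module I M\<^esub> x = \<zero>\<^bsub>dsum_module I M\<^esub>"
      using c[OF x] M by (auto simp: dsum_module_simps abelian_group.l_neg intro!: restrict_ext)
    moreover have "(\<lambda>i\<in>I. \<ominus>\<^bsub>M i\<^esub> x i) \<in> carrier (dsum_module I M)"
      using c[OF x] M by (auto simp: dsum_module_finite_carrier assms(2) intro: abelian_group.a_inv_closed)
    ultimately show "\<exists>y\<in>carrier (dsum_module I M). y \<oplus>\<^bsub>dsum_module I M\<^esub> x = \<zero>\<^bsub>dsum_module I M\<^esub>"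
      by blast
    show "\<zero>\<^bsub>dsum_module I M\<^esub> \<oplus>\<^bsub>dsum_module I M\<^esub> x = x"
      using c[OF x] e[OF x] ab by (auto simp: dsum_module_simps extensional_def)
  next
    fix x y assume "x \<in> carrier (dsum_module I M)" "y \<in> carrier (dsum_module I M)"
    then show "x \<oplus>\<^bsub>dsum_module I M\<^esub> y = y \<oplus>\<^bsub>dsum_module I M\<^esub> x"
      using c ab by (auto simp: dsum_module_simps intro!: restrict_ext)
  next
    fix x y z
    assume "x \<in> carrier (dsum_module I M)" "y \<in> carrier (dsum_module I M)" "z \<in> carrier (dsum_module I M)"
    then show "x \<oplus>\<^bsub>dsum_module I M\<^esub> y \<oplus>\<^bsub>dsum_module I M\<^esub> z = x \<oplus>\<^bsub>dsum_module I M\<^esub> (y \<oplus>\<^bsub>dsum_module I M\<^esub> z)"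
      using c ab(3) by (auto simp: dsum_module_simps intro!: restrict_ext)
  qed (use assms(2) c ab in \<open>auto simp: dsum_module_finite_carrier dsum_module_simps\<close>)
  then show ?thesis
    using assms(1,2) c md
    by (intro moduleI) (auto simp: dsum_module_finite_carrier dsum_module_simps
        PiE_def extensional_def fun_eq_iff Pi_iff)
qed

text \<open>
  Jointly the components \<open>f i\<close> detect \<open>N\<close>, which makes the induced map injective.  Surjectivity only
  has to be known one coordinate at a time, since an element of the direct sum has finite support and
  is hit by a sum of preimages of its nonzero coordinates.
\<close>

lemma quotient_direct_sum_iso:
  fixes R :: "('r, 'k) ring_scheme" and M :: "('r, 'a, 'm) module_scheme"
    and M' :: "'i \<Rightarrow> ('r, 'b, 'n) module_scheme"
  assumes M: "module R M" "submodule N R M"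
    and M': "\<And>i. i \<in> I \<Longrightarrow> module R (M' i)" "\<And>i. i \<in> I \<Longrightarrow> submodule (N' i) R (M' i)"
    and f: "\<And>i. i \<in> I \<Longrightarrow> f i \<in> mod_hom R M (M' i)"
    and fin: "\<And>x. x \<in> carrier M \<Longrightarrow> finite {i \<in> I. f i x \<notin> N' i}"
    and ker: "\<And>x. x \<in> carrier M \<Longrightarrow> x \<in> N \<longleftrightarrow> (\<forall>i\<in>I. f i x \<in> N' i)"
    and surj: "\<And>i y. i \<in> I \<Longrightarrow> y \<in> carrier (M' i) \<Longrightarrow>
       \<exists>x\<in>carrier M. f i x = y \<and> (\<forall>j\<in>I. j \<noteq> i \<longrightarrow> f j x = \<zero>\<^bsub>M' j\<^esub>)"
  shows "\<exists>\<Phi>. \<Phi> \<in> mod_iso R (quot_module M N) (dsum_module I (\<lambda>i. quot_module (M' i) (N' i)))"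
proof -
  interpret M: module R M by fact
  let ?D = "dsum_module I (\<lambda>i. quot_module (M' i) (N' i))"
  note fD = mod_homD[OF f]
  have "\<exists>g. g \<in> mod_hom R (quot_module M N) (quot_module (M' i) (N' i)) \<and>
      (\<forall>x\<in>carrier M. g (N +>\<^bsub>M\<^esub> x) = N' i +>\<^bsub>M' i\<^esub> f i x)" if i: "i \<in> I" for i
  proof -
    have "(\<lambda>x. N' i +>\<^bsub>M' i\<^esub> f i x) \<in> mod_hom R M (quot_module (M' i) (N' i))"
      by (rule mod_hom_comp[OF f[OF i] coset_hom[OF M'(1)[OF i] M'(2)[OF i]]])
    moreover have "N' i +>\<^bsub>M' i\<^esub> f i x = \<zero>\<^bsub>quot_module (M' i) (N' i)\<^esub>" if "x \<in> N" for x
    proof -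
      have x: "x \<in> carrier M" using that M.submoduleE(1)[OF M(2)] by auto
      then show ?thesis
        using ker[OF x] that i by (simp add: coset_eq_zero_iff[OF M'(1)[OF i] M'(2)[OF i] fD(1)[OF i x]])
    qed
    ultimately show ?thesis
      unfolding Bex_def[symmetric]
      by (rule quot_module_lift[OF M quot_module_module[OF M'(1)[OF i] M'(2)[OF i]]])
  qed
  then obtain g where
    g: "\<And>i. i \<in> I \<Longrightarrow> g i \<in> mod_hom R (quot_module M N) (quot_module (M' i) (N' i))" and
    gc: "\<And>i x. i \<in> I \<Longrightarrow> x \<in> carrier M \<Longrightarrow> g i (N +>\<^bsub>M\<^esub> x) = N' i +>\<^bsub>M' i\<^esub> f i x"
    by metis
  note gD = mod_homD[OF g]
  define \<Phi> where "\<Phi> = (\<lambda>X. \<lambda>i\<in>I. g i X)"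
  have g0: "g i (N +>\<^bsub>M\<^esub> x) = \<zero>\<^bsub>quot_module (M' i) (N' i)\<^esub> \<longleftrightarrow> f i x \<in> N' i"
    if "i \<in> I" "x \<in> carrier M" for i x
    using coset_eq_zero_iff[OF M'(1)[OF that(1)] M'(2)[OF that(1)] fD(1)[OF that]] gc[OF that] by simp
  note qc = quot_module_carrier[OF M]
  have hom: "\<Phi> \<in> mod_hom R (quot_module M N) ?D"
  proof (rule mod_homI)
    fix X assume X: "X \<in> carrier (quot_module M N)"
    then obtain x where x: "x \<in> carrier M" "X = N +>\<^bsub>M\<^esub> x" by (auto simp: qc)
    have "finite {i \<in> I. \<Phi> X i \<noteq> \<zero>\<^bsub>quot_module (M' i) (N' i)\<^esub>}"
      by (rule finite_subset[OF _ fin[OF x(1)]]) (auto simp: \<Phi>_def x g0)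
    then show "\<Phi> X \<in> carrier ?D" using gD(1)[OF _ X] by (auto simp: dsum_module_carrier_iff \<Phi>_def)
  qed (auto simp: \<Phi>_def dsum_module_simps gD intro!: restrict_ext)
  have inj: "inj_on \<Phi> (carrier (quot_module M N))"
  proof (rule inj_onI)
    fix X Y assume "X \<in> carrier (quot_module M N)" "Y \<in> carrier (quot_module M N)" and eq: "\<Phi> X = \<Phi> Y"
    then obtain x y where x: "x \<in> carrier M" "X = N +>\<^bsub>M\<^esub> x" and y: "y \<in> carrier M" "Y = N +>\<^bsub>M\<^esub> y"
      by (auto simp: qc)
    have "f i (x \<ominus>\<^bsub>M\<^esub> y) \<in> N' i" if i: "i \<in> I" for i
    proof -
      have "g i X = g i Y" using fun_cong[OF eq, of i] i by (simp add: \<Phi>_def)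
      then have "N' i +>\<^bsub>M' i\<^esub> f i x = N' i +>\<^bsub>M' i\<^esub> f i y" using i x y gc by simp
      then have "f i x \<ominus>\<^bsub>M' i\<^esub> f i y \<in> N' i"
        using coset_eq_iff[OF M'(1)[OF i] M'(2)[OF i] fD(1)[OF i x(1)] fD(1)[OF i y(1)]] by simp
      then show ?thesis using mod_hom_diff[OF M(1) M'(1)[OF i] f[OF i] x(1) y(1)] by simp
    qed
    then have "x \<ominus>\<^bsub>M\<^esub> y \<in> N" using ker x y by simp
    then show "X = Y" using coset_eq_iff[OF M] x y by simp
  qed
  have "carrier ?D \<subseteq> \<Phi> ` carrier (quot_module M N)"
  proof
    fix Y assume Y: "Y \<in> carrier ?D"
    have "\<exists>y. y \<in> carrier (M' i) \<and> Y i = N' i +>\<^bsub>M' i\<^esub> y" if i: "i \<in> I" for i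
    proof -
      have "Y i \<in> carrier (quot_module (M' i) (N' i))"
        using Y i by (auto simp: dsum_module_carrier_iff)
      then show ?thesis unfolding quot_module_carrier[OF M'(1)[OF i] M'(2)[OF i]] by auto
    qed
    then obtain y where y: "\<And>i. i \<in> I \<Longrightarrow> y i \<in> carrier (M' i)"
      "\<And>i. i \<in> I \<Longrightarrow> Y i = N' i +>\<^bsub>M' i\<^esub> y i" by metis
    have "\<exists>s. \<forall>i\<in>I. s i \<in> carrier M \<and> f i (s i) = y i \<and> (\<forall>j\<in>I. j \<noteq> i \<longrightarrow> f j (s i) = \<zero>\<^bsub>M' j\<^esub>)"
      using surj y(1) by (intro bchoice) blast
    then obtain s where s: "\<And>i. i \<in> I \<Longrightarrow> s i \<in> carrier M" "\<And>i. i \<in> I \<Longrightarrow> f i (s i) = y i"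
      "\<And>i j. i \<in> I \<Longrightarrow> j \<in> I \<Longrightarrow> j \<noteq> i \<Longrightarrow> f j (s i) = \<zero>\<^bsub>M' j\<^esub>" by metis
    define F where "F = {i \<in> I. Y i \<noteq> \<zero>\<^bsub>quot_module (M' i) (N' i)\<^esub>}"
    have F: "finite F" "F \<subseteq> I" using Y by (auto simp: F_def dsum_module_carrier_iff)
    define x where "x = finsum M s F"
    have x: "x \<in> carrier M" unfolding x_def using s(1) F by (intro M.M.finsum_closed) auto
    have fx: "f i x = (if i \<in> F then y i else \<zero>\<^bsub>M' i\<^esub>)" if i: "i \<in> I" for i
    proof -
      interpret Mi: module R "M' i" by (rule M'(1)[OF i])
      have "f i x = finsum (M' i) (\<lambda>j. f i (s j)) F"
        unfolding x_def using s(1) F by (intro mod_hom_finsum[OF M(1) M'(1)[OF i] f[OF i]]) auto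
      also have "\<dots> = finsum (M' i) (\<lambda>j. if j = i then y i else \<zero>\<^bsub>M' i\<^esub>) F"
        using s F i y(1) by (intro Mi.M.finsum_cong') auto
      also have "\<dots> = (if i \<in> F then y i else \<zero>\<^bsub>M' i\<^esub>)"
        by (rule Mi.M.finsum_delta[OF F(1) y(1)[OF i]])
      finally show ?thesis .
    qed
    have "\<Phi> (N +>\<^bsub>M\<^esub> x) i = Y i" for i
    proof (cases "i \<in> I")
      case True
      have "i \<notin> F \<Longrightarrow> Y i = N' i" using True by (simp add: F_def quot_module_zero[OF M'(1)[OF True] M'(2)[OF True]])
      then show ?thesis
        using True x y(2)[OF True] by (auto simp: \<Phi>_def gc fx coset_zero[OF M'(1)[OF True] M'(2)[OF True]])
    next
      case False
      then show ?thesis using Y by (auto simp: \<Phi>_def dsum_module_carrier_iff PiE_iff extensional_def)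
    qed
    then show "Y \<in> \<Phi> ` carrier (quot_module M N)" using x by (auto simp: qc image_iff fun_eq_iff)
  qed
  then have "bij_betw \<Phi> (carrier (quot_module M N)) (carrier ?D)"
    using inj mod_homD(1)[OF hom] by (auto simp: bij_betw_def)
  then show ?thesis using hom by (auto simp: mod_iso_def)
qed


section \<open>Bases and tensor powers\<close>

lemma submodule_zero:
  assumes "module R M" "submodule H R M"
  shows "\<zero>\<^bsub>M\<^esub> \<in> H"
  using subgroup.one_closed[OF submodule.axioms(1)[OF assms(2)]] by simp

lemma submodule_preimage:
  assumes "module R M" "module R N" "h \<in> mod_hom R M N" "submodule H R N"
  shows "submodule {x \<in> carrier M. h x \<in> H} R M"
proof -
  interpret M: module R M by fact
  interpret N: module R N by fact
  note h = mod_homD[OF assms(3)]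
  note H = N.submoduleE[OF assms(4)]
  have "\<zero>\<^bsub>N\<^esub> \<in> H" by (rule submodule_zero[OF assms(2,4)])
  then show ?thesis
    by (intro M.submoduleI) (auto simp: h H mod_hom_zero[OF assms(1-3)] mod_hom_minus[OF assms(1-3)])
qed

lemma submodule_equalizer:
  assumes "module R M" "module R N" "g \<in> mod_hom R M N" "h \<in> mod_hom R M N"
  shows "submodule {x \<in> carrier M. g x = h x} R M"
proof -
  interpret M: module R M by fact
  interpret N: module R N by fact
  note gh = mod_homD[OF assms(3)] mod_homD[OF assms(4)]
  show ?thesis
    by (intro M.submoduleI) (auto simp: gh mod_hom_zero[OF assms(1,2,3)] mod_hom_zero[OF assms(1,2,4)]
      mod_hom_minus[OF assms(1,2,3)] mod_hom_minus[OF assms(1,2,4)])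
qed

subsection \<open>Free modules\<close>

lemma free_module_simps:
  "\<zero>\<^bsub>free_module R X\<^esub> = (\<lambda>x. \<zero>\<^bsub>R\<^esub>)"
  "f \<oplus>\<^bsub>free_module R X\<^esub> g = (\<lambda>x. f x \<oplus>\<^bsub>R\<^esub> g x)"
  "r \<odot>\<^bsub>free_module R X\<^esub> f = (\<lambda>x. r \<otimes>\<^bsub>R\<^esub> f x)"
  by (simp_all add: free_module_def)

lemma free_module_carrier_iff:
  "f \<in> carrier (free_module R X) \<longleftrightarrow>
    (\<forall>x\<in>X. f x \<in> carrier R) \<and> (\<forall>x. x \<notin> X \<longrightarrow> f x = \<zero>\<^bsub>R\<^esub>) \<and> finite {x. f x \<noteq> \<zero>\<^bsub>R\<^esub>}"
  by (simp add: free_module_def)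

context cring
begin

lemma free_module_val: "f \<in> carrier (free_module R X) \<Longrightarrow> f x \<in> carrier R"
  unfolding free_module_carrier_iff by (cases "x \<in> X") auto

lemma free_module_module: "module R (free_module R X)"
proof -
  have add: "f \<oplus>\<^bsub>free_module R X\<^esub> g \<in> carrier (free_module R X)"
    if "f \<in> carrier (free_module R X)" "g \<in> carrier (free_module R X)" for f g
  proof -
    have "finite ({x. f x \<noteq> \<zero>} \<union> {x. g x \<noteq> \<zero>})" using that by (simp add: free_module_carrier_iff)
    then have "finite {x. f x \<oplus> g x \<noteq> \<zero>}" by (rule finite_subset[rotated]) auto
    then show ?thesis using that by (auto simp: free_module_carrier_iff free_module_simps)
  qed
  have smult: "r \<odot>\<^bsub>free_module R X\<^esub> f \<in> carrier (free_module R X)"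
    if "r \<in> carrier R" "f \<in> carrier (free_module R X)" for r f
  proof -
    have "finite {x. f x \<noteq> \<zero>}" using that by (simp add: free_module_carrier_iff)
    then have "finite {x. r \<otimes> f x \<noteq> \<zero>}" by (rule finite_subset[rotated]) (use that in auto)
    then show ?thesis using that by (auto simp: free_module_carrier_iff free_module_simps)
  qed
  have "abelian_group (free_module R X)"
  proof (rule abelian_groupI)
    fix f assume f: "f \<in> carrier (free_module R X)"
    have "((\<ominus> \<one>) \<odot>\<^bsub>free_module R X\<^esub> f) \<oplus>\<^bsub>free_module R X\<^esub> f = \<zero>\<^bsub>free_module R X\<^esub>"
      using free_module_val[OF f] by (auto simp: free_module_simps l_minus l_neg)
    with smult[OF _ f, of "\<ominus> \<one>"]
    show "\<exists>g\<in>carrier (free_module R X). g \<oplus>\<^bsub>free_module R X\<^esub> f = \<zero>\<^bsub>free_module R X\<^esub>" by auto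
    show "\<zero>\<^bsub>free_module R X\<^esub> \<oplus>\<^bsub>free_module R X\<^esub> f = f"
      using free_module_val[OF f] by (simp add: free_module_simps)
  next
    show "\<zero>\<^bsub>free_module R X\<^esub> \<in> carrier (free_module R X)"
      by (simp add: free_module_carrier_iff free_module_simps)
  next
    fix f g assume f: "f \<in> carrier (free_module R X)" and g: "g \<in> carrier (free_module R X)"
    show "f \<oplus>\<^bsub>free_module R X\<^esub> g = g \<oplus>\<^bsub>free_module R X\<^esub> f"
      using free_module_val[OF f] free_module_val[OF g] by (simp add: free_module_simps a_comm)
  next
    fix f g h assume f: "f \<in> carrier (free_module R X)" and g: "g \<in> carrier (free_module R X)"
      and h: "h \<in> carrier (free_module R X)"
    show "f \<oplus>\<^bsub>free_module R X\<^esub> g \<oplus>\<^bsub>free_module R X\<^esub> h = f \<oplus>\<^bsub>free_module R X\<^esub> (g \<oplus>\<^bsub>free_module R X\<^esub> h)"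
      using free_module_val[OF f] free_module_val[OF g] free_module_val[OF h]
      by (simp add: free_module_simps a_assoc)
  qed (use add in blast)
  then show ?thesis
  proof (intro moduleI)
    fix r t f assume r: "r \<in> carrier R" and t: "t \<in> carrier R" and f: "f \<in> carrier (free_module R X)"
    note f' = free_module_val[OF f]
    show "(r \<oplus> t) \<odot>\<^bsub>free_module R X\<^esub> f =
        (r \<odot>\<^bsub>free_module R X\<^esub> f) \<oplus>\<^bsub>free_module R X\<^esub> (t \<odot>\<^bsub>free_module R X\<^esub> f)"
      using f' r t by (simp add: free_module_simps l_distr)
    show "(r \<otimes> t) \<odot>\<^bsub>free_module R X\<^esub> f = r \<odot>\<^bsub>free_module R X\<^esub> (t \<odot>\<^bsub>free_module R X\<^esub> f)"
      using f' r t by (simp add: free_module_simps m_assoc)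
  next
    fix r f g assume r: "r \<in> carrier R" and f: "f \<in> carrier (free_module R X)"
      and g: "g \<in> carrier (free_module R X)"
    show "r \<odot>\<^bsub>free_module R X\<^esub> (f \<oplus>\<^bsub>free_module R X\<^esub> g) =
        (r \<odot>\<^bsub>free_module R X\<^esub> f) \<oplus>\<^bsub>free_module R X\<^esub> (r \<odot>\<^bsub>free_module R X\<^esub> g)"
      using free_module_val[OF f] free_module_val[OF g] r by (simp add: free_module_simps r_distr)
  next
    fix f assume f: "f \<in> carrier (free_module R X)"
    show "\<one> \<odot>\<^bsub>free_module R X\<^esub> f = f"
      using free_module_val[OF f] by (simp add: free_module_simps)
  qed (use smult cring_axioms in auto)
qed

lemma gen_closed: "x \<in> X \<Longrightarrow> gen R x \<in> carrier (free_module R X)"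
proof -
  have "finite {y. gen R x y \<noteq> \<zero>}" by (rule finite_subset[of _ "{x}"]) (auto simp: gen_def)
  then show "x \<in> X \<Longrightarrow> gen R x \<in> carrier (free_module R X)"
    by (auto simp: free_module_carrier_iff gen_def)
qed

lemma free_module_span:
  assumes H: "submodule H R (free_module R X)" and gen: "\<And>x. x \<in> X \<Longrightarrow> gen R x \<in> H"
  shows "carrier (free_module R X) \<subseteq> H"
proof
  interpret F: module R "free_module R X" by (rule free_module_module)
  note E = F.submoduleE[OF H]
  have zero: "\<zero>\<^bsub>free_module R X\<^esub> \<in> H" by (rule submodule_zero[OF free_module_module H])
  have "f \<in> carrier (free_module R X) \<Longrightarrow> {x. f x \<noteq> \<zero>} \<subseteq> S \<Longrightarrow> f \<in> H" if "finite S" for S f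
    using that
  proof (induction S arbitrary: f)
    case empty
    then have "f = \<zero>\<^bsub>free_module R X\<^esub>" by (auto simp: free_module_simps)
    then show ?case using zero by simp
  next
    case (insert s S)
    show ?case
    proof (cases "s \<in> X")
      case False
      then have "f s = \<zero>" using insert.prems by (simp add: free_module_carrier_iff)
      then show ?thesis using insert by (intro insert.IH) auto
    next
      case True
      let ?g = "f s \<odot>\<^bsub>free_module R X\<^esub> gen R s"
      have fs: "f s \<in> carrier R" by (rule free_module_val[OF insert.prems(1)])
      have g: "?g \<in> H" using E(4) fs gen[OF True] by simp
      define h where "h = (\<lambda>x. if x = s then \<zero> else f x)"
      have "{x. h x \<noteq> \<zero>} \<subseteq> {x. f x \<noteq> \<zero>}" by (auto simp: h_def)
      then have "finite {x. h x \<noteq> \<zero>}" using insert.prems(1) finite_subset by (auto simp: free_module_carrier_iff)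
      then have hc: "h \<in> carrier (free_module R X)"
        using insert.prems(1) by (auto simp: free_module_carrier_iff h_def)
      have "h \<in> H" using insert.prems hc by (intro insert.IH) (auto simp: h_def)
      moreover have "f = h \<oplus>\<^bsub>free_module R X\<^esub> ?g"
        using free_module_val[OF insert.prems(1)] by (auto simp: h_def free_module_simps gen_def)
      ultimately show ?thesis using g E(5) by metis
    qed
  qed
  then show "f \<in> H" if "f \<in> carrier (free_module R X)" for f
    using that by (auto simp: free_module_carrier_iff)
qed

lemma free_module_extend:
  assumes N: "module R N" and v: "v \<in> X \<rightarrow> carrier N"
  shows "\<exists>h \<in> mod_hom R (free_module R X) N. \<forall>x\<in>X. h (gen R x) = v x"
proof -
  interpret N: module R N by fact
  interpret F: module R "free_module R X" by (rule free_module_module)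
  define h where "h = (\<lambda>f. finsum N (\<lambda>x. f x \<odot>\<^bsub>N\<^esub> v x) {x \<in> X. f x \<noteq> \<zero>})"
  have h: "h f = finsum N (\<lambda>x. f x \<odot>\<^bsub>N\<^esub> v x) S"
    if "finite S" "S \<subseteq> X" "{x. f x \<noteq> \<zero>} \<subseteq> S" "f \<in> carrier (free_module R X)" for f S
  proof -
    have "x \<in> S \<Longrightarrow> v x \<in> carrier N" for x using v that(2) by auto
    then show ?thesis
      unfolding h_def using that free_module_val[OF that(4)]
      by (intro N.M.add.finprod_mono_neutral_cong_left) auto
  qed
  have supp: "finite {x. f x \<noteq> \<zero>}" "{x. f x \<noteq> \<zero>} \<subseteq> X" if "f \<in> carrier (free_module R X)" for f
    using that by (auto simp: free_module_carrier_iff)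
  have vc: "x \<in> X \<Longrightarrow> v x \<in> carrier N" for x using v by auto
  have "h \<in> mod_hom R (free_module R X) N"
  proof (rule mod_homI)
    fix f assume f: "f \<in> carrier (free_module R X)"
    show "h f \<in> carrier N"
      unfolding h_def using free_module_val[OF f] vc by (intro N.M.finsum_closed) auto
  next
    fix f g assume f: "f \<in> carrier (free_module R X)" and g: "g \<in> carrier (free_module R X)"
    let ?S = "{x. f x \<noteq> \<zero>} \<union> {x. g x \<noteq> \<zero>}"
    have S: "finite ?S" "?S \<subseteq> X" using supp[OF f] supp[OF g] by auto
    have "h (f \<oplus>\<^bsub>free_module R X\<^esub> g) = finsum N (\<lambda>x. (f x \<oplus> g x) \<odot>\<^bsub>N\<^esub> v x) ?S"
      using S F.M.a_closed[OF f g] by (subst h[of ?S]) (auto simp: free_module_simps)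
    also have "\<dots> = finsum N (\<lambda>x. f x \<odot>\<^bsub>N\<^esub> v x \<oplus>\<^bsub>N\<^esub> g x \<odot>\<^bsub>N\<^esub> v x) ?S"
      using S free_module_val[OF f] free_module_val[OF g] vc
      by (intro N.M.finsum_cong') (auto simp: N.smult_l_distr subset_iff)
    also have "\<dots> = finsum N (\<lambda>x. f x \<odot>\<^bsub>N\<^esub> v x) ?S \<oplus>\<^bsub>N\<^esub> finsum N (\<lambda>x. g x \<odot>\<^bsub>N\<^esub> v x) ?S"
      using S free_module_val[OF f] free_module_val[OF g] vc by (intro N.M.finsum_addf) auto
    also have "\<dots> = h f \<oplus>\<^bsub>N\<^esub> h g" using h[of ?S] S f g by simp
    finally show "h (f \<oplus>\<^bsub>free_module R X\<^esub> g) = h f \<oplus>\<^bsub>N\<^esub> h g" .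
  next
    fix r f assume r: "r \<in> carrier R" and f: "f \<in> carrier (free_module R X)"
    let ?S = "{x. f x \<noteq> \<zero>}"
    have "h (r \<odot>\<^bsub>free_module R X\<^esub> f) = finsum N (\<lambda>x. (r \<otimes> f x) \<odot>\<^bsub>N\<^esub> v x) ?S"
      using supp[OF f] f r by (subst h[of ?S]) (auto simp: free_module_simps F.smult_closed[unfolded free_module_simps])
    also have "\<dots> = finsum N (\<lambda>x. r \<odot>\<^bsub>N\<^esub> (f x \<odot>\<^bsub>N\<^esub> v x)) ?S"
      using supp[OF f] free_module_val[OF f] r vc
      by (intro N.M.finsum_cong') (auto simp: N.smult_assoc1 subset_iff)
    also have "\<dots> = r \<odot>\<^bsub>N\<^esub> h f"
      unfolding h[OF supp[OF f] order_refl f]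
      using supp[OF f] free_module_val[OF f] r vc by (subst N.finsum_smult_ldistr) auto
    finally show "h (r \<odot>\<^bsub>free_module R X\<^esub> f) = r \<odot>\<^bsub>N\<^esub> h f" .
  qed
  moreover have "h (gen R x) = v x" if x: "x \<in> X" for x
  proof -
    have "h (gen R x) = finsum N (\<lambda>y. gen R x y \<odot>\<^bsub>N\<^esub> v y) {x}"
      using x gen_closed[OF x] by (intro h) (auto simp: gen_def)
    also have "\<dots> = v x" using vc[OF x] by (simp add: gen_def)
    finally show ?thesis .
  qed
  ultimately show ?thesis by blast
qed

end

subsection \<open>Modules with a chosen basis\<close>

record ('r, 'm, 'x) based_module =
  Space :: "('r, 'm) module"
  Idx :: "'x set"
  Elt :: "'x \<Rightarrow> 'm"

definition spanning :: "('r, 'k) ring_scheme \<Rightarrow> ('r, 'm, 'e) module_scheme \<Rightarrow> 'm set \<Rightarrow> bool"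
  where "spanning R M S \<longleftrightarrow>
    S \<subseteq> carrier M \<and> (\<forall>H. submodule H R M \<longrightarrow> S \<subseteq> H \<longrightarrow> carrier M \<subseteq> H)"

text \<open>
  Independence is expressed by a coordinate map to the free module.  This is the form in which it is
  used to prescribe linear maps on the basis, and it also covers the zero ring, over which different
  indices have the same basis vector.
\<close>

definition is_basis :: "('r, 'k) ring_scheme \<Rightarrow> ('r, 'm, 'x) based_module \<Rightarrow> bool"
  where "is_basis R B \<longleftrightarrow> module R (Space B) \<and> spanning R (Space B) (Elt B ` Idx B) \<and>
    (\<exists>\<psi> \<in> mod_hom R (Space B) (free_module R (Idx B)). \<forall>x\<in>Idx B. \<psi> (Elt B x) = gen R x)"

lemma spanning_eq:
  assumes "spanning R M S" "module R M" "module R N" "g \<in> mod_hom R M N" "h \<in> mod_hom R M N"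
    and "\<And>s. s \<in> S \<Longrightarrow> g s = h s" and "x \<in> carrier M"
  shows "g x = h x"
  using submodule_equalizer[OF assms(2-5)] assms(1,6,7) unfolding spanning_def by blast

text \<open>
  A spanning set determines a linear map, so the definite description in \<open>linear_extension\<close> denotes
  any linear map that has the required values.
\<close>

lemma linear_extension_eqI:
  assumes M: "module R M" and N: "module R N" and sp: "spanning R M (e ` I)"
    and h: "h \<in> mod_hom R M N" "\<And>i. i \<in> I \<Longrightarrow> h (e i) = v i"
  shows "linear_extension R M N I e v = restrict h (carrier M)"
  unfolding linear_extension_def
proof (rule the_equality)
  have e: "e i \<in> carrier M" if "i \<in> I" for i using sp that by (auto simp: spanning_def)
  show "restrict h (carrier M) \<in> mod_hom R M N \<and> restrict h (carrier M) \<in> extensional (carrier M) \<and>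
      (\<forall>i\<in>I. restrict h (carrier M) (e i) = v i)"
    using h e by (auto intro: mod_hom_cong[OF h(1) M])
  fix g assume g: "g \<in> mod_hom R M N \<and> g \<in> extensional (carrier M) \<and> (\<forall>i\<in>I. g (e i) = v i)"
  have "g x = h x" if "x \<in> carrier M" for x
    by (rule spanning_eq[OF sp M N]) (use g h that in auto)
  then show "g = restrict h (carrier M)" using g by (auto simp: extensional_def)
qed

lemma linear_extension_props:
  assumes M: "module R M" and N: "module R N" and sp: "spanning R M (e ` I)"
    and h: "\<exists>h \<in> mod_hom R M N. \<forall>i\<in>I. h (e i) = v i"
  shows "linear_extension R M N I e v \<in> mod_hom R M N"
    and "i \<in> I \<Longrightarrow> linear_extension R M N I e v (e i) = v i"
proof -
  obtain h where h: "h \<in> mod_hom R M N" "\<And>i. i \<in> I \<Longrightarrow> h (e i) = v i" using h by blast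
  have eq: "linear_extension R M N I e v = restrict h (carrier M)"
    by (rule linear_extension_eqI[OF M N sp h])
  show "linear_extension R M N I e v \<in> mod_hom R M N"
    unfolding eq by (rule mod_hom_cong[OF h(1) M]) simp
  show "i \<in> I \<Longrightarrow> linear_extension R M N I e v (e i) = v i"
    unfolding eq using h(2) sp by (auto simp: spanning_def)
qed

context
  fixes R :: "('r, 'k) ring_scheme" and B :: "('r, 'm, 'x) based_module"
  assumes B: "is_basis R B"
begin

lemma basis_module: "module R (Space B)"
  and basis_spanning: "spanning R (Space B) (Elt B ` Idx B)"
  using B by (auto simp: is_basis_def)

lemma basis_closed: "x \<in> Idx B \<Longrightarrow> Elt B x \<in> carrier (Space B)"
  using basis_spanning by (auto simp: spanning_def)

lemma basis_extend:
  assumes N: "module R N" and v: "v \<in> Idx B \<rightarrow> carrier N"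
  shows "\<exists>h \<in> mod_hom R (Space B) N. \<forall>x\<in>Idx B. h (Elt B x) = v x"
proof -
  interpret N: module R N by fact
  obtain \<psi> where \<psi>: "\<psi> \<in> mod_hom R (Space B) (free_module R (Idx B))" "\<forall>x\<in>Idx B. \<psi> (Elt B x) = gen R x"
    using B by (auto simp: is_basis_def)
  obtain h where h: "h \<in> mod_hom R (free_module R (Idx B)) N" "\<forall>x\<in>Idx B. h (gen R x) = v x"
    using N.R.free_module_extend[OF N v] by blast
  from mod_hom_comp[OF \<psi>(1) h(1)] \<psi>(2) h(2) show ?thesis by (intro bexI[of _ "\<lambda>x. h (\<psi> x)"]) auto
qed

lemma basis_eq:
  assumes "module R N" "g \<in> mod_hom R (Space B) N" "h \<in> mod_hom R (Space B) N"
    and "\<And>x. x \<in> Idx B \<Longrightarrow> g (Elt B x) = h (Elt B x)" and "m \<in> carrier (Space B)"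
  shows "g m = h m"
  by (rule spanning_eq[OF basis_spanning basis_module assms(1-3) _ assms(5)]) (use assms(4) in auto)

lemma basis_induct:
  assumes m: "m \<in> carrier (Space B)" and zero: "P \<zero>\<^bsub>Space B\<^esub>"
    and add: "\<And>a b. a \<in> carrier (Space B) \<Longrightarrow> b \<in> carrier (Space B) \<Longrightarrow> P a \<Longrightarrow> P b \<Longrightarrow> P (a \<oplus>\<^bsub>Space B\<^esub> b)"
    and smult: "\<And>r a. r \<in> carrier R \<Longrightarrow> a \<in> carrier (Space B) \<Longrightarrow> P a \<Longrightarrow> P (r \<odot>\<^bsub>Space B\<^esub> a)"
    and gen: "\<And>x. x \<in> Idx B \<Longrightarrow> P (Elt B x)"
  shows "P m"
proof -
  interpret M: module R "Space B" by (rule basis_module)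
  have "submodule {m \<in> carrier (Space B). P m} R (Space B)"
  proof (rule M.submoduleI)
    fix a assume a: "a \<in> {m \<in> carrier (Space B). P m}"
    then have "P ((\<ominus>\<^bsub>R\<^esub> \<one>\<^bsub>R\<^esub>) \<odot>\<^bsub>Space B\<^esub> a)" by (intro smult) auto
    then show "\<ominus>\<^bsub>Space B\<^esub> a \<in> {m \<in> carrier (Space B). P m}" using a by (simp add: M.minus_one_smult)
  qed (use zero add smult in auto)
  moreover have "Elt B ` Idx B \<subseteq> {m \<in> carrier (Space B). P m}" using basis_closed gen by auto
  ultimately show ?thesis using basis_spanning m by (auto simp: spanning_def)
qed

end

subsection \<open>Tensor powers\<close>

definition multilinear ::
  "('r, 'k) ring_scheme \<Rightarrow> ('r, 'a, 'm) module_scheme \<Rightarrow> nat \<Rightarrow> ('r, 'b, 'n) module_scheme \<Rightarrow>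
    ('a list \<Rightarrow> 'b) \<Rightarrow> bool"
  where "multilinear R M n N v \<longleftrightarrow> v \<in> tuples n (carrier M) \<rightarrow> carrier N \<and>
    (\<forall>as\<in>tuples n (carrier M). \<forall>i<n. (\<lambda>x. v (as[i := x])) \<in> mod_hom R M N)"

lemma tuples_update: "as \<in> tuples n A \<Longrightarrow> x \<in> A \<Longrightarrow> as[i := x] \<in> tuples n A"
  by (auto simp: tuples_def dest: set_update_subset_insert[THEN subsetD])

lemma tuples_nth: "as \<in> tuples n A \<Longrightarrow> i < n \<Longrightarrow> as ! i \<in> A"
  by (auto simp: tuples_def)

lemma tuples_length: "as \<in> tuples n A \<Longrightarrow> length as = n"
  by (auto simp: tuples_def)

context
  fixes R :: "('r, 'k) ring_scheme" and M :: "('r, 'a, 'm) module_scheme"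
  assumes M: "module R M"
begin

interpretation M: module R M by (fact M)

interpretation F: module R "free_module R (tuples n (carrier M))" for n
  by (rule M.R.free_module_module)

lemma tensor_relations_carrier:
  "tensor_relations R M n \<subseteq> carrier (free_module R (tuples n (carrier M)))"
  unfolding tensor_relations_def Let_def
  by (auto simp: tuples_update M.R.gen_closed a_minus_def)

lemma tensor_null_submodule:
  "submodule (tensor_null R M n) R (free_module R (tuples n (carrier M)))"
proof -
  let ?F = "free_module R (tuples n (carrier M))"
  have "carrier ?F \<in> {N. submodule N R ?F \<and> tensor_relations R M n \<subseteq> N}"
    using F.carrier_is_submodule tensor_relations_carrier by auto
  moreover have "\<zero>\<^bsub>?F\<^esub> \<in> N" if "submodule N R ?F" for N
    by (rule submodule_zero[OF F.module_axioms that])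
  ultimately show ?thesis
    unfolding tensor_null_def span_submodule_def
    by (intro F.submoduleI) (auto intro: F.submoduleE(3,4,5) dest: F.submoduleE(1)[THEN subsetD])
qed

lemma tensor_relations_null: "tensor_relations R M n \<subseteq> tensor_null R M n"
  by (auto simp: tensor_null_def span_submodule_def)

lemma tensor_power_module: "module R (tensor_power R M n)"
  unfolding tensor_power_def by (rule quot_module_module[OF F.module_axioms tensor_null_submodule])

lemma pure_tensor_eq:
  "as \<in> tuples n (carrier M) \<Longrightarrow>
    pure_tensor R M as = tensor_null R M n +>\<^bsub>free_module R (tuples n (carrier M))\<^esub> gen R as"
  by (simp add: pure_tensor_def tuples_length)

lemma pure_tensor_closed:
  "as \<in> tuples n (carrier M) \<Longrightarrow> pure_tensor R M as \<in> carrier (tensor_power R M n)"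
  unfolding tensor_power_def quot_module_carrier[OF F.module_axioms tensor_null_submodule]
  using M.R.gen_closed by (auto simp: pure_tensor_eq intro!: imageI)

lemma pure_tensor_multilinear: "multilinear R M n (tensor_power R M n) (pure_tensor R M)"
  unfolding multilinear_def
proof (intro conjI ballI allI impI)
  show "pure_tensor R M \<in> tuples n (carrier M) \<rightarrow> carrier (tensor_power R M n)"
    using pure_tensor_closed by auto
  fix as i assume as: "as \<in> tuples n (carrier M)" and i: "i < n"
  note q = F.module_axioms[of n] tensor_null_submodule[of n]
  note g = M.R.gen_closed[OF tuples_update[OF as]]
  show "(\<lambda>x. pure_tensor R M (as[i := x])) \<in> mod_hom R M (tensor_power R M n)"
  proof (rule mod_homI)
    fix x assume "x \<in> carrier M"
    then show "pure_tensor R M (as[i := x]) \<in> carrier (tensor_power R M n)"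
      using as by (intro pure_tensor_closed tuples_update)
  next
    fix x y assume x: "x \<in> carrier M" and y: "y \<in> carrier M"
    let ?F = "free_module R (tuples n (carrier M))"
    have "gen R (as[i := x \<oplus>\<^bsub>M\<^esub> y]) \<ominus>\<^bsub>?F\<^esub> (gen R (as[i := x]) \<oplus>\<^bsub>?F\<^esub> gen R (as[i := y])) \<in> tensor_null R M n"
      by (rule subsetD[OF tensor_relations_null])
        (use as i x y in \<open>unfold tensor_relations_def Let_def, blast\<close>)
    then show "pure_tensor R M (as[i := x \<oplus>\<^bsub>M\<^esub> y]) =
        pure_tensor R M (as[i := x]) \<oplus>\<^bsub>tensor_power R M n\<^esub> pure_tensor R M (as[i := y])"
      using as x y g
      by (simp add: pure_tensor_eq[OF tuples_update] tensor_power_def coset_add[OF q] coset_eq_iff[OF q])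
  next
    fix r x assume r: "r \<in> carrier R" and x: "x \<in> carrier M"
    let ?F = "free_module R (tuples n (carrier M))"
    have "gen R (as[i := r \<odot>\<^bsub>M\<^esub> x]) \<ominus>\<^bsub>?F\<^esub> (r \<odot>\<^bsub>?F\<^esub> gen R (as[i := x])) \<in> tensor_null R M n"
      by (rule subsetD[OF tensor_relations_null])
        (use as i x r in \<open>unfold tensor_relations_def Let_def, blast\<close>)
    then show "pure_tensor R M (as[i := r \<odot>\<^bsub>M\<^esub> x]) =
        r \<odot>\<^bsub>tensor_power R M n\<^esub> pure_tensor R M (as[i := x])"
      using as r x g
      by (simp add: pure_tensor_eq[OF tuples_update] tensor_power_def coset_smult[OF q] coset_eq_iff[OF q])
  qed
qed

lemma pure_tensor_spanning:
  "spanning R (tensor_power R M n) (pure_tensor R M ` tuples n (carrier M))"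
  unfolding spanning_def
proof (intro conjI allI impI)
  show "pure_tensor R M ` tuples n (carrier M) \<subseteq> carrier (tensor_power R M n)"
    using pure_tensor_closed by auto
  fix H assume H: "submodule H R (tensor_power R M n)"
    and sub: "pure_tensor R M ` tuples n (carrier M) \<subseteq> H"
  let ?F = "free_module R (tuples n (carrier M))"
  let ?c = "\<lambda>x. tensor_null R M n +>\<^bsub>?F\<^esub> x"
  note q = F.module_axioms[of n] tensor_null_submodule[of n]
  have "submodule {x \<in> carrier ?F. ?c x \<in> H} R ?F"
    using submodule_preimage[OF q(1) tensor_power_module _ H] coset_hom[OF q]
    by (simp add: tensor_power_def)
  moreover have "gen R as \<in> {x \<in> carrier ?F. ?c x \<in> H}" if "as \<in> tuples n (carrier M)" for as
    using that M.R.gen_closed sub by (auto simp: pure_tensor_eq)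
  ultimately have "carrier ?F \<subseteq> {x \<in> carrier ?F. ?c x \<in> H}" by (rule M.R.free_module_span)
  then show "carrier (tensor_power R M n) \<subseteq> H"
    unfolding tensor_power_def quot_module_carrier[OF q] by blast
qed

text \<open>
  The defining relations of the tensor power are differences that every multilinear map sends to zero.
\<close>

lemma tensor_power_lift:
  assumes N: "module R N" and v: "multilinear R M n N v"
  shows "\<exists>h \<in> mod_hom R (tensor_power R M n) N. \<forall>as\<in>tuples n (carrier M). h (pure_tensor R M as) = v as"
proof -
  interpret N: module R N by fact
  let ?F = "free_module R (tuples n (carrier M))"
  note q = F.module_axioms[of n] tensor_null_submodule[of n]
  have vc: "v \<in> tuples n (carrier M) \<rightarrow> carrier N" using v by (simp add: multilinear_def)
  have vlin: "(\<lambda>x. v (as[i := x])) \<in> mod_hom R M N" if "as \<in> tuples n (carrier M)" "i < n" for as i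
    using v that by (simp add: multilinear_def)
  obtain f where f: "f \<in> mod_hom R ?F N" "\<And>as. as \<in> tuples n (carrier M) \<Longrightarrow> f (gen R as) = v as"
    using M.R.free_module_extend[OF N vc] by blast
  note fD = mod_homD[OF f(1)]
  have vu: "v (as[i := x]) \<in> carrier N" if "as \<in> tuples n (carrier M)" "x \<in> carrier M" for as i x
    using vc tuples_update[OF that] by blast
  have "tensor_relations R M n \<subseteq> {x \<in> carrier ?F. f x = \<zero>\<^bsub>N\<^esub>}"
  proof
    fix z assume z: "z \<in> tensor_relations R M n"
    then have zc: "z \<in> carrier ?F" using tensor_relations_carrier by blast
    from z consider
      (add) as i x y where "z = gen R (as[i := x \<oplus>\<^bsub>M\<^esub> y]) \<ominus>\<^bsub>?F\<^esub> (gen R (as[i := x]) \<oplus>\<^bsub>?F\<^esub> gen R (as[i := y]))"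
        "as \<in> tuples n (carrier M)" "i < n" "x \<in> carrier M" "y \<in> carrier M"
      | (smult) as i r x where "z = gen R (as[i := r \<odot>\<^bsub>M\<^esub> x]) \<ominus>\<^bsub>?F\<^esub> (r \<odot>\<^bsub>?F\<^esub> gen R (as[i := x]))"
        "as \<in> tuples n (carrier M)" "i < n" "r \<in> carrier R" "x \<in> carrier M"
      unfolding tensor_relations_def Let_def by blast
    then have "f z = \<zero>\<^bsub>N\<^esub>"
    proof cases
      case add
      note g = M.R.gen_closed[OF tuples_update[OF add(2)]]
      have "f z = v (as[i := x \<oplus>\<^bsub>M\<^esub> y]) \<ominus>\<^bsub>N\<^esub> (v (as[i := x]) \<oplus>\<^bsub>N\<^esub> v (as[i := y]))"
        unfolding add(1) using g add f(2)[OF tuples_update[OF add(2)]] fD(2) F.M.a_closed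
        by (simp add: mod_hom_diff[OF q(1) N f(1)])
      also have "\<dots> = \<zero>\<^bsub>N\<^esub>"
        using mod_homD(2)[OF vlin[OF add(2,3)] add(4,5)] vu[OF add(2)] add(4,5) by (simp add: N.M.diff_self)
      finally show ?thesis .
    next
      case smult
      note g = M.R.gen_closed[OF tuples_update[OF smult(2)]]
      have "f z = v (as[i := r \<odot>\<^bsub>M\<^esub> x]) \<ominus>\<^bsub>N\<^esub> (r \<odot>\<^bsub>N\<^esub> v (as[i := x]))"
        unfolding smult(1) using g smult f(2)[OF tuples_update[OF smult(2)]] fD(3)
        by (simp add: mod_hom_diff[OF q(1) N f(1)])
      also have "\<dots> = \<zero>\<^bsub>N\<^esub>"
        using mod_homD(3)[OF vlin[OF smult(2,3)] smult(4,5)] vu[OF smult(2)] smult(4,5)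
        by (simp add: N.M.diff_self)
      finally show ?thesis .
    qed
    then show "z \<in> {x \<in> carrier ?F. f x = \<zero>\<^bsub>N\<^esub>}" using zc by simp
  qed
  then have "tensor_null R M n \<subseteq> {x \<in> carrier ?F. f x = \<zero>\<^bsub>N\<^esub>}"
    unfolding tensor_null_def span_submodule_def using submodule_kernel[OF q(1) N f(1)] by blast
  then obtain h where "h \<in> mod_hom R (quot_module ?F (tensor_null R M n)) N"
    "\<And>x. x \<in> carrier ?F \<Longrightarrow> h (tensor_null R M n +>\<^bsub>?F\<^esub> x) = f x"
    using quot_module_lift[OF q N f(1)] by blast
  then show ?thesis
    unfolding tensor_power_def
  proof (intro bexI[of _ h] ballI)
    fix as assume as: "as \<in> tuples n (carrier M)"
    assume "\<And>x. x \<in> carrier ?F \<Longrightarrow> h (tensor_null R M n +>\<^bsub>?F\<^esub> x) = f x"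
    from this[OF M.R.gen_closed[OF as]] show "h (pure_tensor R M as) = v as"
      by (simp add: pure_tensor_eq[OF as] f(2)[OF as])
  qed
qed

end

definition tensor_based ::
  "('r, 'k) ring_scheme \<Rightarrow> ('r, 'a, 'x) based_module \<Rightarrow> nat \<Rightarrow> ('r, ('a list \<Rightarrow> 'r) set, 'x list) based_module"
  where "tensor_based R B n = \<lparr>Space = tensor_power R (Space B) n, Idx = tuples n (Idx B),
    Elt = (\<lambda>xs. pure_tensor R (Space B) (map (Elt B) xs))\<rparr>"

text \<open>
  The product of the coordinates of the entries.  On tuples of basis vectors it is the coordinate of
  the corresponding pure tensor, hence it provides the coordinate map of the tensor power.
\<close>

lemma tuple_coefficients_multilinear:
  fixes R :: "('r, 'k) ring_scheme" and M :: "('r, 'a, 'm) module_scheme"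
  assumes M: "module R M" and \<psi>: "\<psi> \<in> mod_hom R M (free_module R X)"
  shows "multilinear R M n (free_module R (tuples n X))
    (\<lambda>as xs. if xs \<in> tuples n X then finprod R (\<lambda>i. \<psi> (as ! i) (xs ! i)) {..<n} else \<zero>\<^bsub>R\<^esub>)"
    (is "multilinear R M n ?F ?v")
proof -
  interpret M: module R M by fact
  note \<psi>D = mod_homD[OF \<psi>]
  have \<psi>c: "\<psi> a x \<in> carrier R" if "a \<in> carrier M" for a x
    by (rule M.R.free_module_val[OF \<psi>D(1)[OF that]])
  have split: "finprod R (\<lambda>j. \<psi> (as[i := a] ! j) (xs ! j)) {..<n} =
      \<psi> a (xs ! i) \<otimes>\<^bsub>R\<^esub> finprod R (\<lambda>j. \<psi> (as ! j) (xs ! j)) ({..<n} - {i})"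
    if "as \<in> tuples n (carrier M)" "i < n" "a \<in> carrier M" for as i a xs
  proof -
    have "finprod R (\<lambda>j. \<psi> (as[i := a] ! j) (xs ! j)) (insert i ({..<n} - {i})) =
        \<psi> (as[i := a] ! i) (xs ! i) \<otimes>\<^bsub>R\<^esub> finprod R (\<lambda>j. \<psi> (as[i := a] ! j) (xs ! j)) ({..<n} - {i})"
      using that tuples_nth[OF tuples_update[OF that(1,3)]] \<psi>c by (intro M.R.finprod_insert) auto
    also have "finprod R (\<lambda>j. \<psi> (as[i := a] ! j) (xs ! j)) ({..<n} - {i}) =
        finprod R (\<lambda>j. \<psi> (as ! j) (xs ! j)) ({..<n} - {i})"
      using that tuples_nth[OF that(1)] \<psi>c by (intro M.R.finprod_cong') auto
    finally show ?thesis using that by (simp add: insert_absorb tuples_length)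
  qed
  have rest: "finprod R (\<lambda>j. \<psi> (as ! j) (xs ! j)) ({..<n} - {i}) \<in> carrier R"
    if "as \<in> tuples n (carrier M)" for as i xs
    using tuples_nth[OF that] \<psi>c by (intro M.R.finprod_closed) auto
  have closed: "?v as \<in> carrier ?F" if as: "as \<in> tuples n (carrier M)" for as
  proof -
    let ?S = "\<Union>a\<in>set as. {x. \<psi> a x \<noteq> \<zero>\<^bsub>R\<^esub>}"
    have fin: "finite ?S"
      using \<psi>D(1) as by (auto simp: free_module_carrier_iff tuples_def)
    have "xs \<in> {xs. set xs \<subseteq> ?S \<and> length xs = n}"
      if "?v as xs \<noteq> \<zero>\<^bsub>R\<^esub>" for xs
    proof -
      have xs: "xs \<in> tuples n X" using that by (auto split: if_splits)
      have "\<psi> (as ! i) (xs ! i) \<noteq> \<zero>\<^bsub>R\<^esub>" if i: "i < n" for i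
      proof
        assume "\<psi> (as ! i) (xs ! i) = \<zero>\<^bsub>R\<^esub>"
        then have "finprod R (\<lambda>j. \<psi> (as ! j) (xs ! j)) {..<n} = \<zero>\<^bsub>R\<^esub>"
          using split[OF as i tuples_nth[OF as i], of xs] rest[OF as] by simp
        then show False using \<open>?v as xs \<noteq> \<zero>\<^bsub>R\<^esub>\<close> xs by simp
      qed
      then show ?thesis
        using xs as by (fastforce simp: tuples_def in_set_conv_nth)
    qed
    then have "finite {xs. ?v as xs \<noteq> \<zero>\<^bsub>R\<^esub>}"
      by (intro finite_subset[OF _ finite_lists_length_eq[OF fin, of n]] subsetI) (simp only: mem_Collect_eq)
    moreover have "finprod R (\<lambda>j. \<psi> (as ! j) (xs ! j)) {..<n} \<in> carrier R" for xs
      using tuples_nth[OF as] \<psi>c by (intro M.R.finprod_closed) auto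
    ultimately show ?thesis unfolding free_module_carrier_iff by auto
  qed
  show ?thesis
    unfolding multilinear_def
  proof (intro conjI ballI allI impI)
    show "?v \<in> tuples n (carrier M) \<rightarrow> carrier ?F" using closed by blast
    fix as i assume as: "as \<in> tuples n (carrier M)" and i: "i < n"
    show "(\<lambda>x. ?v (as[i := x])) \<in> mod_hom R M ?F"
    proof (rule mod_homI)
      fix x y assume x: "x \<in> carrier M" and y: "y \<in> carrier M"
      show "?v (as[i := x \<oplus>\<^bsub>M\<^esub> y]) = ?v (as[i := x]) \<oplus>\<^bsub>?F\<^esub> ?v (as[i := y])"
        using split[OF as i] x y rest[OF as] \<psi>c
        by (auto simp: free_module_simps \<psi>D M.R.l_distr)
    next
      fix r x assume r: "r \<in> carrier R" and x: "x \<in> carrier M"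
      show "?v (as[i := r \<odot>\<^bsub>M\<^esub> x]) = r \<odot>\<^bsub>?F\<^esub> ?v (as[i := x])"
        using split[OF as i] r x rest[OF as] \<psi>c
        by (auto simp: free_module_simps \<psi>D M.R.m_assoc)
    qed (use closed tuples_update[OF as] in blast)
  qed
qed

lemma finprod_gen:
  assumes "cring R" "length xs = length ys"
  shows "finprod R (\<lambda>i. gen R (xs ! i) (ys ! i)) {..<length xs} = gen R xs ys"
proof -
  interpret R: cring R by fact
  show ?thesis
  proof (cases "ys = xs")
    case True
    then show ?thesis by (simp add: gen_def R.finprod_one_eqI)
  next
    case False
    then obtain i where i: "i < length xs" "ys ! i \<noteq> xs ! i" using assms(2) nth_equalityI by metis
    have "finprod R (\<lambda>i. gen R (xs ! i) (ys ! i)) (insert i ({..<length xs} - {i})) =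
      gen R (xs ! i) (ys ! i) \<otimes>\<^bsub>R\<^esub> finprod R (\<lambda>i. gen R (xs ! i) (ys ! i)) ({..<length xs} - {i})"
      by (rule R.finprod_insert) (auto simp: gen_def)
    also have "\<dots> = \<zero>\<^bsub>R\<^esub>" using i by (simp add: gen_def R.finprod_closed)
    finally show ?thesis using i False by (simp add: insert_absorb gen_def)
  qed
qed

text \<open>
  Spanning follows by expanding the entries of a pure tensor in the basis, one slot after the other;
  independence comes from the products of coordinates.
\<close>

lemma tensor_based_basis:
  assumes B: "is_basis R B"
  shows "is_basis R (tensor_based R B n)"
proof -
  let ?T = "tensor_power R (Space B) n"
  note M = basis_module[OF B]
  interpret M: module R "Space B" by (rule M)
  interpret T: module R ?T by (rule tensor_power_module[OF M])
  note ml = pure_tensor_multilinear[OF M, of n]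
  have mapc: "map (Elt B) xs \<in> tuples n (carrier (Space B))" if "xs \<in> tuples n (Idx B)" for xs
    using that basis_closed[OF B] by (auto simp: tuples_def)
  have "spanning R ?T ((\<lambda>xs. pure_tensor R (Space B) (map (Elt B) xs)) ` tuples n (Idx B))"
    unfolding spanning_def
  proof (intro conjI allI impI)
    show "(\<lambda>xs. pure_tensor R (Space B) (map (Elt B) xs)) ` tuples n (Idx B) \<subseteq> carrier ?T"
      using mapc pure_tensor_closed[OF M] by blast
    fix H assume H: "submodule H R ?T"
      and sub: "(\<lambda>xs. pure_tensor R (Space B) (map (Elt B) xs)) ` tuples n (Idx B) \<subseteq> H"
    note HE = T.submoduleE[OF H]
    have H0: "\<zero>\<^bsub>?T\<^esub> \<in> H" by (rule submodule_zero[OF T.module_axioms H])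
    have "as \<in> tuples n (carrier (Space B)) \<Longrightarrow> (\<And>i. k \<le> i \<Longrightarrow> i < n \<Longrightarrow> as ! i \<in> Elt B ` Idx B) \<Longrightarrow>
        k \<le> n \<Longrightarrow> pure_tensor R (Space B) as \<in> H" for k as
    proof (induction k arbitrary: as)
      case 0
      define xs where "xs = map (\<lambda>a. SOME x. x \<in> Idx B \<and> a = Elt B x) as"
      have a: "(SOME x. x \<in> Idx B \<and> a = Elt B x) \<in> Idx B \<and> a = Elt B (SOME x. x \<in> Idx B \<and> a = Elt B x)"
        if "a \<in> set as" for a
      proof -
        obtain i where "i < n" "a = as ! i"
          using \<open>a \<in> set as\<close> 0(1) by (auto simp: in_set_conv_nth tuples_length)
        then have "\<exists>x. x \<in> Idx B \<and> a = Elt B x" using 0(2)[of i] by auto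
        then show ?thesis by (rule someI_ex)
      qed
      have "xs \<in> tuples n (Idx B)" "as = map (Elt B) xs"
        using 0(1) a by (auto simp: xs_def tuples_def map_idI)
      then show ?case using sub by blast
    next
      case (Suc k)
      then have k: "k < n" by simp
      have lin: "(\<lambda>x. pure_tensor R (Space B) (as[k := x])) \<in> mod_hom R (Space B) ?T"
        using ml Suc.prems(1) k by (simp add: multilinear_def)
      have "pure_tensor R (Space B) (as[k := a]) \<in> H" if "a \<in> carrier (Space B)" for a
      proof (rule basis_induct[OF B that])
        show "pure_tensor R (Space B) (as[k := \<zero>\<^bsub>Space B\<^esub>]) \<in> H"
          using mod_hom_zero[OF M T.module_axioms lin] H0 by simp
      next
        fix x assume x: "x \<in> Idx B"
        show "pure_tensor R (Space B) (as[k := Elt B x]) \<in> H"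
        proof (rule Suc.IH)
          show "as[k := Elt B x] \<in> tuples n (carrier (Space B))"
            by (rule tuples_update[OF Suc.prems(1) basis_closed[OF B x]])
          show "as[k := Elt B x] ! i \<in> Elt B ` Idx B" if "k \<le> i" "i < n" for i
            using that x Suc.prems(2)[of i] tuples_length[OF Suc.prems(1)] by (cases "i = k") auto
        qed (use k in simp)
      qed (auto simp: mod_homD[OF lin] HE)
      from this[of "as ! k"] tuples_nth[OF Suc.prems(1) k] show ?case by simp
    qed
    from this[of _ n] have "pure_tensor R (Space B) ` tuples n (carrier (Space B)) \<subseteq> H" by auto
    then show "carrier ?T \<subseteq> H" using pure_tensor_spanning[OF M, of n] H by (auto simp: spanning_def)
  qed
  moreover have "\<exists>h \<in> mod_hom R ?T (free_module R (tuples n (Idx B))).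
      \<forall>xs\<in>tuples n (Idx B). h (pure_tensor R (Space B) (map (Elt B) xs)) = gen R xs"
  proof -
    obtain \<psi> where \<psi>: "\<psi> \<in> mod_hom R (Space B) (free_module R (Idx B))" "\<And>x. x\<in>Idx B \<Longrightarrow> \<psi> (Elt B x) = gen R x"
      using B by (auto simp: is_basis_def)
    obtain h where h: "h \<in> mod_hom R ?T (free_module R (tuples n (Idx B)))"
      "\<And>as. as \<in> tuples n (carrier (Space B)) \<Longrightarrow> h (pure_tensor R (Space B) as) =
        (\<lambda>xs. if xs \<in> tuples n (Idx B) then finprod R (\<lambda>i. \<psi> (as ! i) (xs ! i)) {..<n} else \<zero>\<^bsub>R\<^esub>)"
      using tensor_power_lift[OF M M.R.free_module_module tuple_coefficients_multilinear[OF M \<psi>(1)]] by blast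
    have "h (pure_tensor R (Space B) (map (Elt B) xs)) ys = gen R xs ys" if xs: "xs \<in> tuples n (Idx B)" for xs ys
    proof (cases "ys \<in> tuples n (Idx B)")
      case True
      have "h (pure_tensor R (Space B) (map (Elt B) xs)) ys =
          finprod R (\<lambda>i. \<psi> (map (Elt B) xs ! i) (ys ! i)) {..<n}"
        using h(2)[OF mapc[OF xs]] True by simp
      also have "\<dots> = finprod R (\<lambda>i. gen R (xs ! i) (ys ! i)) {..<n}"
        using xs tuples_nth[OF xs] tuples_length[OF xs] \<psi>(2)
        by (intro M.R.finprod_cong') (auto simp: gen_def)
      also have "\<dots> = gen R xs ys"
        using finprod_gen[OF M.R.cring_axioms, of xs ys] tuples_length[OF xs] tuples_length[OF True] by simp
      finally show ?thesis .
    next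
      case False
      then show ?thesis using h(2)[OF mapc[OF xs]] xs by (auto simp: gen_def)
    qed
    then show ?thesis using h(1) by blast
  qed
  ultimately show ?thesis
    using T.module_axioms by (simp add: is_basis_def tensor_based_def)
qed


section \<open>Integral chains and alternating sums\<close>

definition signed :: "nat \<Rightarrow> 'a::ab_group_add \<Rightarrow> 'a"
  where "signed k a = (if even k then a else - a)"

lemma signed_sum: "signed k (sum f A) = (\<Sum>i\<in>A. signed k (f i))"
  by (simp add: signed_def sum_negf)

lemma signed_signed: "signed k (signed l a) = signed (k + l) a"
  by (simp add: signed_def)

lemma signed_cong: "even k = even l \<Longrightarrow> signed k a = signed l a"
  by (simp add: signed_def)

lemma signed_0 [simp]: "signed 0 a = a"
  by (simp add: signed_def)

lemma signed_Suc: "signed (Suc k) a = - signed k a"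
  by (simp add: signed_def)

text \<open>
  The terms with \<open>j < i\<close> cancel those with \<open>i \<le> j\<close>.  On degree \<open>n\<close> the case \<open>k = n\<close> gives
  \<open>b b = 0\<close>, and the case \<open>k = n - 1\<close> gives \<open>b' b' = 0\<close>.
\<close>

lemma alternating_square_sum_zero:
  fixes a :: "nat \<Rightarrow> nat \<Rightarrow> 'a::ab_group_add"
  assumes "\<And>i j. j < i \<Longrightarrow> i \<le> k \<Longrightarrow> a i j = a j (i - 1)"
  shows "(\<Sum>i\<le>k. \<Sum>j<k. signed (i + j) (a i j)) = 0"
proof -
  let ?f = "\<lambda>(i, j). signed (i + j) (a i j)"
  let ?A = "{(i, j). j < i \<and> i \<le> k}" and ?B = "{(i, j). i \<le> j \<and> j < k}"
  have fin: "finite ?A" "finite ?B"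
    by (rule finite_subset[of _ "{..k} \<times> {..k}"]; auto)+
  have "sum ?f ?A = (\<Sum>p\<in>?B. - ?f p)"
  proof (rule sum.reindex_bij_witness[of _ "\<lambda>(i, j). (Suc j, i)" "\<lambda>(i, j). (j, i - 1)"])
    fix p assume "p \<in> ?A"
    then obtain i j where p: "p = (Suc i, j)" "j \<le> i" "Suc i \<le> k"
      by (cases p; cases "fst p") auto
    show "- ?f (case p of (i, j) \<Rightarrow> (j, i - 1)) = ?f p"
      using assms[of j "Suc i"] p by (simp add: signed_Suc add.commute)
  qed auto
  then have "sum ?f ?A + sum ?f ?B = 0" by (simp add: sum_negf)
  moreover have "sum ?f ({..k} \<times> {..<k}) = sum ?f ?A + sum ?f ?B"
  proof -
    have "{..k} \<times> {..<k} = ?A \<union> ?B" by auto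
    then show ?thesis using fin by (simp add: sum.union_disjoint disjoint_iff)
  qed
  ultimately show ?thesis by (simp add: sum.cartesian_product)
qed

text \<open>
  The terms away from the two diagonals \<open>i = j\<close> and \<open>i = j + 1\<close> cancel the second double sum, and the
  two diagonals telescope.
\<close>

lemma alternating_prism_sum:
  fixes F E :: "nat \<Rightarrow> nat \<Rightarrow> 'a::ab_group_add"
  assumes lower: "\<And>i j. i < j \<Longrightarrow> j \<le> n \<Longrightarrow> F i j = E i (j - 1)"
    and upper: "\<And>i j. Suc j < i \<Longrightarrow> i \<le> Suc n \<Longrightarrow> F i j = E (i - 1) j"
    and diag: "\<And>j. j < n \<Longrightarrow> F (Suc j) (Suc j) = F (Suc j) j"
  shows "(\<Sum>j\<le>n. \<Sum>i\<le>Suc n. signed (i + j) (F i j)) + (\<Sum>i\<le>n. \<Sum>j<n. signed (i + j) (E i j))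
     = F 0 0 - F (Suc n) n"
proof -
  let ?f = "\<lambda>(j, i). signed (i + j) (F i j)" and ?e = "\<lambda>(i, j). signed (i + j) (E i j)"
  let ?L = "{(j, i). i < j \<and> j \<le> n}" and ?U = "{(j, i). Suc j < i \<and> i \<le> Suc n}"
  let ?D = "(\<lambda>j. (j, j)) ` {..n}" and ?S = "(\<lambda>j. (j, Suc j)) ` {..n}"
  let ?L' = "{(i, j). i \<le> j \<and> j < n}" and ?U' = "{(i, j). j < i \<and> i \<le> n}"
  have fin: "finite ?L" "finite ?U" "finite ?L'" "finite ?U'"
    by (rule finite_subset[of _ "{..Suc n} \<times> {..Suc n}"]; auto)+
  have "sum ?f ?L = (\<Sum>p\<in>?L'. - ?e p)"
  proof (rule sum.reindex_bij_witness[of _ "\<lambda>(i, j). (Suc j, i)" "\<lambda>(j, i). (i, j - 1)"])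
    fix p assume "p \<in> ?L"
    then obtain i j where p: "p = (Suc j, i)" "i \<le> j" "Suc j \<le> n"
      by (cases p; cases "fst p") auto
    show "- ?e (case p of (j, i) \<Rightarrow> (i, j - 1)) = ?f p"
      using lower[of i "Suc j"] p by (simp add: signed_Suc add.commute)
  qed auto
  moreover have "sum ?f ?U = (\<Sum>p\<in>?U'. - ?e p)"
  proof (rule sum.reindex_bij_witness[of _ "\<lambda>(i, j). (j, Suc i)" "\<lambda>(j, i). (i - 1, j)"])
    fix p assume "p \<in> ?U"
    then obtain i j where p: "p = (j, Suc i)" "j < i" "i \<le> n"
      by (cases p; cases "snd p") auto
    show "- ?e (case p of (j, i) \<Rightarrow> (i - 1, j)) = ?f p"
      using upper[of j "Suc i"] p by (simp add: signed_Suc add.commute)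
  qed auto
  moreover have "sum ?f ?D + sum ?f ?S = F 0 0 - F (Suc n) n"
  proof -
    have "sum ?f ?D = (\<Sum>j\<le>n. F j j)"
      by (subst sum.reindex) (auto simp: inj_on_def signed_def)
    also have "\<dots> = F 0 0 + (\<Sum>j<n. F (Suc j) (Suc j))"
      by (rule sum.atMost_shift)
    also have "\<dots> = F 0 0 + (\<Sum>j<n. F (Suc j) j)" using diag by simp
    finally have D: "sum ?f ?D = F 0 0 + (\<Sum>j<n. F (Suc j) j)" .
    have "sum ?f ?S = - (\<Sum>j\<le>n. F (Suc j) j)"
      by (subst sum.reindex) (auto simp: inj_on_def signed_def sum_negf)
    then have S: "sum ?f ?S = - (\<Sum>j<n. F (Suc j) j) - F (Suc n) n"
      by (simp add: lessThan_Suc_atMost[symmetric])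
    show ?thesis unfolding D S by simp
  qed
  moreover have "sum ?f ({..n} \<times> {..Suc n}) = sum ?f ?L + sum ?f ?U + (sum ?f ?D + sum ?f ?S)"
  proof -
    have *: "{..n} \<times> {..Suc n} = (?L \<union> ?U) \<union> (?D \<union> ?S)"
    proof (rule Set.set_eqI)
      fix p :: "nat \<times> nat"
      obtain j i where p: "p = (j, i)" by fastforce
      have "i < j \<or> i = j \<or> i = Suc j \<or> Suc j < i" by linarith
      then show "p \<in> {..n} \<times> {..Suc n} \<longleftrightarrow> p \<in> (?L \<union> ?U) \<union> (?D \<union> ?S)"
        unfolding p by (auto simp: image_iff)
    qed
    have d1: "?L \<inter> ?U = {}" "?D \<inter> ?S = {}" "(?L \<union> ?U) \<inter> (?D \<union> ?S) = {}" by auto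
    have "sum ?f ((?L \<union> ?U) \<union> (?D \<union> ?S)) = sum ?f (?L \<union> ?U) + sum ?f (?D \<union> ?S)"
      using fin d1 by (intro sum.union_disjoint) auto
    also have "sum ?f (?L \<union> ?U) = sum ?f ?L + sum ?f ?U"
      using fin d1 by (intro sum.union_disjoint) auto
    also have "sum ?f (?D \<union> ?S) = sum ?f ?D + sum ?f ?S"
      using d1 by (intro sum.union_disjoint) auto
    finally show ?thesis unfolding * .
  qed
  moreover have "sum ?e ({..n} \<times> {..<n}) = sum ?e ?L' + sum ?e ?U'"
  proof -
    have "{..n} \<times> {..<n} = ?L' \<union> ?U'" by auto
    then show ?thesis using fin by (simp add: sum.union_disjoint disjoint_iff)
  qed
  ultimately show ?thesis unfolding sum.cartesian_product sum_negf by (simp add: algebra_simps)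
qed

lemma frag_extend_signed: "frag_extend F (signed k c) = signed k (frag_extend F c)"
  by (simp add: signed_def frag_extend_minus)

lemma keys_signed: "Poly_Mapping.keys (signed k c) = Poly_Mapping.keys (c :: 'a \<Rightarrow>\<^sub>0 int)"
  by (simp add: signed_def)

lemma keys_sum_subset:
  "(\<And>i. i \<in> A \<Longrightarrow> Poly_Mapping.keys (f i) \<subseteq> S) \<Longrightarrow> Poly_Mapping.keys (sum f A :: 'a \<Rightarrow>\<^sub>0 int) \<subseteq> S"
  using sum_closed_free_Abelian_group[of A f S] by simp

section \<open>Linear maps represented by integral chains\<close>

text \<open>
  The additive extension of \<open>x \<mapsto> Elt B x\<close>, which the universal property of the free abelian group
  provides.
\<close>

definition realize :: "('r, 'm, 'x) based_module \<Rightarrow> ('x \<Rightarrow>\<^sub>0 int) \<Rightarrow> 'm"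
  where "realize B = (SOME h. h \<in> hom (free_Abelian_group (Idx B)) (add_monoid (Space B)) \<and>
    (\<forall>x\<in>Idx B. h (frag_of x) = Elt B x))"

context
  fixes R :: "('r, 'k) ring_scheme" and B :: "('r, 'm, 'x) based_module"
  assumes B: "is_basis R B"
begin

interpretation M: module R "Space B" by (rule basis_module[OF B])

lemma realize_hom: "realize B \<in> hom (free_Abelian_group (Idx B)) (add_monoid (Space B))"
  and realize_of: "x \<in> Idx B \<Longrightarrow> realize B (frag_of x) = Elt B x"
proof -
  have "\<exists>h. h \<in> hom (free_Abelian_group (Idx B)) (add_monoid (Space B)) \<and>
      (\<forall>x\<in>Idx B. h (frag_of x) = Elt B x)"
    using comm_group.free_Abelian_group_universal[OF M.M.a_comm_group, of "Elt B" "Idx B"] basis_closed[OF B]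
    by (metis image_subsetI partial_object.select_convs(1))
  from someI_ex[OF this]
  show "realize B \<in> hom (free_Abelian_group (Idx B)) (add_monoid (Space B))"
    "x \<in> Idx B \<Longrightarrow> realize B (frag_of x) = Elt B x"
    by (simp_all add: realize_def)
qed

lemma realize_closed: "Poly_Mapping.keys c \<subseteq> Idx B \<Longrightarrow> realize B c \<in> carrier (Space B)"
  using realize_hom by (auto simp: hom_def Pi_iff)

lemma realize_add:
  "Poly_Mapping.keys c \<subseteq> Idx B \<Longrightarrow> Poly_Mapping.keys c' \<subseteq> Idx B \<Longrightarrow>
    realize B (c + c') = realize B c \<oplus>\<^bsub>Space B\<^esub> realize B c'"
  using realize_hom by (auto simp: hom_def)

lemma realize_zero: "realize B 0 = \<zero>\<^bsub>Space B\<^esub>"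
proof -
  have "realize B 0 \<oplus>\<^bsub>Space B\<^esub> realize B 0 = realize B 0" using realize_add[of 0 0] by simp
  moreover have "realize B 0 \<in> carrier (Space B)" by (rule realize_closed) simp
  ultimately show ?thesis by (metis M.M.add.r_cancel_one')
qed

lemma realize_minus:
  assumes "Poly_Mapping.keys c \<subseteq> Idx B"
  shows "realize B (- c) = \<ominus>\<^bsub>Space B\<^esub> realize B c"
proof -
  have "realize B (- c) \<oplus>\<^bsub>Space B\<^esub> realize B c = \<zero>\<^bsub>Space B\<^esub>"
    using realize_add[of "- c" c] assms realize_zero by simp
  then show ?thesis using realize_closed assms by (metis M.M.minus_equality keys_minus)
qed

lemma realize_diff:
  assumes "Poly_Mapping.keys c \<subseteq> Idx B" "Poly_Mapping.keys c' \<subseteq> Idx B"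
  shows "realize B (c - c') = realize B c \<ominus>\<^bsub>Space B\<^esub> realize B c'"
  using realize_add[of c "- c'"] realize_minus[of c'] assms by (simp add: a_minus_def)

lemma sign_smult:
  assumes "m \<in> carrier (Space B)"
  shows "sign R k \<odot>\<^bsub>Space B\<^esub> m = (if even k then m else \<ominus>\<^bsub>Space B\<^esub> m)"
proof -
  have "sign R k = (if even k then \<one>\<^bsub>R\<^esub> else \<ominus>\<^bsub>R\<^esub> \<one>\<^bsub>R\<^esub>)"
    unfolding sign_def by (induction k) (auto simp: M.R.minus_minus M.R.l_minus)
  then show ?thesis using assms by (simp add: M.minus_one_smult)
qed

lemma realize_signed:
  assumes "Poly_Mapping.keys c \<subseteq> Idx B"
  shows "realize B (signed k c) = sign R k \<odot>\<^bsub>Space B\<^esub> realize B c"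
  using assms sign_smult[OF realize_closed[OF assms]] realize_minus by (simp add: signed_def)

lemma realize_sum:
  assumes "finite A" "\<And>i. i \<in> A \<Longrightarrow> Poly_Mapping.keys (f i) \<subseteq> Idx B"
  shows "realize B (sum f A) = finsum (Space B) (\<lambda>i. realize B (f i)) A"
  using assms
proof (induction A)
  case empty then show ?case by (simp add: realize_zero)
next
  case (insert a A)
  have "realize B (sum f (insert a A)) = realize B (f a) \<oplus>\<^bsub>Space B\<^esub> realize B (sum f A)"
    using insert keys_sum_subset[of A f "Idx B"] by (simp add: realize_add)
  also have "\<dots> = finsum (Space B) (\<lambda>i. realize B (f i)) (insert a A)"
    using insert realize_closed by (simp add: Pi_iff)
  finally show ?case .
qed

end

lemma keys_frag_extend_subset:
  assumes "Poly_Mapping.keys c \<subseteq> S" "\<And>x. x \<in> S \<Longrightarrow> Poly_Mapping.keys (F x) \<subseteq> T"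
  shows "Poly_Mapping.keys (frag_extend F c) \<subseteq> T"
  using keys_frag_extend[of F c] assms by blast

text \<open>
  Matrices over the integers: \<open>F x\<close> holds the coefficients of the image of the basis vector \<open>x\<close>.  Two
  maps with the same matrix agree, so an identity between linear maps reduces to one between integral
  chains.
\<close>

definition represents ::
  "('r, 'k) ring_scheme \<Rightarrow> ('r, 'm, 'x) based_module \<Rightarrow> ('r, 'n, 'y) based_module \<Rightarrow>
    ('m \<Rightarrow> 'n) \<Rightarrow> ('x \<Rightarrow> ('y \<Rightarrow>\<^sub>0 int)) \<Rightarrow> bool"
  where "represents R B B' \<phi> F \<longleftrightarrow> is_basis R B \<and> is_basis R B' \<and>
    \<phi> \<in> mod_hom R (Space B) (Space B') \<and>
    (\<forall>x\<in>Idx B. Poly_Mapping.keys (F x) \<subseteq> Idx B' \<and> \<phi> (Elt B x) = realize B' (F x))"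

lemma represents_some:
  assumes "is_basis R B" "is_basis R B'" "\<And>x. x \<in> Idx B \<Longrightarrow> Poly_Mapping.keys (F x) \<subseteq> Idx B'"
  shows "represents R B B' (SOME \<phi>. represents R B B' \<phi> F) F"
proof -
  have "\<exists>\<phi>. represents R B B' \<phi> F"
    using basis_extend[OF assms(1) basis_module[OF assms(2)], of "\<lambda>x. realize B' (F x)"]
      realize_closed[OF assms(2)] assms
    by (auto simp: represents_def)
  then show ?thesis by (rule someI_ex)
qed

lemma represents_basis_map:
  assumes "is_basis R B" "is_basis R B'" "\<phi> \<in> mod_hom R (Space B) (Space B')"
    "\<And>x. x \<in> Idx B \<Longrightarrow> f x \<in> Idx B'" "\<And>x. x \<in> Idx B \<Longrightarrow> \<phi> (Elt B x) = Elt B' (f x)"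
  shows "represents R B B' \<phi> (\<lambda>x. frag_of (f x))"
  using assms by (simp add: represents_def realize_of[OF assms(2)])

lemma represents_id: "is_basis R B \<Longrightarrow> represents R B B (\<lambda>m. m) frag_of"
  by (simp add: represents_def realize_of mod_hom_id)

lemma represents_const_zero:
  "is_basis R B \<Longrightarrow> is_basis R B' \<Longrightarrow> represents R B B' (\<lambda>m. \<zero>\<^bsub>Space B'\<^esub>) (\<lambda>x. 0)"
  by (simp add: represents_def realize_zero mod_hom_const_zero basis_module)

context
  fixes R :: "('r, 'k) ring_scheme" and B :: "('r, 'm, 'x) based_module"
    and B' :: "('r, 'n, 'y) based_module" and \<phi> F
  assumes \<phi>: "represents R B B' \<phi> F"
begin

lemma represents_bases: "is_basis R B" "is_basis R B'"
  and represents_hom: "\<phi> \<in> mod_hom R (Space B) (Space B')"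
  and represents_keys: "x \<in> Idx B \<Longrightarrow> Poly_Mapping.keys (F x) \<subseteq> Idx B'"
  and represents_elt: "x \<in> Idx B \<Longrightarrow> \<phi> (Elt B x) = realize B' (F x)"
  using \<phi> by (auto simp: represents_def)

interpretation M: module R "Space B" by (rule basis_module[OF represents_bases(1)])
interpretation N: module R "Space B'" by (rule basis_module[OF represents_bases(2)])

lemma represents_closed: "m \<in> carrier (Space B) \<Longrightarrow> \<phi> m \<in> carrier (Space B')"
  by (rule mod_homD(1)[OF represents_hom])

lemma represents_zero: "\<phi> \<zero>\<^bsub>Space B\<^esub> = \<zero>\<^bsub>Space B'\<^esub>"
  by (rule mod_hom_zero[OF M.module_axioms N.module_axioms represents_hom])

lemma represents_cong:
  assumes "\<And>x. x \<in> Idx B \<Longrightarrow> G x = F x" "\<And>m. m \<in> carrier (Space B) \<Longrightarrow> \<psi> m = \<phi> m"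
  shows "represents R B B' \<psi> G"
  using \<phi> assms basis_closed[OF represents_bases(1)]
    mod_hom_cong[OF represents_hom M.module_axioms, of \<psi>]
  by (auto simp: represents_def)

lemma represents_realize:
  assumes c: "Poly_Mapping.keys c \<subseteq> Idx B"
  shows "\<phi> (realize B c) = realize B' (frag_extend F c)"
proof -
  note B = represents_bases
  have "Poly_Mapping.keys c \<subseteq> Idx B \<and> \<phi> (realize B c) = realize B' (frag_extend F c)"
    using c
  proof (induction c rule: frag_induction)
    case zero
    then show ?case by (simp add: realize_zero[OF B(1)] realize_zero[OF B(2)] represents_zero)
  next
    case (one x)
    then show ?case by (simp add: realize_of[OF B(1)] represents_elt)
  next
    case (diff a b)
    then have ab: "Poly_Mapping.keys a \<subseteq> Idx B" "Poly_Mapping.keys b \<subseteq> Idx B" by auto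
    have "Poly_Mapping.keys (a - b) \<subseteq> Idx B" using ab keys_diff[of a b] by blast
    then show ?case
      using diff ab
      by (simp add: realize_diff[OF B(1)] realize_diff[OF B(2)] frag_extend_diff
        keys_frag_extend_subset[OF _ represents_keys] realize_closed[OF B(1)]
        mod_hom_diff[OF M.module_axioms N.module_axioms represents_hom])
  qed
  then show ?thesis by simp
qed

lemma represents_sign:
  "represents R B B' (\<lambda>m. sign R k \<odot>\<^bsub>Space B'\<^esub> \<phi> m) (\<lambda>x. signed k (F x))"
  using represents_bases represents_keys represents_elt
    mod_hom_scale[OF N.module_axioms represents_hom, of "sign R k"]
  by (simp add: represents_def keys_signed realize_signed sign_def)

lemma represents_neg: "represents R B B' (\<lambda>m. \<ominus>\<^bsub>Space B'\<^esub> \<phi> m) (\<lambda>x. - F x)"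
  using represents_bases represents_keys represents_elt mod_hom_neg[OF N.module_axioms represents_hom]
  by (simp add: represents_def realize_minus)

lemma represents_add:
  assumes \<psi>: "represents R B B' \<psi> G"
  shows "represents R B B' (\<lambda>m. \<phi> m \<oplus>\<^bsub>Space B'\<^esub> \<psi> m) (\<lambda>x. F x + G x)"
  using \<phi> \<psi> mod_hom_plus[OF N.module_axioms, of \<phi> _ \<psi>] keys_add
  by (fastforce simp: represents_def realize_add[OF represents_bases(2)])

lemma represents_diff:
  assumes \<psi>: "represents R B B' \<psi> G"
  shows "represents R B B' (\<lambda>m. \<phi> m \<ominus>\<^bsub>Space B'\<^esub> \<psi> m) (\<lambda>x. F x - G x)"
  using \<phi> \<psi> mod_hom_sub[OF N.module_axioms, of \<phi> _ \<psi>] keys_diff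
  by (fastforce simp: represents_def realize_diff[OF represents_bases(2)])

end

lemma represents_comp:
  assumes \<phi>: "represents R B B' \<phi> F" and \<psi>: "represents R B' B'' \<psi> G"
  shows "represents R B B'' (\<lambda>m. \<psi> (\<phi> m)) (\<lambda>x. frag_extend G (F x))"
  unfolding represents_def
proof (intro conjI ballI)
  show "is_basis R B" "is_basis R B''" using represents_bases[OF \<phi>] represents_bases[OF \<psi>] by auto
  show "(\<lambda>m. \<psi> (\<phi> m)) \<in> mod_hom R (Space B) (Space B'')"
    by (rule mod_hom_comp[OF represents_hom[OF \<phi>] represents_hom[OF \<psi>]])
  fix x assume x: "x \<in> Idx B"
  note k = represents_keys[OF \<phi> x]
  show "Poly_Mapping.keys (frag_extend G (F x)) \<subseteq> Idx B''"
    by (rule keys_frag_extend_subset[OF k represents_keys[OF \<psi>]])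
  show "\<psi> (\<phi> (Elt B x)) = realize B'' (frag_extend G (F x))"
    by (simp add: represents_elt[OF \<phi> x] represents_realize[OF \<psi> k])
qed

lemma represents_eq:
  assumes \<phi>: "represents R B B' \<phi> F" and \<psi>: "represents R B B' \<psi> G"
    and "\<And>x. x \<in> Idx B \<Longrightarrow> F x = G x" "m \<in> carrier (Space B)"
  shows "\<phi> m = \<psi> m"
  using basis_eq[OF represents_bases(1)[OF \<phi>] basis_module[OF represents_bases(2)[OF \<phi>]]
      represents_hom[OF \<phi>] represents_hom[OF \<psi>] _ assms(4)] assms(3)
  by (simp add: represents_elt[OF \<phi>] represents_elt[OF \<psi>])

lemma represents_sum:
  assumes B: "is_basis R B" "is_basis R B'" and A: "finite A"
    and \<phi>: "\<And>i. i \<in> A \<Longrightarrow> represents R B B' (\<phi> i) (F i)"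
  shows "represents R B B' (\<lambda>m. finsum (Space B') (\<lambda>i. \<phi> i m) A) (\<lambda>x. \<Sum>i\<in>A. F i x)"
  unfolding represents_def
proof (intro conjI ballI B)
  interpret N: module R "Space B'" by (rule basis_module[OF B(2)])
  show "(\<lambda>m. finsum (Space B') (\<lambda>i. \<phi> i m) A) \<in> mod_hom R (Space B) (Space B')"
    by (intro mod_hom_sum N.module_axioms A represents_hom[OF \<phi>])
  fix x assume x: "x \<in> Idx B"
  note k = represents_keys[OF \<phi> x]
  show "Poly_Mapping.keys (\<Sum>i\<in>A. F i x) \<subseteq> Idx B'" using k by (intro keys_sum_subset) auto
  have "realize B' (\<Sum>i\<in>A. F i x) = finsum (Space B') (\<lambda>i. realize B' (F i x)) A"
    using k by (intro realize_sum[OF B(2) A]) auto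
  also have "\<dots> = finsum (Space B') (\<lambda>i. \<phi> i (Elt B x)) A"
    using k represents_elt[OF \<phi> x] realize_closed[OF B(2)] by (intro N.M.finsum_cong') auto
  finally show "finsum (Space B') (\<lambda>i. \<phi> i (Elt B x)) A = realize B' (\<Sum>i\<in>A. F i x)" by simp
qed

lemma represents_funpow:
  assumes B: "is_basis R B" and \<phi>: "represents R B B \<phi> (\<lambda>x. signed k (frag_of (f x)))"
  shows "represents R B B (\<phi> ^^ j) (\<lambda>x. signed (k * j) (frag_of ((f ^^ j) x)))"
proof (induction j)
  case 0 then show ?case using represents_id[OF B] by (simp add: id_def)
next
  case (Suc j)
  show ?case
    by (rule represents_cong[OF represents_comp[OF Suc.IH \<phi>]])
      (simp_all add: frag_extend_signed signed_signed algebra_simps)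
qed


section \<open>Total complexes\<close>

text \<open>
  The relations that make the total differential a differential; horizontal and vertical maps
  anticommute because the odd columns carry \<open>-b'\<close>.
\<close>

locale bicomplex =
  fixes R :: "('r, 'k) ring_scheme" and C :: "('r, 'c) cyclic_module"
  assumes Deg_module: "module R (Deg C q)"
    and vert_hom: "vert R C p (Suc q) \<in> mod_hom R (Deg C (Suc q)) (Deg C q)"
    and horiz_hom: "horiz R C p q \<in> mod_hom R (Deg C q) (Deg C q)"
    and vert_vert: "x \<in> carrier (Deg C (Suc (Suc q))) \<Longrightarrow>
      vert R C p (Suc q) (vert R C p (Suc (Suc q)) x) = \<zero>\<^bsub>Deg C q\<^esub>"
    and horiz_horiz: "x \<in> carrier (Deg C q) \<Longrightarrow> horiz R C p q (horiz R C (Suc p) q x) = \<zero>\<^bsub>Deg C q\<^esub>"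
    and vert_horiz: "x \<in> carrier (Deg C (Suc q)) \<Longrightarrow>
      vert R C p (Suc q) (horiz R C (Suc p) (Suc q) x) \<oplus>\<^bsub>Deg C q\<^esub>
      horiz R C (Suc p) q (vert R C (Suc p) (Suc q) x) = \<zero>\<^bsub>Deg C q\<^esub>"
begin

sublocale Deg: module R "Deg C q" for q
  by (rule Deg_module)

lemmas vertD = mod_homD[OF vert_hom] and horizD = mod_homD[OF horiz_hom]

lemma Tot_module: "module R (Tot C n)"
  unfolding Tot_def by (rule dsum_module_module[OF Deg.R.cring_axioms _ Deg_module]) simp

sublocale Tot: module R "Tot C n" for n
  by (rule Tot_module)

lemma Tot_carrier: "carrier (Tot C n) = (\<Pi>\<^sub>E p\<in>{..n}. carrier (Deg C (n - p)))"
  by (simp add: Tot_def dsum_module_finite_carrier)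

lemma Tot_closed: "x \<in> carrier (Tot C n) \<Longrightarrow> p \<le> n \<Longrightarrow> x p \<in> carrier (Deg C (n - p))"
  by (auto simp: Tot_carrier)

lemma Tot_eqI:
  "x \<in> carrier (Tot C n) \<Longrightarrow> y \<in> carrier (Tot C n) \<Longrightarrow> (\<And>p. p \<le> n \<Longrightarrow> x p = y p) \<Longrightarrow> x = y"
  unfolding Tot_carrier by (rule PiE_ext) auto

lemma Tot_simps:
  "p \<le> n \<Longrightarrow> \<zero>\<^bsub>Tot C n\<^esub> p = \<zero>\<^bsub>Deg C (n - p)\<^esub>"
  "p \<le> n \<Longrightarrow> (x \<oplus>\<^bsub>Tot C n\<^esub> y) p = x p \<oplus>\<^bsub>Deg C (n - p)\<^esub> y p"
  "p \<le> n \<Longrightarrow> (r \<odot>\<^bsub>Tot C n\<^esub> x) p = r \<odot>\<^bsub>Deg C (n - p)\<^esub> x p"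
  by (simp_all add: Tot_def dsum_module_simps)

lemma tot_diff_apply:
  "p \<le> n \<Longrightarrow> tot_diff R C (Suc n) x p =
    vert R C p (Suc (n - p)) (x p) \<oplus>\<^bsub>Deg C (n - p)\<^esub> horiz R C (Suc p) (n - p) (x (Suc p))"
  by (simp add: tot_diff_def Suc_diff_le)

lemma Tot_comp:
  assumes "x \<in> carrier (Tot C (Suc n))" "p \<le> n"
  shows "x p \<in> carrier (Deg C (Suc (n - p)))" "x (Suc p) \<in> carrier (Deg C (n - p))"
  using Tot_closed[OF assms(1), of p] Tot_closed[OF assms(1), of "Suc p"] assms(2)
  by (simp_all add: Suc_diff_le)

lemma tot_diff_hom: "tot_diff R C (Suc n) \<in> mod_hom R (Tot C (Suc n)) (Tot C n)"
proof -
  have closed: "tot_diff R C (Suc n) x \<in> carrier (Tot C n)" if "x \<in> carrier (Tot C (Suc n))" for x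
    unfolding Tot_carrier
  proof (rule PiE_I)
    fix p assume "p \<in> {..n}"
    then show "tot_diff R C (Suc n) x p \<in> carrier (Deg C (n - p))"
      using Tot_comp[OF that, of p] by (simp add: tot_diff_apply vertD(1) horizD(1))
  qed (simp add: tot_diff_def)
  show ?thesis
  proof (rule mod_homI)
    fix x y assume xy: "x \<in> carrier (Tot C (Suc n))" "y \<in> carrier (Tot C (Suc n))"
    show "tot_diff R C (Suc n) (x \<oplus>\<^bsub>Tot C (Suc n)\<^esub> y) =
        tot_diff R C (Suc n) x \<oplus>\<^bsub>Tot C n\<^esub> tot_diff R C (Suc n) y"
      by (rule Tot_eqI) (use xy closed Tot_comp[OF xy(1)] Tot_comp[OF xy(2)] in
        \<open>auto simp: tot_diff_apply Tot_simps Suc_diff_le vertD horizD Deg.M.a_ac\<close>)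
  next
    fix r x assume rx: "r \<in> carrier R" "x \<in> carrier (Tot C (Suc n))"
    show "tot_diff R C (Suc n) (r \<odot>\<^bsub>Tot C (Suc n)\<^esub> x) = r \<odot>\<^bsub>Tot C n\<^esub> tot_diff R C (Suc n) x"
      by (rule Tot_eqI) (use rx closed Tot_comp[OF rx(2)] in
        \<open>auto simp: tot_diff_apply Tot_simps Suc_diff_le vertD horizD Deg.smult_r_distr\<close>)
  qed (rule closed)
qed

lemmas tot_diffD = mod_homD[OF tot_diff_hom]

lemma tot_diff_diff:
  assumes x: "x \<in> carrier (Tot C (Suc (Suc n)))"
  shows "tot_diff R C (Suc n) (tot_diff R C (Suc (Suc n)) x) = \<zero>\<^bsub>Tot C n\<^esub>"
proof (rule Tot_eqI)
  fix p assume p: "p \<le> n"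
  let ?q = "n - p"
  have q: "Suc n - p = Suc ?q" "Suc (Suc n) - p = Suc (Suc ?q)" using p by auto
  have a: "x p \<in> carrier (Deg C (Suc (Suc ?q)))" "x (Suc p) \<in> carrier (Deg C (Suc ?q))"
    "x (Suc (Suc p)) \<in> carrier (Deg C ?q)"
    using Tot_closed[OF x, of p] Tot_closed[OF x, of "Suc p"] Tot_closed[OF x, of "Suc (Suc p)"] p q by auto
  have d: "tot_diff R C (Suc (Suc n)) x p = vert R C p (Suc (Suc ?q)) (x p) \<oplus>\<^bsub>Deg C (Suc ?q)\<^esub>
       horiz R C (Suc p) (Suc ?q) (x (Suc p))"
    "tot_diff R C (Suc (Suc n)) x (Suc p) = vert R C (Suc p) (Suc ?q) (x (Suc p)) \<oplus>\<^bsub>Deg C ?q\<^esub>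
       horiz R C (Suc (Suc p)) ?q (x (Suc (Suc p)))"
    using p q by (simp_all add: tot_diff_apply)
  have e: "vert R C p (Suc ?q) (horiz R C (Suc p) (Suc ?q) (x (Suc p))) \<in> carrier (Deg C ?q)"
    "horiz R C (Suc p) ?q (vert R C (Suc p) (Suc ?q) (x (Suc p))) \<in> carrier (Deg C ?q)"
    using a by (simp_all add: vertD(1) horizD(1))
  have "tot_diff R C (Suc n) (tot_diff R C (Suc (Suc n)) x) p =
    (\<zero>\<^bsub>Deg C ?q\<^esub> \<oplus>\<^bsub>Deg C ?q\<^esub> vert R C p (Suc ?q) (horiz R C (Suc p) (Suc ?q) (x (Suc p)))) \<oplus>\<^bsub>Deg C ?q\<^esub>
    (horiz R C (Suc p) ?q (vert R C (Suc p) (Suc ?q) (x (Suc p))) \<oplus>\<^bsub>Deg C ?q\<^esub> \<zero>\<^bsub>Deg C ?q\<^esub>)"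
    unfolding tot_diff_apply[OF p] d using a
    by (simp add: vertD horizD vert_vert horiz_horiz)
  also have "\<dots> = \<zero>\<^bsub>Deg C ?q\<^esub>" using e vert_horiz[OF a(2)] by simp
  finally show "tot_diff R C (Suc n) (tot_diff R C (Suc (Suc n)) x) p = \<zero>\<^bsub>Tot C n\<^esub> p"
    using p by (simp add: Tot_simps)
qed (use tot_diffD(1) x in auto)

lemma tot_cycles_submodule: "submodule (tot_cycles R C n) R (Tot C n)"
proof (cases n)
  case 0
  then show ?thesis using Tot.carrier_is_submodule by (simp add: tot_cycles_def)
next
  case (Suc m)
  then show ?thesis
    using submodule_kernel[OF Tot_module Tot_module tot_diff_hom, of m] by (simp add: tot_cycles_def)
qed

lemma tot_boundaries_submodule: "submodule (tot_boundaries R C n) R (Tot C n)"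
  using submodule_image[OF Tot_module Tot_module tot_diff_hom, of n] by (simp add: tot_boundaries_def)

lemma tot_boundaries_cycles: "tot_boundaries R C n \<subseteq> tot_cycles R C n"
proof (cases n)
  case 0
  then show ?thesis using tot_diffD(1)[of _ 0] by (auto simp: tot_boundaries_def tot_cycles_def)
next
  case (Suc m)
  then show ?thesis
    using tot_diffD(1)[of _ n] tot_diff_diff[of _ m] by (auto simp: tot_boundaries_def tot_cycles_def)
qed

lemma cycles_module: "module R ((Tot C n)\<lparr>carrier := tot_cycles R C n\<rparr>)"
  by (rule submodule.submodule_is_module[OF tot_cycles_submodule Tot_module])

lemma boundaries_submodule_cycles:
  "submodule (tot_boundaries R C n) R ((Tot C n)\<lparr>carrier := tot_cycles R C n\<rparr>)"
  by (rule submodule_restrict[OF Tot_module tot_cycles_submodule tot_boundaries_submodule tot_boundaries_cycles])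

text \<open>
  A zigzag from the last column to the first.  Given \<open>y (p + 1)\<close>, the element
  \<open>z p - horiz (y (p + 1))\<close> is a vertical cycle, because \<open>z\<close> is a total cycle and \<open>y\<close> already solves the
  equation in column \<open>p + 1\<close>; exactness of column \<open>p\<close> then provides \<open>y p\<close>.
\<close>

lemma total_exact_if_columns_exact:
  fixes K :: "nat \<Rightarrow> 'c set"
  assumes K: "\<And>q. submodule (K q) R (Deg C q)"
    and Khor: "\<And>p q x. x \<in> K q \<Longrightarrow> horiz R C p q x \<in> K q"
    and exact: "\<And>p q x. x \<in> K q \<Longrightarrow> (\<And>m. q = Suc m \<Longrightarrow> vert R C p q x = \<zero>\<^bsub>Deg C m\<^esub>) \<Longrightarrow>
      \<exists>y\<in>K (Suc q). vert R C p (Suc q) y = x"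
    and z: "z \<in> tot_cycles R C n" and zK: "\<And>p. p \<le> n \<Longrightarrow> z p \<in> K (n - p)"
  shows "\<exists>y\<in>carrier (Tot C (Suc n)). tot_diff R C (Suc n) y = z"
proof -
  have zc: "z \<in> carrier (Tot C n)" using z by (simp add: tot_cycles_def)
  have Kc: "x \<in> carrier (Deg C q)" if "x \<in> K q" for x q
    using Deg.submoduleE(1)[OF K] that by blast
  \<comment> \<open>\<open>y\<close> is a solution in the last \<open>m\<close> columns, where column \<open>n + 1\<close> carries no equation\<close>
  define good where "good = (\<lambda>m y. (\<forall>p\<le>Suc n. Suc n \<le> p + m \<longrightarrow> y p \<in> K (Suc n - p)) \<and>
      (\<forall>p\<le>n. Suc n \<le> p + m \<longrightarrow> vert R C p (Suc (n - p)) (y p) \<oplus>\<^bsub>Deg C (n - p)\<^esub>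
         horiz R C (Suc p) (n - p) (y (Suc p)) = z p))"
  have "m \<le> Suc n \<Longrightarrow> \<exists>y. good m y" for m
  proof (induction m)
    case 0
    have "good 0 (\<lambda>_. \<zero>\<^bsub>Deg C 0\<^esub>)"
      using submodule_zero[OF Deg_module K, of 0] by (auto simp: good_def)
    then show ?case by blast
  next
    case (Suc m)
    then obtain y where y: "good m y" by auto
    define p where "p = n - m"
    have p: "p \<le> n" "n - p = m" "Suc n \<le> Suc p + m" using Suc.prems by (auto simp: p_def)
    have yK: "y (Suc p) \<in> K m"
      using y p by (auto simp: good_def)
    define w where "w = z p \<ominus>\<^bsub>Deg C m\<^esub> horiz R C (Suc p) m (y (Suc p))"
    have w: "w \<in> K m"
      using zK[OF p(1)] Khor[OF yK] Deg.submoduleE(3,5)[OF K] p by (simp add: w_def a_minus_def)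
    have zp: "z p \<in> carrier (Deg C m)" using Kc zK[OF p(1)] p by simp
    note yc = Kc[OF yK]
    have "vert R C p m w = \<zero>\<^bsub>Deg C l\<^esub>" if ml: "m = Suc l" for l
    proof -
      have pn: "Suc p \<le> n" "n - Suc p = l" "Suc n - Suc (Suc p) = l" using p ml by auto
      obtain n' where n': "n = Suc n'" using pn(1) by (cases n) auto
      have pn': "p \<le> n'" "n' - p = l" using pn n' by auto
      have "tot_diff R C n z p = \<zero>\<^bsub>Deg C l\<^esub>"
        using z pn' by (auto simp: tot_cycles_def n' Tot_simps)
      then have c: "vert R C p m (z p) \<oplus>\<^bsub>Deg C l\<^esub> horiz R C (Suc p) l (z (Suc p)) = \<zero>\<^bsub>Deg C l\<^esub>"
        unfolding n' tot_diff_apply[OF pn'(1)] pn'(2) ml .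
      have y2: "y (Suc (Suc p)) \<in> carrier (Deg C l)"
        using y pn p by (intro Kc) (auto simp: good_def)
      have e: "vert R C (Suc p) m (y (Suc p)) \<oplus>\<^bsub>Deg C l\<^esub> horiz R C (Suc (Suc p)) l (y (Suc (Suc p))) = z (Suc p)"
        using y pn p ml by (auto simp: good_def)
      let ?hv = "horiz R C (Suc p) l (vert R C (Suc p) m (y (Suc p)))"
      have yc': "y (Suc p) \<in> carrier (Deg C (Suc l))" using yc ml by simp
      have zp': "z p \<in> carrier (Deg C (Suc l))" using zp ml by simp
      have hv: "?hv \<in> carrier (Deg C l)" unfolding ml by (intro horizD(1) vertD(1) yc')
      have "horiz R C (Suc p) l (z (Suc p)) = ?hv"
      proof -
        have "horiz R C (Suc p) l (z (Suc p)) =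
            ?hv \<oplus>\<^bsub>Deg C l\<^esub> horiz R C (Suc p) l (horiz R C (Suc (Suc p)) l (y (Suc (Suc p))))"
          unfolding e[symmetric] ml by (intro horizD(2) vertD(1) horizD(1) yc' y2)
        also have "\<dots> = ?hv" unfolding horiz_horiz[OF y2] using hv by simp
        finally show ?thesis .
      qed
      moreover have "vert R C p m (z p) \<in> carrier (Deg C l)" unfolding ml by (intro vertD(1) zp')
      ultimately have 1: "vert R C p m (z p) = \<ominus>\<^bsub>Deg C l\<^esub> ?hv" using c hv Deg.M.minus_equality by metis
      have vh: "vert R C p m (horiz R C (Suc p) m (y (Suc p))) \<in> carrier (Deg C l)"
        unfolding ml by (intro horizD(1) vertD(1) yc')
      have 2: "vert R C p m (horiz R C (Suc p) m (y (Suc p))) = \<ominus>\<^bsub>Deg C l\<^esub> ?hv"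
        using vert_horiz[OF yc', of p] hv vh Deg.M.minus_equality unfolding ml by metis
      have "vert R C p m w = vert R C p m (z p) \<ominus>\<^bsub>Deg C l\<^esub> vert R C p m (horiz R C (Suc p) m (y (Suc p)))"
        unfolding w_def ml using zp' yc' horizD(1)
        by (intro mod_hom_diff[OF Deg_module Deg_module vert_hom]) auto
      also have "\<dots> = \<zero>\<^bsub>Deg C l\<^esub>" unfolding 1 2 using hv by (simp add: Deg.M.diff_self)
      finally show ?thesis .
    qed
    then obtain u where u: "u \<in> K (Suc m)" "vert R C p (Suc m) u = w" using exact[OF w] by blast
    have "vert R C p (Suc m) u \<oplus>\<^bsub>Deg C m\<^esub> horiz R C (Suc p) m (y (Suc p)) = z p"
      unfolding u(2) w_def using zp yc horizD(1) by (simp add: Deg.M.diff_add_cancel)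
    note eq = this
    have "good (Suc m) (y(p := u))"
      unfolding good_def
    proof (intro conjI allI impI)
      fix p' assume p': "p' \<le> Suc n" "Suc n \<le> p' + Suc m"
      have "p' = p \<or> Suc n \<le> p' + m" using p p' by linarith
      then show "(y(p := u)) p' \<in> K (Suc n - p')"
        using y u(1) p p' by (auto simp: good_def Suc_diff_le)
    next
      fix p' assume p': "p' \<le> n" "Suc n \<le> p' + Suc m"
      have "p' = p \<or> (Suc n \<le> p' + m \<and> p' \<noteq> p \<and> Suc p' \<noteq> p)" using p p' by linarith
      then show "vert R C p' (Suc (n - p')) ((y(p := u)) p') \<oplus>\<^bsub>Deg C (n - p')\<^esub>
          horiz R C (Suc p') (n - p') ((y(p := u)) (Suc p')) = z p'"
        using y eq p p' by (auto simp: good_def)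
    qed
    then show ?case by blast
  qed
  then obtain y where y: "good (Suc n) y" by blast
  define x where "x = restrict y {..Suc n}"
  have x: "x \<in> carrier (Tot C (Suc n))"
    unfolding Tot_carrier x_def using y Kc by (auto simp: good_def)
  moreover have "tot_diff R C (Suc n) x = z"
  proof (rule Tot_eqI[OF tot_diffD(1)[OF x] zc])
    fix p assume p: "p \<le> n"
    show "tot_diff R C (Suc n) x p = z p"
      unfolding tot_diff_apply[OF p] using y p by (simp add: good_def x_def)
  qed
  ultimately show ?thesis by blast
qed

end

definition bicomplex_map ::
  "('r, 'k) ring_scheme \<Rightarrow> ('r, 'c) cyclic_module \<Rightarrow> ('r, 'd) cyclic_module \<Rightarrow> (nat \<Rightarrow> 'c \<Rightarrow> 'd) \<Rightarrow> bool"
  where "bicomplex_map R C D f \<longleftrightarrow> (\<forall>q. f q \<in> mod_hom R (Deg C q) (Deg D q)) \<and>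
    (\<forall>p q. \<forall>x\<in>carrier (Deg C (Suc q)). f q (vert R C p (Suc q) x) = vert R D p (Suc q) (f (Suc q) x)) \<and>
    (\<forall>p q. \<forall>x\<in>carrier (Deg C q). f q (horiz R C p q x) = horiz R D p q (f q x))"

definition tot_map :: "(nat \<Rightarrow> 'c \<Rightarrow> 'd) \<Rightarrow> nat \<Rightarrow> (nat \<Rightarrow> 'c) \<Rightarrow> nat \<Rightarrow> 'd"
  where "tot_map f n x = (\<lambda>p\<in>{..n}. f (n - p) (x p))"

context
  fixes R :: "('r, 'k) ring_scheme" and C :: "('r, 'c) cyclic_module" and D :: "('r, 'd) cyclic_module"
    and f :: "nat \<Rightarrow> 'c \<Rightarrow> 'd"
  assumes C: "bicomplex R C" and D: "bicomplex R D" and f: "bicomplex_map R C D f"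
begin

interpretation C: bicomplex R C by (fact C)
interpretation D: bicomplex R D by (fact D)

lemma bicomplex_map_hom: "f q \<in> mod_hom R (Deg C q) (Deg D q)"
  using f by (simp add: bicomplex_map_def)

lemma tot_map_hom: "tot_map f n \<in> mod_hom R (Tot C n) (Tot D n)"
proof (rule mod_homI)
  note h = mod_homD[OF bicomplex_map_hom]
  have closed: "tot_map f n x \<in> carrier (Tot D n)" if "x \<in> carrier (Tot C n)" for x
    using C.Tot_closed[OF that] h(1) by (auto simp: D.Tot_carrier tot_map_def)
  then show "\<And>x. x \<in> carrier (Tot C n) \<Longrightarrow> tot_map f n x \<in> carrier (Tot D n)" .
  show "tot_map f n (x \<oplus>\<^bsub>Tot C n\<^esub> y) = tot_map f n x \<oplus>\<^bsub>Tot D n\<^esub> tot_map f n y"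
    if xy: "x \<in> carrier (Tot C n)" "y \<in> carrier (Tot C n)" for x y
  proof (rule D.Tot_eqI)
    fix p assume p: "p \<le> n"
    show "tot_map f n (x \<oplus>\<^bsub>Tot C n\<^esub> y) p = (tot_map f n x \<oplus>\<^bsub>Tot D n\<^esub> tot_map f n y) p"
      using C.Tot_closed[OF xy(1) p] C.Tot_closed[OF xy(2) p] p
      by (simp add: D.Tot_simps C.Tot_simps tot_map_def h)
  qed (use xy closed in auto)
  show "tot_map f n (r \<odot>\<^bsub>Tot C n\<^esub> x) = r \<odot>\<^bsub>Tot D n\<^esub> tot_map f n x"
    if rx: "r \<in> carrier R" "x \<in> carrier (Tot C n)" for r x
  proof (rule D.Tot_eqI)
    fix p assume p: "p \<le> n"
    show "tot_map f n (r \<odot>\<^bsub>Tot C n\<^esub> x) p = (r \<odot>\<^bsub>Tot D n\<^esub> tot_map f n x) p"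
      using C.Tot_closed[OF rx(2) p] p rx(1) by (simp add: D.Tot_simps C.Tot_simps tot_map_def h)
  qed (use rx closed in auto)
qed

lemma tot_map_diff:
  assumes x: "x \<in> carrier (Tot C (Suc n))"
  shows "tot_map f n (tot_diff R C (Suc n) x) = tot_diff R D (Suc n) (tot_map f (Suc n) x)"
proof (rule D.Tot_eqI)
  note h = mod_homD[OF bicomplex_map_hom]
  fix p assume p: "p \<le> n"
  note c = C.Tot_comp[OF x p]
  show "tot_map f n (tot_diff R C (Suc n) x) p = tot_diff R D (Suc n) (tot_map f (Suc n) x) p"
    using p c C.vertD(1) C.horizD(1) f
    by (simp add: D.tot_diff_apply C.tot_diff_apply tot_map_def Suc_diff_le h(2) bicomplex_map_def)
qed (use mod_homD(1)[OF tot_map_hom] C.tot_diffD(1) D.tot_diffD(1) x in auto)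

lemma tot_map_cycles: "z \<in> tot_cycles R C n \<Longrightarrow> tot_map f n z \<in> tot_cycles R D n"
proof (cases n)
  case 0
  then show "z \<in> tot_cycles R C n \<Longrightarrow> tot_map f n z \<in> tot_cycles R D n"
    using mod_homD(1)[OF tot_map_hom] by (auto simp: tot_cycles_def)
next
  case (Suc m)
  then show "z \<in> tot_cycles R C n \<Longrightarrow> tot_map f n z \<in> tot_cycles R D n"
    using mod_homD(1)[OF tot_map_hom] tot_map_diff[of z m] mod_hom_zero[OF C.Tot_module D.Tot_module tot_map_hom]
    by (auto simp: tot_cycles_def)
qed

lemma tot_map_boundaries: "z \<in> tot_boundaries R C n \<Longrightarrow> tot_map f n z \<in> tot_boundaries R D n"
  using tot_map_diff mod_homD(1)[OF tot_map_hom] by (auto simp: tot_boundaries_def)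

end

text \<open>
  If the projection of a cycle \<open>z\<close> to every summand is a boundary, subtract from \<open>z\<close> the boundary
  obtained by including the finitely many primitives.  The difference lies in the common kernel of the
  projections, whose total complex is exact.
\<close>

theorem homology_decomposition:
  fixes R :: "('r, 'k) ring_scheme" and C :: "('r, 'c) cyclic_module"
    and D :: "'i \<Rightarrow> ('r, 'd) cyclic_module"
  assumes C: "bicomplex R C" and D: "\<And>c. c \<in> I \<Longrightarrow> bicomplex R (D c)"
    and r: "\<And>c. c \<in> I \<Longrightarrow> bicomplex_map R C (D c) (r c)"
    and j: "\<And>c. c \<in> I \<Longrightarrow> bicomplex_map R (D c) C (j c)"
    and rj: "\<And>c q y. c \<in> I \<Longrightarrow> y \<in> carrier (Deg (D c) q) \<Longrightarrow> r c q (j c q y) = y"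
    and rj': "\<And>c c' q y. c \<in> I \<Longrightarrow> c' \<in> I \<Longrightarrow> c' \<noteq> c \<Longrightarrow> y \<in> carrier (Deg (D c) q) \<Longrightarrow>
      r c' q (j c q y) = \<zero>\<^bsub>Deg (D c') q\<^esub>"
    and fin: "\<And>q x. x \<in> carrier (Deg C q) \<Longrightarrow> finite {c \<in> I. r c q x \<noteq> \<zero>\<^bsub>Deg (D c) q\<^esub>}"
    and exact: "\<And>p q x. x \<in> carrier (Deg C q) \<Longrightarrow> (\<And>c. c \<in> I \<Longrightarrow> r c q x = \<zero>\<^bsub>Deg (D c) q\<^esub>) \<Longrightarrow>
      (\<And>m. q = Suc m \<Longrightarrow> vert R C p q x = \<zero>\<^bsub>Deg C m\<^esub>) \<Longrightarrow>
      \<exists>y\<in>carrier (Deg C (Suc q)). (\<forall>c\<in>I. r c (Suc q) y = \<zero>\<^bsub>Deg (D c) (Suc q)\<^esub>) \<and> vert R C p (Suc q) y = x"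
  shows "\<exists>\<Phi>. \<forall>n. \<Phi> n \<in> mod_iso R (cyclic_homology R C n)
    (dsum_module I (\<lambda>c. cyclic_homology R (D c) n))"
proof -
  interpret C: bicomplex R C by (fact C)
  note DT = bicomplex.Tot_module[OF D]
  have "\<exists>\<Phi>. \<Phi> \<in> mod_iso R (cyclic_homology R C n) (dsum_module I (\<lambda>c. cyclic_homology R (D c) n))" for n
    unfolding cyclic_homology_def
  proof (rule quotient_direct_sum_iso[where f = "\<lambda>c. tot_map (r c) n"])
    let ?T = "\<lambda>c. tot_map (r c) n"
    note Tn = tot_map_hom[OF C D r]
    show "module R ((Tot C n)\<lparr>carrier := tot_cycles R C n\<rparr>)" by (rule C.cycles_module)
    show "submodule (tot_boundaries R C n) R ((Tot C n)\<lparr>carrier := tot_cycles R C n\<rparr>)"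
      by (rule C.boundaries_submodule_cycles)
    show "\<And>c. c \<in> I \<Longrightarrow> module R ((Tot (D c) n)\<lparr>carrier := tot_cycles R (D c) n\<rparr>)"
      by (rule bicomplex.cycles_module[OF D])
    show "\<And>c. c \<in> I \<Longrightarrow> submodule (tot_boundaries R (D c) n) R ((Tot (D c) n)\<lparr>carrier := tot_cycles R (D c) n\<rparr>)"
      by (rule bicomplex.boundaries_submodule_cycles[OF D])
    show "?T c \<in> mod_hom R ((Tot C n)\<lparr>carrier := tot_cycles R C n\<rparr>) ((Tot (D c) n)\<lparr>carrier := tot_cycles R (D c) n\<rparr>)"
      if c: "c \<in> I" for c
      by (rule mod_hom_restrict_submodule[OF Tn[OF c c] _ tot_map_cycles[OF C D[OF c] r[OF c]]])
        (auto simp: tot_cycles_def)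
    have Tfin: "finite {c \<in> I. ?T c z \<noteq> \<zero>\<^bsub>Tot (D c) n\<^esub>}" if z: "z \<in> carrier (Tot C n)" for z
    proof (rule finite_subset)
      show "{c \<in> I. ?T c z \<noteq> \<zero>\<^bsub>Tot (D c) n\<^esub>} \<subseteq> (\<Union>p\<le>n. {c \<in> I. r c (n - p) (z p) \<noteq> \<zero>\<^bsub>Deg (D c) (n - p)\<^esub>})"
        by (auto simp: tot_map_def Tot_def dsum_module_simps intro!: restrict_ext)
      show "finite (\<Union>p\<le>n. {c \<in> I. r c (n - p) (z p) \<noteq> \<zero>\<^bsub>Deg (D c) (n - p)\<^esub>})"
        using fin C.Tot_closed[OF z] by auto
    qed
    have DB0: "\<zero>\<^bsub>Tot (D c) n\<^esub> \<in> tot_boundaries R (D c) n" if "c \<in> I" for c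
      by (rule submodule_zero[OF DT[OF that] bicomplex.tot_boundaries_submodule[OF D[OF that]]])
    show "finite {c \<in> I. ?T c z \<notin> tot_boundaries R (D c) n}"
      if z: "z \<in> carrier ((Tot C n)\<lparr>carrier := tot_cycles R C n\<rparr>)" for z
      by (rule finite_subset[OF _ Tfin[of z]]) (use z DB0 in \<open>auto simp: tot_cycles_def\<close>)
    show "\<exists>x\<in>carrier ((Tot C n)\<lparr>carrier := tot_cycles R C n\<rparr>). ?T c x = y \<and>
        (\<forall>c'\<in>I. c' \<noteq> c \<longrightarrow> ?T c' x = \<zero>\<^bsub>(Tot (D c') n)\<lparr>carrier := tot_cycles R (D c') n\<rparr>\<^esub>)"
      if c: "c \<in> I" and y: "y \<in> carrier ((Tot (D c) n)\<lparr>carrier := tot_cycles R (D c) n\<rparr>)" for c y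
    proof (intro bexI conjI ballI impI)
      have yc: "y \<in> carrier (Tot (D c) n)" using y by (simp add: tot_cycles_def)
      note yp = bicomplex.Tot_closed[OF D[OF c] yc]
      show "tot_map (j c) n y \<in> carrier ((Tot C n)\<lparr>carrier := tot_cycles R C n\<rparr>)"
        using tot_map_cycles[OF D[OF c] C j[OF c]] y by simp
      show "?T c (tot_map (j c) n y) = y"
        using bicomplex.Tot_carrier[OF D[OF c], of n] yc yp rj[OF c]
        by (auto simp: tot_map_def fun_eq_iff PiE_iff extensional_def)
      show "?T c' (tot_map (j c) n y) = \<zero>\<^bsub>(Tot (D c') n)\<lparr>carrier := tot_cycles R (D c') n\<rparr>\<^esub>"
        if "c' \<in> I" "c' \<noteq> c" for c'
        using rj'[OF c that yp] by (auto simp: tot_map_def Tot_def dsum_module_simps intro!: restrict_ext)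
    qed
    show "z \<in> tot_boundaries R C n \<longleftrightarrow> (\<forall>c\<in>I. ?T c z \<in> tot_boundaries R (D c) n)"
      if "z \<in> carrier ((Tot C n)\<lparr>carrier := tot_cycles R C n\<rparr>)" for z
    proof
      show "z \<in> tot_boundaries R C n \<Longrightarrow> \<forall>c\<in>I. ?T c z \<in> tot_boundaries R (D c) n"
        using tot_map_boundaries[OF C D r] by blast
    next
      have z: "z \<in> tot_cycles R C n" and zc: "z \<in> carrier (Tot C n)" using that by (auto simp: tot_cycles_def)
      assume "\<forall>c\<in>I. ?T c z \<in> tot_boundaries R (D c) n"
      then have "\<forall>c\<in>I. \<exists>y. y \<in> carrier (Tot (D c) (Suc n)) \<and> ?T c z = tot_diff R (D c) (Suc n) y"
        by (auto simp: tot_boundaries_def)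
      then obtain y where y: "\<And>c. c \<in> I \<Longrightarrow> y c \<in> carrier (Tot (D c) (Suc n))"
        "\<And>c. c \<in> I \<Longrightarrow> ?T c z = tot_diff R (D c) (Suc n) (y c)" by metis
      \<comment> \<open>only the summands in which \<open>z\<close> has a nonzero component contribute to the correction\<close>
      define F where "F = {c \<in> I. ?T c z \<noteq> \<zero>\<^bsub>Tot (D c) n\<^esub>}"
      have F: "finite F" "F \<subseteq> I" using Tfin[OF zc] by (auto simp: F_def)
      define J where "J = (\<lambda>c. tot_map (j c) (Suc n) (y c))"
      have J: "J c \<in> carrier (Tot C (Suc n))" if "c \<in> I" for c
        unfolding J_def by (rule mod_homD(1)[OF tot_map_hom[OF D[OF that] C j[OF that]] y(1)[OF that]])
      have TJ: "tot_map (r c) (Suc n) (J c') = (if c' = c then y c else \<zero>\<^bsub>Tot (D c) (Suc n)\<^esub>)"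
        if c: "c \<in> I" "c' \<in> I" for c c'
      proof -
        note yp = bicomplex.Tot_closed[OF D[OF c(2)] y(1)[OF c(2)]]
        show ?thesis
        proof (cases "c' = c")
          case True
          have "y c \<in> extensional {..Suc n}"
            using y(1)[OF c(1)] bicomplex.Tot_carrier[OF D[OF c(1)], of "Suc n"] by (simp add: PiE_def)
          then show ?thesis
            using True yp rj[OF c(1)]
            by (auto simp: tot_map_def J_def fun_eq_iff extensional_def)
        next
          case False
          then have "r c (Suc n - p) (j c' (Suc n - p) (y c' p)) = \<zero>\<^bsub>Deg (D c) (Suc n - p)\<^esub>" if "p \<le> Suc n" for p
            using rj'[OF c(2,1) _ yp[OF that]] by blast
          then show ?thesis
            using False by (auto simp: tot_map_def J_def Tot_def dsum_module_simps intro!: restrict_ext)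
        qed
      qed
      define w where "w = finsum (Tot C (Suc n)) J F"
      have w: "w \<in> carrier (Tot C (Suc n))" unfolding w_def using J F by (intro C.Tot.M.finsum_closed) auto
      have Tw: "tot_map (r c) (Suc n) w = (if c \<in> F then y c else \<zero>\<^bsub>Tot (D c) (Suc n)\<^esub>)" if c: "c \<in> I" for c
      proof -
        interpret Dc: bicomplex R "D c" by (rule D[OF c])
        have "tot_map (r c) (Suc n) w = finsum (Tot (D c) (Suc n)) (\<lambda>c'. tot_map (r c) (Suc n) (J c')) F"
          unfolding w_def using F J
          by (intro mod_hom_finsum[OF C.Tot_module Dc.Tot_module tot_map_hom[OF C D[OF c] r[OF c]]]) auto
        also have "\<dots> = finsum (Tot (D c) (Suc n)) (\<lambda>c'. if c' = c then y c else \<zero>\<^bsub>Tot (D c) (Suc n)\<^esub>) F"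
          using F TJ[OF c] y(1)[OF c] by (intro Dc.Tot.M.finsum_cong') auto
        also have "\<dots> = (if c \<in> F then y c else \<zero>\<^bsub>Tot (D c) (Suc n)\<^esub>)"
          by (rule Dc.Tot.M.finsum_delta[OF F(1) y(1)[OF c]])
        finally show ?thesis .
      qed
      define v where "v = tot_diff R C (Suc n) w"
      have vB: "v \<in> tot_boundaries R C n" using w by (auto simp: v_def tot_boundaries_def)
      then have vZ: "v \<in> tot_cycles R C n" and vc: "v \<in> carrier (Tot C n)"
        using C.tot_boundaries_cycles by (auto simp: tot_cycles_def)
      have Tv: "?T c v = ?T c z" if c: "c \<in> I" for c
      proof -
        have "?T c v = tot_diff R (D c) (Suc n) (tot_map (r c) (Suc n) w)"
          unfolding v_def by (rule tot_map_diff[OF C D[OF c] r[OF c] w])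
        also have "\<dots> = ?T c z"
          using Tw[OF c] y(2)[OF c] c mod_hom_zero[OF DT[OF c] DT[OF c] bicomplex.tot_diff_hom[OF D[OF c]]]
          by (auto simp: F_def)
        finally show ?thesis .
      qed
      let ?z = "z \<ominus>\<^bsub>Tot C n\<^esub> v"
      define K where "K = (\<lambda>q. {x \<in> carrier (Deg C q). \<forall>c\<in>I. r c q x = \<zero>\<^bsub>Deg (D c) q\<^esub>})"
      have "\<exists>u\<in>carrier (Tot C (Suc n)). tot_diff R C (Suc n) u = ?z"
      proof (rule C.total_exact_if_columns_exact[where K = K])
        show "submodule (K q) R (Deg C q)" for q
        proof -
          have rh: "r c q \<in> mod_hom R (Deg C q) (Deg (D c) q)" if "c \<in> I" for c
            using r[OF that] by (simp add: bicomplex_map_def)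
          note h = mod_homD[OF rh]
          have z0: "r c q \<zero>\<^bsub>Deg C q\<^esub> = \<zero>\<^bsub>Deg (D c) q\<^esub>" if "c \<in> I" for c
            by (rule mod_hom_zero[OF C.Deg_module bicomplex.Deg_module[OF D[OF that]] rh[OF that]])
          have DM: "module R (Deg (D c) q)" if "c \<in> I" for c by (rule bicomplex.Deg_module[OF D[OF that]])
          have "\<zero>\<^bsub>Deg (D c) q\<^esub> \<oplus>\<^bsub>Deg (D c) q\<^esub> \<zero>\<^bsub>Deg (D c) q\<^esub> = \<zero>\<^bsub>Deg (D c) q\<^esub>"
            "\<ominus>\<^bsub>Deg (D c) q\<^esub> \<zero>\<^bsub>Deg (D c) q\<^esub> = \<zero>\<^bsub>Deg (D c) q\<^esub>"
            "\<And>s. s \<in> carrier R \<Longrightarrow> s \<odot>\<^bsub>Deg (D c) q\<^esub> \<zero>\<^bsub>Deg (D c) q\<^esub> = \<zero>\<^bsub>Deg (D c) q\<^esub>" if c: "c \<in> I" for c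
          proof -
            interpret N: module R "Deg (D c) q" by (rule DM[OF c])
            show "\<zero>\<^bsub>Deg (D c) q\<^esub> \<oplus>\<^bsub>Deg (D c) q\<^esub> \<zero>\<^bsub>Deg (D c) q\<^esub> = \<zero>\<^bsub>Deg (D c) q\<^esub>"
              "\<ominus>\<^bsub>Deg (D c) q\<^esub> \<zero>\<^bsub>Deg (D c) q\<^esub> = \<zero>\<^bsub>Deg (D c) q\<^esub>"
              "\<And>s. s \<in> carrier R \<Longrightarrow> s \<odot>\<^bsub>Deg (D c) q\<^esub> \<zero>\<^bsub>Deg (D c) q\<^esub> = \<zero>\<^bsub>Deg (D c) q\<^esub>"
              using N.M.minus_equality[of "\<zero>\<^bsub>Deg (D c) q\<^esub>" "\<zero>\<^bsub>Deg (D c) q\<^esub>"] by auto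
          qed
          then show ?thesis
            using z0 h mod_hom_minus[OF C.Deg_module DM rh]
            by (intro C.Deg.submoduleI) (auto simp: K_def)
        qed
        show "horiz R C p q x \<in> K q" if "x \<in> K q" for p q x
        proof -
          have x: "x \<in> carrier (Deg C q)" using that by (simp add: K_def)
          have "r c q (horiz R C p q x) = \<zero>\<^bsub>Deg (D c) q\<^esub>" if c: "c \<in> I" for c
          proof -
            have "r c q (horiz R C p q x) = horiz R (D c) p q (r c q x)"
              using r[OF c] x by (simp add: bicomplex_map_def)
            also have "r c q x = \<zero>\<^bsub>Deg (D c) q\<^esub>" using \<open>x \<in> K q\<close> c by (simp add: K_def)
            finally show ?thesis
              using mod_hom_zero[OF bicomplex.Deg_module[OF D[OF c]] bicomplex.Deg_module[OF D[OF c]]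
                  bicomplex.horiz_hom[OF D[OF c]]] by simp
          qed
          then show ?thesis using x C.horizD(1) by (simp add: K_def)
        qed
        show "\<exists>y\<in>K (Suc q). vert R C p (Suc q) y = x"
          if "x \<in> K q" "\<And>m. q = Suc m \<Longrightarrow> vert R C p q x = \<zero>\<^bsub>Deg C m\<^esub>" for p q x
          using exact[of x q p] that by (auto simp: K_def)
        show "?z \<in> tot_cycles R C n"
          using z vZ C.Tot.submoduleE(3,5)[OF C.tot_cycles_submodule] by (simp add: a_minus_def)
        fix p assume p: "p \<le> n"
        have zvc: "?z \<in> carrier (Tot C n)" using zc vc by simp
        have "r c (n - p) (?z p) = \<zero>\<^bsub>Deg (D c) (n - p)\<^esub>" if c: "c \<in> I" for c
        proof -
          interpret Dc: bicomplex R "D c" by (rule D[OF c])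
          have "?T c ?z = ?T c z \<ominus>\<^bsub>Tot (D c) n\<^esub> ?T c v"
            by (rule mod_hom_diff[OF C.Tot_module DT[OF c] Tn[OF c c] zc vc])
          also have "\<dots> = \<zero>\<^bsub>Tot (D c) n\<^esub>"
            unfolding Tv[OF c] using mod_homD(1)[OF Tn[OF c c] zc] by (rule Dc.Tot.M.diff_self)
          finally have "?T c ?z p = \<zero>\<^bsub>Tot (D c) n\<^esub> p" by simp
          then show ?thesis using p by (simp add: tot_map_def Dc.Tot_simps)
        qed
        then show "?z p \<in> K (n - p)" using C.Tot_closed[OF zvc p] by (simp add: K_def)
      qed
      then have "?z \<in> tot_boundaries R C n"
        unfolding tot_boundaries_def Suc_eq_plus1[symmetric] by (metis image_eqI)
      then have "?z \<oplus>\<^bsub>Tot C n\<^esub> v \<in> tot_boundaries R C n"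
        using vB C.Tot.submoduleE(5)[OF C.tot_boundaries_submodule] by blast
      then show "z \<in> tot_boundaries R C n" using zc vc by (simp add: C.Tot.M.diff_add_cancel)
    qed
  qed
  then show ?thesis by (intro choice) blast
qed

section \<open>Maps of cyclic modules\<close>

definition cyclic_operators :: "('r, 'k) ring_scheme \<Rightarrow> ('r, 'c) cyclic_module \<Rightarrow> bool"
  where "cyclic_operators R C \<longleftrightarrow> (\<forall>n. module R (Deg C n)) \<and>
    (\<forall>n. \<forall>i\<le>Suc n. Face C (Suc n) i \<in> mod_hom R (Deg C (Suc n)) (Deg C n)) \<and>
    (\<forall>n. Cyc C n \<in> mod_hom R (Deg C n) (Deg C n))"

definition cyclic_map ::
  "('r, 'k) ring_scheme \<Rightarrow> ('r, 'c) cyclic_module \<Rightarrow> ('r, 'd) cyclic_module \<Rightarrow> (nat \<Rightarrow> 'c \<Rightarrow> 'd) \<Rightarrow> bool"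
  where "cyclic_map R C D f \<longleftrightarrow> (\<forall>n. f n \<in> mod_hom R (Deg C n) (Deg D n)) \<and>
    (\<forall>n. \<forall>i\<le>Suc n. \<forall>x\<in>carrier (Deg C (Suc n)).
      f n (Face C (Suc n) i x) = Face D (Suc n) i (f (Suc n) x)) \<and>
    (\<forall>n. \<forall>x\<in>carrier (Deg C n). f n (Cyc C n x) = Cyc D n (f n x))"

lemma (in cring) sign_closed [simp]: "sign R k \<in> carrier R"
  by (simp add: sign_def)

context
  fixes R :: "('r, 'k) ring_scheme" and C :: "('r, 'c) cyclic_module"
  assumes C: "cyclic_operators R C"
begin

interpretation C: module R "Deg C n" for n using C by (simp add: cyclic_operators_def)

lemma Face_hom: "i \<le> Suc n \<Longrightarrow> Face C (Suc n) i \<in> mod_hom R (Deg C (Suc n)) (Deg C n)"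
  and Cyc_hom: "Cyc C n \<in> mod_hom R (Deg C n) (Deg C n)"
  using C by (auto simp: cyclic_operators_def)

lemma bd_hom: "bd R C (Suc n) \<in> mod_hom R (Deg C (Suc n)) (Deg C n)"
  unfolding bd_def[abs_def] diff_Suc_1
  by (intro mod_hom_sum mod_hom_scale C.module_axioms Face_hom) auto

lemma bd'_hom: "bd' R C (Suc n) \<in> mod_hom R (Deg C (Suc n)) (Deg C n)"
  unfolding bd'_def[abs_def] diff_Suc_1
  by (intro mod_hom_sum mod_hom_scale C.module_axioms Face_hom) auto

lemma signed_cyc_hom: "signed_cyc R C n \<in> mod_hom R (Deg C n) (Deg C n)"
  unfolding signed_cyc_def[abs_def] by (intro mod_hom_scale C.module_axioms Cyc_hom) simp

lemma signed_cyc_funpow_hom: "(signed_cyc R C n ^^ i) \<in> mod_hom R (Deg C n) (Deg C n)"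
proof (induction i)
  case 0 then show ?case using mod_hom_id by (simp add: id_def)
next
  case (Suc i)
  then show ?case using mod_hom_comp[OF Suc signed_cyc_hom] by (simp add: comp_def)
qed

lemma cyc_norm_hom: "cyc_norm R C n \<in> mod_hom R (Deg C n) (Deg C n)"
  unfolding cyc_norm_def[abs_def] by (intro mod_hom_sum C.module_axioms signed_cyc_funpow_hom) auto

lemma vert_hom': "vert R C p (Suc q) \<in> mod_hom R (Deg C (Suc q)) (Deg C q)"
  unfolding vert_def[abs_def] diff_Suc_1
  using bd_hom mod_hom_neg[OF C.module_axioms bd'_hom] by (cases "even p") simp_all

lemma horiz_hom': "horiz R C p q \<in> mod_hom R (Deg C q) (Deg C q)"
  unfolding horiz_def[abs_def]
  using cyc_norm_hom mod_hom_sub[OF C.module_axioms mod_hom_id signed_cyc_hom] by (cases "odd p") simp_all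

end

lemma cyclic_map_bicomplex_map:
  assumes C: "cyclic_operators R C" and D: "cyclic_operators R D" and f: "cyclic_map R C D f"
  shows "bicomplex_map R C D f"
proof -
  interpret C: module R "Deg C n" for n using C by (simp add: cyclic_operators_def)
  interpret D: module R "Deg D n" for n using D by (simp add: cyclic_operators_def)
  have fh: "f n \<in> mod_hom R (Deg C n) (Deg D n)" for n using f by (simp add: cyclic_map_def)
  note h = mod_homD[OF fh]
  have face: "f n (Face C (Suc n) i x) = Face D (Suc n) i (f (Suc n) x)"
    if "i \<le> Suc n" "x \<in> carrier (Deg C (Suc n))" for n i x
    using f that by (simp add: cyclic_map_def)
  note Fc = mod_homD(1)[OF Face_hom[OF C]] and Fd = mod_homD(1)[OF Face_hom[OF D]]
  have alt: "f n (finsum (Deg C n) (\<lambda>i. sign R i \<odot>\<^bsub>Deg C n\<^esub> Face C (Suc n) i x) A) =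
      finsum (Deg D n) (\<lambda>i. sign R i \<odot>\<^bsub>Deg D n\<^esub> Face D (Suc n) i (f (Suc n) x)) A"
    if x: "x \<in> carrier (Deg C (Suc n))" and A: "finite A" "A \<subseteq> {..Suc n}" for n x A
  proof -
    have "f n (finsum (Deg C n) (\<lambda>i. sign R i \<odot>\<^bsub>Deg C n\<^esub> Face C (Suc n) i x) A) =
      finsum (Deg D n) (\<lambda>i. f n (sign R i \<odot>\<^bsub>Deg C n\<^esub> Face C (Suc n) i x)) A"
      using Fc x A by (intro mod_hom_finsum[OF C.module_axioms D.module_axioms fh]) auto
    also have "\<dots> = finsum (Deg D n) (\<lambda>i. sign R i \<odot>\<^bsub>Deg D n\<^esub> Face D (Suc n) i (f (Suc n) x)) A"
    proof (rule D.M.finsum_cong')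
      show "(\<lambda>i. sign R i \<odot>\<^bsub>Deg D n\<^esub> Face D (Suc n) i (f (Suc n) x)) \<in> A \<rightarrow> carrier (Deg D n)"
        using Fd h(1) x A by auto
      fix i assume "i \<in> A"
      then have i: "i \<le> Suc n" using A by auto
      show "f n (sign R i \<odot>\<^bsub>Deg C n\<^esub> Face C (Suc n) i x) = sign R i \<odot>\<^bsub>Deg D n\<^esub> Face D (Suc n) i (f (Suc n) x)"
        using h(3)[OF C.sign_closed Fc[OF i x]] face[OF i x] by simp
    qed simp
    finally show ?thesis .
  qed
  have b: "f n (bd R C (Suc n) x) = bd R D (Suc n) (f (Suc n) x)" if "x \<in> carrier (Deg C (Suc n))" for n x
    using alt[OF that, of "{..Suc n}"] by (simp only: bd_def diff_Suc_1 finite_atMost order_refl)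
  have b': "f n (bd' R C (Suc n) x) = bd' R D (Suc n) (f (Suc n) x)" if "x \<in> carrier (Deg C (Suc n))" for n x
  proof -
    have "{..<Suc n} \<subseteq> {..Suc n}" by auto
    then show ?thesis using alt[OF that, of "{..<Suc n}"] by (simp only: bd'_def diff_Suc_1 finite_lessThan)
  qed
  have t: "f n (signed_cyc R C n x) = signed_cyc R D n (f n x)" if "x \<in> carrier (Deg C n)" for n x
    using h(3)[OF C.sign_closed mod_homD(1)[OF Cyc_hom[OF C] that]] f that
    by (simp add: signed_cyc_def cyclic_map_def)
  have tp: "f n ((signed_cyc R C n ^^ i) x) = (signed_cyc R D n ^^ i) (f n x)" if "x \<in> carrier (Deg C n)" for n x i
    using that mod_homD(1)[OF signed_cyc_funpow_hom[OF C] that] by (induction i) (simp_all add: t)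
  have nm: "f n (cyc_norm R C n x) = cyc_norm R D n (f n x)" if x: "x \<in> carrier (Deg C n)" for n x
  proof -
    have "f n (cyc_norm R C n x) = finsum (Deg D n) (\<lambda>i. f n ((signed_cyc R C n ^^ i) x)) {..n}"
      unfolding cyc_norm_def using mod_homD(1)[OF signed_cyc_funpow_hom[OF C] x]
      by (intro mod_hom_finsum[OF C.module_axioms D.module_axioms fh]) auto
    then show ?thesis by (simp add: cyc_norm_def tp[OF x])
  qed
  have "f q (vert R C p (Suc q) x) = vert R D p (Suc q) (f (Suc q) x)" if x: "x \<in> carrier (Deg C (Suc q))" for p q x
    using mod_hom_minus[OF C.module_axioms D.module_axioms fh mod_homD(1)[OF bd'_hom[OF C] x]]
    by (simp add: vert_def b[OF x] b'[OF x])
  moreover have "f q (horiz R C p q x) = horiz R D p q (f q x)" if x: "x \<in> carrier (Deg C q)" for p q x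
    using mod_hom_diff[OF C.module_axioms D.module_axioms fh x mod_homD(1)[OF signed_cyc_hom[OF C] x]]
    by (simp add: horiz_def nm[OF x] t[OF x])
  ultimately show ?thesis using fh by (simp add: bicomplex_map_def)
qed

text \<open>
  The inclusion of a retract is injective, so the relations can be checked in the larger module.
\<close>

lemma retract_bicomplex:
  assumes C: "bicomplex R C" and D: "cyclic_operators R D"
    and r: "bicomplex_map R C D r" and j: "bicomplex_map R D C j"
    and rj: "\<And>q y. y \<in> carrier (Deg D q) \<Longrightarrow> r q (j q y) = y"
  shows "bicomplex R D"
proof -
  interpret C: bicomplex R C by (fact C)
  have DM: "module R (Deg D q)" for q using D by (simp add: cyclic_operators_def)
  have rh: "r q \<in> mod_hom R (Deg C q) (Deg D q)" and jh: "j q \<in> mod_hom R (Deg D q) (Deg C q)" for q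
    using r j by (simp_all add: bicomplex_map_def)
  note jc = mod_homD(1)[OF jh]
  note vD = mod_homD(1)[OF vert_hom'[OF D]] and hD = mod_homD(1)[OF horiz_hom'[OF D]]
  have jv: "j q (vert R D p (Suc q) y) = vert R C p (Suc q) (j (Suc q) y)" if "y \<in> carrier (Deg D (Suc q))" for p q y
    using j that by (simp add: bicomplex_map_def)
  have jo: "j q (horiz R D p q y) = horiz R C p q (j q y)" if "y \<in> carrier (Deg D q)" for p q y
    using j that by (simp add: bicomplex_map_def)
  have r0: "r q \<zero>\<^bsub>Deg C q\<^esub> = \<zero>\<^bsub>Deg D q\<^esub>" for q by (rule mod_hom_zero[OF C.Deg_module DM rh])
  have inj: "y = \<zero>\<^bsub>Deg D q\<^esub>" if "y \<in> carrier (Deg D q)" "j q y = \<zero>\<^bsub>Deg C q\<^esub>" for q y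
    using rj[OF that(1)] that(2) r0 by simp
  interpret D: module R "Deg D q" for q by (rule DM)
  show ?thesis
  proof
    fix p q x assume x: "x \<in> carrier (Deg D (Suc (Suc q)))"
    show "vert R D p (Suc q) (vert R D p (Suc (Suc q)) x) = \<zero>\<^bsub>Deg D q\<^esub>"
      by (rule inj) (simp_all add: x vD jv C.vert_vert jc)
  next
    fix p q x assume x: "x \<in> carrier (Deg D q)"
    show "horiz R D p q (horiz R D (Suc p) q x) = \<zero>\<^bsub>Deg D q\<^esub>"
      by (rule inj) (simp_all add: x hD jo C.horiz_horiz jc)
  next
    fix p q x assume x: "x \<in> carrier (Deg D (Suc q))"
    show "vert R D p (Suc q) (horiz R D (Suc p) (Suc q) x) \<oplus>\<^bsub>Deg D q\<^esub>
        horiz R D (Suc p) q (vert R D (Suc p) (Suc q) x) = \<zero>\<^bsub>Deg D q\<^esub>"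
      by (rule inj) (simp_all add: x hD vD jo jv C.vert_horiz jc mod_homD(2)[OF jh])
  qed (use DM vert_hom'[OF D] horiz_hom'[OF D] in auto)
qed


section \<open>Linearised cyclic sets\<close>

lemma frag_cmul_minus_right: "frag_cmul k (a - b) = frag_cmul k a - frag_cmul k b"
  by (metis add_diff_cancel_right' diff_add_cancel frag_cmul_distrib2)

lemma frag_extend_diff_fun: "frag_extend (\<lambda>x. F x - G x) c = frag_extend F c - frag_extend G c"
  by (simp add: frag_extend_def sum_subtractf[symmetric] frag_cmul_minus_right)

lemma frag_extend_neg_fun: "frag_extend (\<lambda>x. - F x) c = - frag_extend F c"
  using frag_extend_diff_fun[of "\<lambda>_. 0" F c] by (simp add: frag_extend_eq_0)

lemma frag_extend_frag_of: "frag_extend frag_of c = c"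
  using frag_expansion[of c] by simp

locale cyclic_set =
  fixes X :: "nat \<Rightarrow> 'x set" and d :: "nat \<Rightarrow> nat \<Rightarrow> 'x \<Rightarrow> 'x" and t :: "nat \<Rightarrow> 'x \<Rightarrow> 'x"
  assumes d_closed: "x \<in> X (Suc n) \<Longrightarrow> i \<le> Suc n \<Longrightarrow> d (Suc n) i x \<in> X n"
    and t_closed: "x \<in> X n \<Longrightarrow> t n x \<in> X n"
    and d_d: "x \<in> X (Suc (Suc n)) \<Longrightarrow> j < i \<Longrightarrow> i \<le> Suc (Suc n) \<Longrightarrow>
      d (Suc n) j (d (Suc (Suc n)) i x) = d (Suc n) (i - 1) (d (Suc (Suc n)) j x)"
    and d_t: "x \<in> X (Suc n) \<Longrightarrow> i \<le> n \<Longrightarrow> d (Suc n) (Suc i) (t (Suc n) x) = t n (d (Suc n) i x)"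
    and d_0_t: "x \<in> X (Suc n) \<Longrightarrow> d (Suc n) 0 (t (Suc n) x) = d (Suc n) (Suc n) x"
    and t_power: "x \<in> X n \<Longrightarrow> (t n ^^ Suc n) x = x"
begin

definition chain_b :: "nat \<Rightarrow> 'x \<Rightarrow> ('x \<Rightarrow>\<^sub>0 int)"
  where "chain_b n x = (\<Sum>i\<le>n. signed i (frag_of (d n i x)))"

definition chain_b' :: "nat \<Rightarrow> 'x \<Rightarrow> ('x \<Rightarrow>\<^sub>0 int)"
  where "chain_b' n x = (\<Sum>i<n. signed i (frag_of (d n i x)))"

definition chain_t :: "nat \<Rightarrow> 'x \<Rightarrow> ('x \<Rightarrow>\<^sub>0 int)"
  where "chain_t n x = signed n (frag_of (t n x))"

definition chain_N :: "nat \<Rightarrow> 'x \<Rightarrow> ('x \<Rightarrow>\<^sub>0 int)"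
  where "chain_N n x = (\<Sum>i\<le>n. signed (n * i) (frag_of ((t n ^^ i) x)))"

lemma frag_extend_signed_sum:
  "finite A \<Longrightarrow> frag_extend F (\<Sum>i\<in>A. signed (k i) (frag_of (f i))) = (\<Sum>i\<in>A. signed (k i) (F (f i)))"
  by (simp add: frag_extend_sum frag_extend_signed comp_def)

lemma t_funpow_closed: "x \<in> X n \<Longrightarrow> (t n ^^ i) x \<in> X n"
  by (induction i) (auto intro: t_closed)

lemma chain_b_b: "x \<in> X (Suc (Suc n)) \<Longrightarrow> frag_extend (chain_b (Suc n)) (chain_b (Suc (Suc n)) x) = 0"
  using alternating_square_sum_zero[of "Suc (Suc n)" "\<lambda>i j. frag_of (d (Suc n) j (d (Suc (Suc n)) i x))"] d_d[of x n]
  unfolding chain_b_def[of "Suc (Suc n)"]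
  by (simp only: frag_extend_signed_sum finite_atMost) (simp add: chain_b_def signed_sum signed_signed
      lessThan_Suc_atMost del: sum.atMost_Suc sum.lessThan_Suc)

lemma chain_b'_b': "x \<in> X (Suc (Suc n)) \<Longrightarrow> frag_extend (chain_b' (Suc n)) (chain_b' (Suc (Suc n)) x) = 0"
  using alternating_square_sum_zero[of "Suc n" "\<lambda>i j. frag_of (d (Suc n) j (d (Suc (Suc n)) i x))"] d_d[of x n]
  unfolding chain_b'_def[of "Suc (Suc n)"]
  by (simp only: frag_extend_signed_sum finite_lessThan) (simp add: chain_b'_def signed_sum signed_signed
      lessThan_Suc_atMost[symmetric] del: sum.atMost_Suc sum.lessThan_Suc)

text \<open>
  With \<open>D\<^sub>i = (-1)\<^sup>i d\<^sub>i\<close> the signs are absorbed: \<open>D\<^sub>0 \<tau> = D\<^sub>n\<close> and \<open>D\<^sub>i\<^sub>+\<^sub>1 \<tau> = \<tau> D\<^sub>i\<close>.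
\<close>

lemma chain_b_t:
  assumes x: "x \<in> X (Suc n)"
  shows "frag_extend (chain_b (Suc n)) (frag_of x - chain_t (Suc n) x) =
    chain_b' (Suc n) x - frag_extend (chain_t n) (chain_b' (Suc n) x)"
proof -
  let ?D = "\<lambda>i. signed i (frag_of (d (Suc n) i x))"
  have "frag_extend (chain_b (Suc n)) (chain_t (Suc n) x) =
      (\<Sum>i\<le>Suc n. signed (Suc n + i) (frag_of (d (Suc n) i (t (Suc n) x))))"
    by (simp add: chain_t_def frag_extend_signed chain_b_def signed_sum signed_signed del: sum.atMost_Suc)
  also have "\<dots> = signed (Suc n) (frag_of (d (Suc n) 0 (t (Suc n) x))) +
      (\<Sum>i<Suc n. signed (Suc n + Suc i) (frag_of (d (Suc n) (Suc i) (t (Suc n) x))))"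
    by (subst sum.atMost_shift) simp
  also have "(\<Sum>i<Suc n. signed (Suc n + Suc i) (frag_of (d (Suc n) (Suc i) (t (Suc n) x)))) =
      (\<Sum>i<Suc n. signed i (chain_t n (d (Suc n) i x)))"
    using d_t[OF x] by (intro sum.cong) (simp_all add: chain_t_def signed_signed signed_Suc add.commute)
  also have "\<dots> = frag_extend (chain_t n) (chain_b' (Suc n) x)"
    by (simp add: chain_b'_def frag_extend_signed_sum del: sum.lessThan_Suc)
  finally have "frag_extend (chain_b (Suc n)) (chain_t (Suc n) x) =
      ?D (Suc n) + frag_extend (chain_t n) (chain_b' (Suc n) x)"
    by (simp add: d_0_t[OF x])
  moreover have "chain_b (Suc n) x = chain_b' (Suc n) x + ?D (Suc n)"
    by (simp add: chain_b_def chain_b'_def lessThan_Suc_atMost del: sum.lessThan_Suc)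
  ultimately show ?thesis by (simp add: frag_extend_diff)
qed

lemma d_t_power_low:
  assumes "x \<in> X (Suc n)" "j \<le> i" "i \<le> Suc n"
  shows "d (Suc n) i ((t (Suc n) ^^ j) x) = (t n ^^ j) (d (Suc n) (i - j) x)"
  using assms(2,3)
proof (induction j arbitrary: i)
  case (Suc j)
  then obtain i' where i: "i = Suc i'" "j \<le> i'" "i' \<le> n" by (cases i) auto
  then show ?case
    using d_t[OF t_funpow_closed[OF assms(1)], of i' j] Suc.IH[of i'] by simp
qed simp

text \<open>
  After \<open>i\<close> rotations the face has become \<open>d\<^sub>0\<close>, one more rotation turns it into the last face, and the
  remaining rotations lower its index again.
\<close>

lemma d_t_power_high:
  assumes x: "x \<in> X (Suc n)" and ij: "i < j" "j \<le> Suc n"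
  shows "d (Suc n) i ((t (Suc n) ^^ j) x) = (t n ^^ (j - 1)) (d (Suc n) (Suc (Suc n) + i - j) x)"
proof -
  define k where "k = j - i - 1"
  have j: "j = i + Suc k" using ij by (simp add: k_def)
  let ?y = "(t (Suc n) ^^ Suc k) x"
  have "d (Suc n) i ((t (Suc n) ^^ j) x) = d (Suc n) i ((t (Suc n) ^^ i) ?y)"
    unfolding j by (simp only: funpow_add comp_def)
  also have "\<dots> = (t n ^^ i) (d (Suc n) 0 ?y)"
    using d_t_power_low[OF t_funpow_closed[OF x], of i i "Suc k"] ij by simp
  also have "d (Suc n) 0 ?y = d (Suc n) (Suc n) ((t (Suc n) ^^ k) x)"
    using d_0_t[OF t_funpow_closed[OF x]] by simp
  also have "\<dots> = (t n ^^ k) (d (Suc n) (Suc n - k) x)"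
    using ij j by (intro d_t_power_low[OF x]) auto
  also have "(t n ^^ i) ((t n ^^ k) (d (Suc n) (Suc n - k) x)) = (t n ^^ (i + k)) (d (Suc n) (Suc n - k) x)"
    by (simp only: funpow_add comp_def)
  finally show ?thesis using j by simp
qed

text \<open>
  Moving every face past the rotations matches the terms \<open>D\<^sub>i \<tau>\<^sup>j\<close> with \<open>i \<le> n\<close>, \<open>j \<le> n + 1\<close> bijectively
  with the terms \<open>\<tau>\<^sup>a D\<^sub>m\<close> with \<open>m \<le> n + 1\<close>, \<open>a \<le> n\<close>.
\<close>

lemma chain_b'_N:
  assumes x: "x \<in> X (Suc n)"
  shows "frag_extend (chain_b' (Suc n)) (chain_N (Suc n) x) = frag_extend (chain_N n) (chain_b (Suc n) x)"
proof -
  let ?f = "\<lambda>(j, i). signed (Suc n * j + i) (frag_of (d (Suc n) i ((t (Suc n) ^^ j) x)))"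
  let ?g = "\<lambda>(m, a). signed (m + n * a) (frag_of ((t n ^^ a) (d (Suc n) m x)))"
  have "frag_extend (chain_b' (Suc n)) (chain_N (Suc n) x) = sum ?f ({..Suc n} \<times> {..<Suc n})"
    unfolding chain_N_def frag_extend_signed_sum[OF finite_atMost] chain_b'_def signed_sum signed_signed
    by (simp only: sum.cartesian_product)
  also have "\<dots> = sum ?g ({..Suc n} \<times> {..n})"
  proof (rule sum.reindex_bij_witness[of _
      "\<lambda>(m, a). if m + a \<le> n then (a, m + a) else (Suc a, m + a - Suc n)"
      "\<lambda>(j, i). if j \<le> i then (i - j, j) else (Suc (Suc n) + i - j, j - 1)"])
    fix p assume "p \<in> {..Suc n} \<times> {..<Suc n}"
    then obtain j i where p: "p = (j, i)" "j \<le> Suc n" "i \<le> n" by auto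
    show "?g (case p of (j, i) \<Rightarrow> if j \<le> i then (i - j, j) else (Suc (Suc n) + i - j, j - 1)) = ?f p"
    proof (cases "j \<le> i")
      case True
      have "even (i - j + n * j) = even (Suc n * j + i)" using True by (auto simp: even_diff_nat)
      then have "signed (i - j + n * j) c = signed (Suc n * j + i) c" for c :: "'x \<Rightarrow>\<^sub>0 int"
        by (rule signed_cong)
      then show ?thesis
        using True p d_t_power_low[OF x True] by (simp del: mult_Suc)
    next
      case False
      then obtain j' where j': "j = Suc j'" by (cases j) auto
      have "even (Suc (Suc n) + i - j + n * (j - 1)) = even (Suc n * j + i)"
        using p False unfolding j' by (auto simp: even_diff_nat)
      then have "signed (Suc (Suc n) + i - j + n * (j - 1)) c = signed (Suc n * j + i) c" for c :: "'x \<Rightarrow>\<^sub>0 int"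
        by (rule signed_cong)
      moreover have "d (Suc n) i ((t (Suc n) ^^ j) x) = (t n ^^ (j - 1)) (d (Suc n) (Suc (Suc n) + i - j) x)"
        using False p by (intro d_t_power_high[OF x]) auto
      ultimately show ?thesis using False by (simp only: p split if_False)
    qed
  qed (auto split: if_splits)
  also have "\<dots> = frag_extend (chain_N n) (chain_b (Suc n) x)"
    unfolding chain_b_def frag_extend_signed_sum[OF finite_atMost] chain_N_def signed_sum signed_signed
    by (simp only: sum.cartesian_product)
  finally show ?thesis .
qed

text \<open>
  Cyclic invariance of the norm.  The term that wraps around keeps its sign since \<open>n (n + 1)\<close> is even.
\<close>

lemma chain_shift:
  assumes x: "x \<in> X n"
  shows "(\<Sum>i\<le>n. signed (n * Suc i) (frag_of ((t n ^^ Suc i) x))) = chain_N n x"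
proof -
  let ?f = "\<lambda>i. signed (n * i) (frag_of ((t n ^^ i) x))"
  have "?f 0 + (\<Sum>i\<le>n. ?f (Suc i)) = (\<Sum>i\<le>Suc n. ?f i)"
    by (simp only: sum.atMost_Suc_shift)
  also have "\<dots> = chain_N n x + ?f (Suc n)" by (simp only: sum.atMost_Suc chain_N_def)
  also have "?f (Suc n) = ?f 0"
  proof -
    have "even (n * Suc n)" by simp
    then show ?thesis using t_power[OF x] by (simp only: signed_def) simp
  qed
  finally show ?thesis by simp
qed

lemma chain_t_N:
  assumes x: "x \<in> X n"
  shows "chain_N n x - frag_extend (chain_t n) (chain_N n x) = 0"
proof -
  have "frag_extend (chain_t n) (chain_N n x) = (\<Sum>i\<le>n. signed (n * Suc i) (frag_of ((t n ^^ Suc i) x)))"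
    unfolding chain_N_def frag_extend_signed_sum[OF finite_atMost]
    by (simp add: chain_t_def signed_signed add.commute)
  then show ?thesis using chain_shift[OF x] by simp
qed

lemma chain_N_t:
  assumes x: "x \<in> X n"
  shows "frag_extend (chain_N n) (frag_of x - chain_t n x) = 0"
proof -
  have "frag_extend (chain_N n) (chain_t n x) = (\<Sum>i\<le>n. signed (n * Suc i) (frag_of ((t n ^^ Suc i) x)))"
    by (simp add: chain_t_def frag_extend_signed chain_N_def signed_sum signed_signed funpow_swap1)
  then show ?thesis using chain_shift[OF x] by (simp add: frag_extend_diff)
qed

end

locale linearized_cyclic_set = cyclic_set X d t
  for X :: "nat \<Rightarrow> 'x set" and d t +
  fixes R :: "('r, 'k) ring_scheme" and B :: "nat \<Rightarrow> ('r, 'c, 'x) based_module"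
    and C :: "('r, 'c) cyclic_module"
  assumes basis: "is_basis R (B n)"
    and Idx: "Idx (B n) = X n" and Deg: "Deg C n = Space (B n)"
    and operators: "cyclic_operators R C"
    and Face_elt: "x \<in> X (Suc n) \<Longrightarrow> i \<le> Suc n \<Longrightarrow> Face C (Suc n) i (Elt (B (Suc n)) x) = Elt (B n) (d (Suc n) i x)"
    and Cyc_elt: "x \<in> X n \<Longrightarrow> Cyc C n (Elt (B n) x) = Elt (B n) (t n x)"
begin

lemma represents_Face:
  "i \<le> Suc n \<Longrightarrow> represents R (B (Suc n)) (B n) (Face C (Suc n) i) (\<lambda>x. frag_of (d (Suc n) i x))"
  using Face_hom[OF operators, of i n] Face_elt d_closed
  by (intro represents_basis_map basis) (simp_all add: Idx Deg)

lemma represents_Cyc: "represents R (B n) (B n) (Cyc C n) (\<lambda>x. frag_of (t n x))"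
  using Cyc_hom[OF operators, of n] Cyc_elt t_closed
  by (intro represents_basis_map basis) (simp_all add: Idx Deg)

lemma represents_bd: "represents R (B (Suc n)) (B n) (bd R C (Suc n)) (chain_b (Suc n))"
  unfolding bd_def[abs_def] chain_b_def[abs_def] Deg diff_Suc_1
  by (intro represents_sum represents_sign represents_Face basis) auto

lemma represents_bd': "represents R (B (Suc n)) (B n) (bd' R C (Suc n)) (chain_b' (Suc n))"
  unfolding bd'_def[abs_def] chain_b'_def[abs_def] Deg diff_Suc_1
  by (intro represents_sum represents_sign represents_Face basis) auto

lemma represents_signed_cyc: "represents R (B n) (B n) (signed_cyc R C n) (chain_t n)"
  unfolding signed_cyc_def[abs_def] chain_t_def[abs_def] Deg
  by (intro represents_sign represents_Cyc basis)

lemma represents_cyc_norm: "represents R (B n) (B n) (cyc_norm R C n) (chain_N n)"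
  unfolding cyc_norm_def[abs_def] chain_N_def[abs_def] Deg
  by (intro represents_sum represents_funpow basis represents_signed_cyc[unfolded chain_t_def[abs_def]]) auto

lemma represents_vert:
  "represents R (B (Suc q)) (B q) (vert R C p (Suc q))
    (\<lambda>x. if even p then chain_b (Suc q) x else - chain_b' (Suc q) x)"
  unfolding vert_def[abs_def] Deg diff_Suc_1
  using represents_bd represents_neg[OF represents_bd'] by (cases "even p") simp_all

lemma represents_horiz:
  "represents R (B q) (B q) (horiz R C p q)
    (\<lambda>x. if odd p then frag_of x - chain_t q x else chain_N q x)"
  unfolding horiz_def[abs_def] Deg
  using represents_cyc_norm represents_diff[OF represents_id[OF basis] represents_signed_cyc]
  by (cases "odd p") simp_all

theorem bicomplex: "bicomplex R C"
proof (rule bicomplex.intro)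
  show "module R (Deg C q)" for q using operators unfolding cyclic_operators_def by blast
  show "vert R C p (Suc q) \<in> mod_hom R (Deg C (Suc q)) (Deg C q)" for p q
    by (rule vert_hom'[OF operators])
  show "horiz R C p q \<in> mod_hom R (Deg C q) (Deg C q)" for p q
    by (rule horiz_hom'[OF operators])
next
  fix p q x assume "x \<in> carrier (Deg C (Suc (Suc q)))"
  then have x: "x \<in> carrier (Space (B (Suc (Suc q))))" by (simp add: Deg)
  show "vert R C p (Suc q) (vert R C p (Suc (Suc q)) x) = \<zero>\<^bsub>Deg C q\<^esub>"
    unfolding Deg
    by (rule represents_eq[OF represents_comp[OF represents_vert represents_vert] represents_const_zero[OF basis basis] _ x])
      (simp add: Idx frag_extend_minus chain_b_b chain_b'_b' frag_extend_neg_fun)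
next
  fix p q x assume "x \<in> carrier (Deg C q)"
  then have x: "x \<in> carrier (Space (B q))" by (simp add: Deg)
  show "horiz R C p q (horiz R C (Suc p) q x) = \<zero>\<^bsub>Deg C q\<^esub>"
    unfolding Deg
    by (rule represents_eq[OF represents_comp[OF represents_horiz represents_horiz] represents_const_zero[OF basis basis] _ x])
      (simp add: Idx chain_N_t chain_t_N frag_extend_diff_fun frag_extend_frag_of)
next
  fix p q x assume "x \<in> carrier (Deg C (Suc q))"
  then have x: "x \<in> carrier (Space (B (Suc q)))" by (simp add: Deg)
  show "vert R C p (Suc q) (horiz R C (Suc p) (Suc q) x) \<oplus>\<^bsub>Deg C q\<^esub>
      horiz R C (Suc p) q (vert R C (Suc p) (Suc q) x) = \<zero>\<^bsub>Deg C q\<^esub>"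
    unfolding Deg
    by (rule represents_eq[OF represents_add[OF represents_comp[OF represents_horiz represents_vert]
            represents_comp[OF represents_vert represents_horiz]] represents_const_zero[OF basis basis] _ x])
      (simp add: Idx chain_b_t chain_b'_N frag_extend_diff_fun frag_extend_frag_of frag_extend_neg_fun frag_extend_minus)
qed

end


section \<open>The cyclic set of a group\<close>

lemma merge_at_0 [simp]: "merge_at A 0 (x # y # zs) = (x \<otimes>\<^bsub>A\<^esub> y) # zs"
  by (simp add: merge_at_def)

lemma merge_at_Suc [simp]: "merge_at A (Suc j) (x # xs) = x # merge_at A j xs"
  by (simp add: merge_at_def)

lemma length_merge_at: "Suc j < length xs \<Longrightarrow> length (merge_at A j xs) = length xs - 1"
  by (simp add: merge_at_def)

lemma merge_at_append: "Suc j < length ys \<Longrightarrow> merge_at A j (ys @ zs) = merge_at A j ys @ zs"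
  by (simp add: merge_at_def nth_append)

lemma merge_at_end: "length zs = j \<Longrightarrow> merge_at A j (zs @ [x, y]) = zs @ [x \<otimes>\<^bsub>A\<^esub> y]"
  by (simp add: merge_at_def nth_append)

lemma set_merge_at:
  "Suc j < length xs \<Longrightarrow> set (merge_at A j xs) \<subseteq> insert (xs ! j \<otimes>\<^bsub>A\<^esub> xs ! Suc j) (set xs)"
  by (auto simp: merge_at_def dest: in_set_takeD in_set_dropD)

lemma two_elements:
  assumes "Suc (Suc n) = length xs" obtains a b ys where "xs = a # ys @ [b]" "length ys = n"
proof -
  obtain a zs where a: "xs = a # zs" "length zs = Suc n" using assms by (cases xs) auto
  then obtain ys b where "zs = ys @ [b]" "length ys = n" by (cases zs rule: rev_cases) auto
  then show ?thesis using a that by auto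
qed

lemma alg_face_wrap: "length ys = n \<Longrightarrow> alg_face A (Suc n) (Suc n) (a # ys @ [b]) = (b \<otimes>\<^bsub>A\<^esub> a) # ys"
  by (simp add: alg_face_def nth_append)

lemma alg_face_merge: "i < n \<Longrightarrow> alg_face A n i xs = merge_at A i xs"
  by (simp add: alg_face_def)

lemma alg_cyc_snoc [simp]: "alg_cyc (ys @ [b]) = b # ys"
  by (simp add: alg_cyc_def)

lemma alg_cyc_Cons_snoc [simp]: "alg_cyc (a # ys @ [b]) = b # a # ys"
  by (simp add: alg_cyc_def)

lemma alg_cyc_funpow: "(alg_cyc ^^ length ys) (xs @ ys) = ys @ xs"
proof (induction ys arbitrary: xs rule: rev_induct)
  case (snoc b ys)
  have "(alg_cyc ^^ length (ys @ [b])) (xs @ ys @ [b]) = (alg_cyc ^^ length ys) (alg_cyc ((xs @ ys) @ [b]))"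
    by (simp only: length_append_singleton funpow_Suc_right comp_def append_assoc)
  also have "\<dots> = ys @ (b # xs)" unfolding alg_cyc_snoc using snoc.IH[of "b # xs"] by simp
  finally show ?case by simp
qed simp

lemma alg_cyc_tuples: "xs \<in> tuples (Suc n) A \<Longrightarrow> alg_cyc xs \<in> tuples (Suc n) A"
  by (cases xs rule: rev_cases) (auto simp: tuples_def)

context group
begin

lemma inv_cancel_left [simp]:
  "x \<in> carrier G \<Longrightarrow> y \<in> carrier G \<Longrightarrow> inv x \<otimes> (x \<otimes> y) = y"
  "x \<in> carrier G \<Longrightarrow> y \<in> carrier G \<Longrightarrow> x \<otimes> (inv x \<otimes> y) = y"
  by (simp_all add: m_assoc[symmetric])

lemma alg_face_tuples:
  assumes xs: "xs \<in> tuples (Suc (Suc n)) (carrier G)" and i: "i \<le> Suc n"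
  shows "alg_face G (Suc n) i xs \<in> tuples (Suc n) (carrier G)"
proof (cases "i < Suc n")
  case True
  have "xs ! i \<in> carrier G" "xs ! Suc i \<in> carrier G" using True tuples_nth[OF xs] by simp_all
  then show ?thesis
    using True xs set_merge_at[of i xs G] length_merge_at[of i xs G] by (auto simp: alg_face_merge tuples_def)
next
  case False
  obtain a b ys where "xs = a # ys @ [b]" "length ys = n"
    using two_elements tuples_length[OF xs] by metis
  then show ?thesis using False i xs by (auto simp: alg_face_wrap tuples_def)
qed

lemma merge_at_merge_at:
  assumes "set xs \<subseteq> carrier G" "j < i" "Suc i < length xs"
  shows "merge_at G j (merge_at G i xs) = merge_at G (i - 1) (merge_at G j xs)"
  using assms
proof (induction j arbitrary: xs i)
  case 0
  then obtain i' where i: "i = Suc i'" by (cases i) auto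
  obtain x xs' where x: "xs = x # xs'" using 0 by (cases xs) auto
  obtain y zs where y: "xs' = y # zs" using 0 x by (cases xs') auto
  obtain z ws where zs: "zs = z # ws" using 0 x y i by (cases zs) auto
  have xs: "xs = x # y # zs" using x y by simp
  show ?case using 0(1) by (cases i') (simp_all add: i xs zs m_assoc)
next
  case (Suc j)
  then obtain i' where i: "i = Suc i'" "j < i'" by (cases i) auto
  obtain x ys where xs: "xs = x # ys" using Suc by (cases xs) auto
  obtain i'' where i'': "i' = Suc i''" using i by (cases i') auto
  show ?case using Suc.IH[of ys i'] Suc.prems i by (simp add: xs i'')
qed

lemma group_cyclic_set: "cyclic_set (\<lambda>n. tuples (Suc n) (carrier G)) (alg_face G) (\<lambda>n. alg_cyc)"
proof
  fix xs n i assume "xs \<in> tuples (Suc (Suc n)) (carrier G)" "i \<le> Suc n"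
  then show "alg_face G (Suc n) i xs \<in> tuples (Suc n) (carrier G)" by (rule alg_face_tuples)
next
  fix xs n assume "xs \<in> tuples (Suc n) (carrier G)"
  then show "alg_cyc xs \<in> tuples (Suc n) (carrier G)" by (rule alg_cyc_tuples)
next
  fix xs n j i assume xs: "xs \<in> tuples (Suc (Suc (Suc n))) (carrier G)" and ji: "j < i" "i \<le> Suc (Suc n)"
  have len: "length xs = Suc (Suc (Suc n))" and set: "set xs \<subseteq> carrier G" using xs by (auto simp: tuples_def)
  show "alg_face G (Suc n) j (alg_face G (Suc (Suc n)) i xs) =
      alg_face G (Suc n) (i - 1) (alg_face G (Suc (Suc n)) j xs)"
  proof (cases "i = Suc (Suc n)")
    case False
    then show ?thesis using ji len merge_at_merge_at[OF set ji(1)] by (simp add: alg_face_merge)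
  next
    case True
    \<comment> \<open>the outer face \<open>i\<close> multiplies the last entry \<open>b\<close> onto the first entry \<open>a\<close>\<close>
    obtain a b ys where x: "xs = a # ys @ [b]" "length ys = Suc n" using two_elements len by metis
    obtain z ws where ws: "ys = ws @ [z]" "length ws = n" using x(2) by (cases ys rule: rev_cases) auto
    have w: "alg_face G (Suc (Suc n)) (Suc (Suc n)) xs = (b \<otimes> a) # ys" using x by (simp add: alg_face_wrap)
    consider "j = 0" "n = 0" | "j = 0" "n > 0" | j' where "j = Suc j'" "j' < n" | "j = Suc n"
      using ji True by (cases j) (auto simp: less_Suc_eq)
    then show ?thesis
    proof cases
      case 1
      then show ?thesis using True set w x ws by (simp add: alg_face_def m_assoc)
    next
      case 2
      then obtain y vs where vs: "ys = y # vs" "length vs = n" using x by (cases ys) auto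
      have "alg_face G (Suc n) (Suc n) ((a \<otimes> y) # vs @ [b]) = (b \<otimes> (a \<otimes> y)) # vs"
        using vs by (simp add: alg_face_wrap)
      then show ?thesis using True 2 set w x vs by (simp add: alg_face_merge m_assoc)
    next
      case 3
      have "merge_at G (Suc j') xs = a # merge_at G j' ys @ [b]" using 3 x by (simp add: merge_at_append)
      moreover have "length (merge_at G j' ys) = n" using 3 x by (simp add: length_merge_at)
      ultimately show ?thesis using True 3 w by (simp add: alg_face_merge alg_face_wrap)
    next
      case 4
      have "merge_at G (Suc n) xs = a # ws @ [z \<otimes> b]" using x ws by (simp add: merge_at_end)
      moreover have "alg_face G (Suc n) (Suc n) ((b \<otimes> a) # ws @ [z]) = (z \<otimes> (b \<otimes> a)) # ws"
        using ws by (simp add: alg_face_wrap)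
      ultimately show ?thesis using True 4 w ws set x by (simp add: alg_face_merge alg_face_wrap m_assoc)
    qed
  qed
next
  fix xs n i assume xs: "xs \<in> tuples (Suc (Suc n)) (carrier G)" and i: "i \<le> n"
  obtain ys b where x: "xs = ys @ [b]" "length ys = Suc n"
    using tuples_length[OF xs] by (cases xs rule: rev_cases) auto
  obtain ws z where ws: "ys = ws @ [z]" "length ws = n" using x(2) by (cases ys rule: rev_cases) auto
  have cyc: "alg_cyc xs = b # ys" by (simp add: x)
  show "alg_face G (Suc n) (Suc i) (alg_cyc xs) = alg_cyc (alg_face G (Suc n) i xs)"
  proof (cases "i = n")
    case True
    have "merge_at G n xs = ws @ [z \<otimes> b]" using x ws by (simp add: merge_at_end)
    then show ?thesis unfolding cyc using True ws alg_face_wrap[OF ws(2), of G b z] by (simp add: alg_face_merge)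
  next
    case False
    then have "merge_at G i xs = merge_at G i ys @ [b]" using i x by (simp add: merge_at_append)
    then show ?thesis using False i x by (simp add: alg_face_merge)
  qed
next
  fix xs n assume xs: "xs \<in> tuples (Suc (Suc n)) (carrier G)"
  obtain a b ys where "xs = a # ys @ [b]" "length ys = n"
    using two_elements tuples_length[OF xs] by metis
  then show "alg_face G (Suc n) 0 (alg_cyc xs) = alg_face G (Suc n) (Suc n) xs"
    by (simp add: alg_face_merge alg_face_wrap)
next
  fix xs n assume "xs \<in> tuples (Suc n) (carrier G)"
  then show "(alg_cyc ^^ Suc n) xs = xs" using alg_cyc_funpow[of xs "[]"] tuples_length by fastforce
qed

abbreviation lprod :: "'a list \<Rightarrow> 'a"
  where "lprod xs \<equiv> foldr (\<otimes>) xs \<one>"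

lemma lprod_closed [simp]: "set xs \<subseteq> carrier G \<Longrightarrow> lprod xs \<in> carrier G"
  by (induction xs) auto

lemma lprod_append: "set xs \<subseteq> carrier G \<Longrightarrow> set ys \<subseteq> carrier G \<Longrightarrow> lprod (xs @ ys) = lprod xs \<otimes> lprod ys"
  by (induction xs) (auto simp: m_assoc)

lemma lprod_merge_at:
  "set xs \<subseteq> carrier G \<Longrightarrow> Suc j < length xs \<Longrightarrow> lprod (merge_at G j xs) = lprod xs"
proof (induction j arbitrary: xs)
  case 0
  then obtain x y zs where "xs = x # y # zs" by (cases xs; cases "tl xs") auto
  then show ?case using 0 by (simp add: m_assoc)
next
  case (Suc j)
  then obtain x ys where "xs = x # ys" by (cases xs) auto
  then show ?case using Suc by simp
qed

text \<open>
  The target of the arrow \<open>g\<close> with source \<open>h\<close> in the action groupoid.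
\<close>

definition conj_by :: "'a \<Rightarrow> 'a \<Rightarrow> 'a"
  where "conj_by h g = inv g \<otimes> h \<otimes> g"

lemma conj_by_closed [simp]: "h \<in> carrier G \<Longrightarrow> g \<in> carrier G \<Longrightarrow> conj_by h g \<in> carrier G"
  by (simp add: conj_by_def)

lemma conj_by_mult:
  "h \<in> carrier G \<Longrightarrow> x \<in> carrier G \<Longrightarrow> y \<in> carrier G \<Longrightarrow> conj_by h (x \<otimes> y) = conj_by (conj_by h x) y"
  by (simp add: conj_by_def inv_mult_group m_assoc)

definition conj_class :: "'a \<Rightarrow> 'a set"
  where "conj_class h = conj_by h ` carrier G"

lemma conj_class_conj_by:
  assumes "h \<in> carrier G" "g \<in> carrier G"
  shows "conj_class (conj_by h g) = conj_class h"
proof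
  show "conj_class (conj_by h g) \<subseteq> conj_class h"
    using assms by (auto simp: conj_class_def conj_by_mult[symmetric])
  have "conj_by h x = conj_by (conj_by h g) (inv g \<otimes> x)" if "x \<in> carrier G" for x
    using assms that by (simp add: conj_by_mult[symmetric])
  moreover have "inv g \<otimes> x \<in> carrier G" if "x \<in> carrier G" for x
    using assms that by simp
  ultimately show "conj_class h \<subseteq> conj_class (conj_by h g)"
    unfolding conj_class_def by blast
qed

lemma conj_class_closed: "h \<in> carrier G \<Longrightarrow> conj_class h \<subseteq> carrier G"
  by (auto simp: conj_class_def)

lemma conj_class_eq:
  assumes "h \<in> carrier G" "k \<in> conj_class h" shows "conj_class k = conj_class h"
proof -
  obtain g where "g \<in> carrier G" "k = conj_by h g" using assms(2) unfolding conj_class_def by blast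
  then show ?thesis using conj_class_conj_by[OF assms(1)] by simp
qed

lemma conj_classes_eq: "conj_classes G = conj_class ` carrier G"
proof -
  have "orbit G (\<lambda>g. \<lambda>h\<in>carrier G. g \<otimes> h \<otimes> inv g) h = conj_class h" if h: "h \<in> carrier G" for h
  proof -
    have "g \<otimes> h \<otimes> inv g = conj_by h (inv g)" "conj_by h g = inv g \<otimes> h \<otimes> inv (inv g)"
      if "g \<in> carrier G" for g
      using that by (simp_all add: conj_by_def)
    then have "{g \<otimes> h \<otimes> inv g |g. g \<in> carrier G} = conj_class h"
      unfolding conj_class_def using inv_closed by blast
    then show ?thesis using h by (simp add: orbit_def)
  qed
  then show ?thesis unfolding conj_classes_def orbits_def by (auto simp: image_iff)
qed

end

section \<open>Retraction onto the centralizers\<close>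

locale conj_reps = group G for G (structure) +
  fixes rep :: "'a set \<Rightarrow> 'a"
  assumes rep: "c \<in> conj_classes G \<Longrightarrow> rep c \<in> c"
begin

definition base :: "'a \<Rightarrow> 'a"
  where "base h = rep (conj_class h)"

lemma base_conj: "h \<in> carrier G \<Longrightarrow> base h \<in> conj_class h"
  using rep conj_classes_eq by (auto simp: base_def)

lemma base_closed [simp]: "h \<in> carrier G \<Longrightarrow> base h \<in> carrier G"
  using base_conj conj_class_closed by blast

lemma base_conj_by [simp]: "h \<in> carrier G \<Longrightarrow> g \<in> carrier G \<Longrightarrow> base (conj_by h g) = base h"
  by (simp add: base_def conj_class_conj_by)

lemma base_base [simp]: "h \<in> carrier G \<Longrightarrow> base (base h) = base h"
  using conj_class_eq[OF _ base_conj, of h] by (metis base_def)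

text \<open>
  An arrow from the chosen representative to \<open>h\<close>.  It is the identity at the representative itself, so
  that straightening fixes the elements of its centralizer.
\<close>

definition conjugator :: "'a \<Rightarrow> 'a"
  where "conjugator h = (if h = base h then \<one> else SOME g. g \<in> carrier G \<and> g \<otimes> h \<otimes> inv g = base h)"

lemma conjugator:
  assumes h: "h \<in> carrier G"
  shows "conjugator h \<in> carrier G" "conjugator h \<otimes> h \<otimes> inv (conjugator h) = base h"
proof -
  obtain g where g: "g \<in> carrier G" "base h = inv g \<otimes> h \<otimes> g"
    using base_conj[OF h] by (auto simp: conj_class_def conj_by_def)
  then have "\<exists>g. g \<in> carrier G \<and> g \<otimes> h \<otimes> inv g = base h" by (intro exI[of _ "inv g"]) auto
  from someI_ex[OF this] h
  have "conjugator h \<in> carrier G \<and> conjugator h \<otimes> h \<otimes> inv (conjugator h) = base h"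
    unfolding conjugator_def by (cases "h = base h") auto
  then show "conjugator h \<in> carrier G" "conjugator h \<otimes> h \<otimes> inv (conjugator h) = base h" by auto
qed

declare conjugator(1) [simp]

lemma conjugator_base: "h \<in> carrier G \<Longrightarrow> conjugator (base h) = \<one>"
  by (simp add: conjugator_def)

lemma base_conjugator: "h \<in> carrier G \<Longrightarrow> base h \<otimes> conjugator h = conjugator h \<otimes> h"
  using conjugator(2)[of h, symmetric] by (simp add: m_assoc)

text \<open>
  The arrow \<open>g\<close> with source \<open>h\<close>, conjugated into the automorphism group of the representative.
\<close>

definition straighten :: "'a \<Rightarrow> 'a \<Rightarrow> 'a"
  where "straighten h g = conjugator h \<otimes> g \<otimes> inv (conjugator (conj_by h g))"

lemma straighten_closed [simp]: "h \<in> carrier G \<Longrightarrow> g \<in> carrier G \<Longrightarrow> straighten h g \<in> carrier G"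
  by (simp add: straighten_def)

lemma straighten_mult:
  "h \<in> carrier G \<Longrightarrow> x \<in> carrier G \<Longrightarrow> y \<in> carrier G \<Longrightarrow>
    straighten h x \<otimes> straighten (conj_by h x) y = straighten h (x \<otimes> y)"
  by (simp add: straighten_def conj_by_mult m_assoc)

lemma straighten_commutes:
  assumes h: "h \<in> carrier G" and g: "g \<in> carrier G"
  shows "straighten h g \<otimes> base h = base h \<otimes> straighten h g"
proof -
  let ?k = "conj_by h g"
  have "inv (conjugator ?k) \<otimes> base h = ?k \<otimes> inv (conjugator ?k)"
    using conjugator(2)[of ?k, symmetric] h g by (simp add: m_assoc)
  then have "straighten h g \<otimes> base h = conjugator h \<otimes> g \<otimes> (?k \<otimes> inv (conjugator ?k))"
    using h g by (simp add: straighten_def m_assoc)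
  also have "\<dots> = conjugator h \<otimes> h \<otimes> g \<otimes> inv (conjugator ?k)"
    using h g by (simp add: conj_by_def m_assoc)
  also have "\<dots> = base h \<otimes> straighten h g"
    using h g by (simp add: base_conjugator[symmetric] straighten_def m_assoc)
  finally show ?thesis .
qed

text \<open>
  Straightens the arrows of a path that starts at \<open>h\<close>.  For a closed path the start is the product of
  its arrows.
\<close>

fun walk :: "'a \<Rightarrow> 'a list \<Rightarrow> 'a list"
  where "walk h [] = []"
  | "walk h (g # gs) = straighten h g # walk (conj_by h g) gs"

definition retract :: "'a list \<Rightarrow> 'a list"
  where "retract xs = walk (lprod xs) xs"

lemma length_walk [simp]: "length (walk h xs) = length xs"
  by (induction xs arbitrary: h) auto

lemma walk_append:
  "h \<in> carrier G \<Longrightarrow> set xs \<subseteq> carrier G \<Longrightarrow>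
    walk h (xs @ ys) = walk h xs @ walk (conj_by h (lprod xs)) ys"
proof (induction xs arbitrary: h)
  case Nil then show ?case by (simp add: conj_by_def)
qed (simp add: conj_by_mult)

lemma walk_merge_at:
  "h \<in> carrier G \<Longrightarrow> set xs \<subseteq> carrier G \<Longrightarrow> Suc j < length xs \<Longrightarrow>
    walk h (merge_at G j xs) = merge_at G j (walk h xs)"
proof (induction j arbitrary: h xs)
  case 0
  then obtain x y zs where "xs = x # y # zs" by (cases xs; cases "tl xs") auto
  then show ?case using 0 by (simp add: straighten_mult conj_by_mult)
next
  case (Suc j)
  then obtain x ys where "xs = x # ys" by (cases xs) auto
  then show ?case using Suc by simp
qed

lemma set_walk:
  "h \<in> carrier G \<Longrightarrow> set xs \<subseteq> carrier G \<Longrightarrow> set (walk h xs) \<subseteq> carrier (centralizer G (base h))"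
proof (induction xs arbitrary: h)
  case (Cons x xs)
  have "set (walk (conj_by h x) xs) \<subseteq> carrier (centralizer G (base (conj_by h x)))"
    using Cons.prems by (intro Cons.IH) auto
  moreover have "straighten h x \<in> carrier (centralizer G (base h))"
    using Cons.prems by (simp add: centralizer_def straighten_commutes)
  ultimately show ?case using Cons.prems by simp
qed simp

lemma lprod_walk:
  "h \<in> carrier G \<Longrightarrow> set xs \<subseteq> carrier G \<Longrightarrow>
    lprod (walk h xs) = conjugator h \<otimes> lprod xs \<otimes> inv (conjugator (conj_by h (lprod xs)))"
proof (induction xs arbitrary: h)
  case Nil then show ?case by (simp add: conj_by_def)
next
  case (Cons x xs)
  then show ?case by (simp add: straighten_def conj_by_mult m_assoc)
qed

lemma conj_by_self: "h \<in> carrier G \<Longrightarrow> conj_by h h = h"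
  by (simp add: conj_by_def)

lemma lprod_retract: "set xs \<subseteq> carrier G \<Longrightarrow> lprod (retract xs) = base (lprod xs)"
  by (simp add: retract_def lprod_walk conj_by_self conjugator(2))

lemma retract_centralizer:
  "xs \<in> tuples n (carrier G) \<Longrightarrow> retract xs \<in> tuples n (carrier (centralizer G (base (lprod xs))))"
  using set_walk[of "lprod xs" xs] by (auto simp: tuples_def retract_def)

lemma centralizer_subset: "carrier (centralizer G z) \<subseteq> carrier G"
  by (auto simp: centralizer_def)

lemma retract_tuples: "xs \<in> tuples n (carrier G) \<Longrightarrow> retract xs \<in> tuples n (carrier G)"
  using retract_centralizer[of xs n] centralizer_subset by (auto simp: tuples_def)

lemma conj_by_centralizer:
  "h \<in> carrier G \<Longrightarrow> x \<in> carrier (centralizer G h) \<Longrightarrow> conj_by h x = h"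
  by (auto simp: centralizer_def conj_by_def m_assoc) (metis inv_cancel_left(1))

lemma walk_centralizer:
  "h \<in> carrier G \<Longrightarrow> set xs \<subseteq> carrier (centralizer G (base h)) \<Longrightarrow> walk (base h) xs = xs"
proof (induction xs)
  case (Cons x xs)
  then have "conj_by (base h) x = base h" "x \<in> carrier G"
    using conj_by_centralizer centralizer_subset by auto
  then show ?case using Cons by (simp add: straighten_def conjugator_base)
qed simp

lemma retract_centralizer_id:
  assumes "h \<in> carrier G" "set xs \<subseteq> carrier (centralizer G (base h))" "lprod xs = base h"
  shows "retract xs = xs"
  using walk_centralizer[OF assms(1,2)] assms(3) by (simp add: retract_def)

lemma retract_retract:
  assumes "xs \<in> tuples n (carrier G)"
  shows "retract (retract xs) = retract xs"
  using assms retract_centralizer[OF assms] lprod_retract[of xs]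
  by (intro retract_centralizer_id[of "lprod xs"]) (auto simp: tuples_def)

lemma retract_merge_at:
  "set xs \<subseteq> carrier G \<Longrightarrow> Suc j < length xs \<Longrightarrow> retract (merge_at G j xs) = merge_at G j (retract xs)"
  by (simp add: retract_def lprod_merge_at walk_merge_at)

lemma lprod_alg_cyc:
  "set (ys @ [b]) \<subseteq> carrier G \<Longrightarrow> lprod (alg_cyc (ys @ [b])) = conj_by (lprod (ys @ [b])) (inv b)"
  by (simp add: lprod_append conj_by_def m_assoc del: foldr_append)

lemma retract_alg_cyc:
  assumes "set xs \<subseteq> carrier G" "xs \<noteq> []"
  shows "retract (alg_cyc xs) = alg_cyc (retract xs)"
proof -
  obtain ys b where xs: "xs = ys @ [b]" using assms(2) by (cases xs rule: rev_cases) auto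
  then have ys: "set ys \<subseteq> carrier G" and b: "b \<in> carrier G" using assms by auto
  have P: "lprod xs = lprod ys \<otimes> b" using xs ys b by (simp add: lprod_append del: foldr_append)
  have "conj_by (lprod xs) (lprod ys) = b \<otimes> lprod ys" using ys b by (simp add: P conj_by_def m_assoc)
  then have r: "retract xs = walk (lprod xs) ys @ [straighten (b \<otimes> lprod ys) b]"
    using ys b P by (simp add: retract_def walk_append xs)
  have "conj_by (b \<otimes> lprod ys) b = lprod xs" using ys b by (simp add: P conj_by_def m_assoc)
  then have "retract (alg_cyc xs) = straighten (b \<otimes> lprod ys) b # walk (lprod xs) ys"
    by (simp add: retract_def xs)
  then show ?thesis by (simp add: r)
qed

text \<open>
  The last face is the first one after a rotation, which reduces statements about it to merging
  neighbours and rotating.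
\<close>

lemma alg_face_last:
  assumes "xs \<in> tuples (Suc (Suc n)) (carrier G)"
  shows "alg_face G (Suc n) (Suc n) xs = merge_at G 0 (alg_cyc xs)"
  using cyclic_set.d_0_t[OF group_cyclic_set assms] by (simp add: alg_face_merge)

lemma retract_alg_face:
  assumes xs: "xs \<in> tuples (Suc (Suc n)) (carrier G)" and i: "i \<le> Suc n"
  shows "retract (alg_face G (Suc n) i xs) = alg_face G (Suc n) i (retract xs)"
proof (cases "i = Suc n")
  case False
  then show ?thesis using assms by (simp add: alg_face_merge retract_merge_at tuples_def)
next
  case True
  have "xs \<noteq> []" "set xs \<subseteq> carrier G" using xs by (auto simp: tuples_def)
  moreover have "set (alg_cyc xs) \<subseteq> carrier G" "length (alg_cyc xs) = Suc (Suc n)"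
    using alg_cyc_tuples[OF xs] by (auto simp: tuples_def)
  ultimately show ?thesis
    using True xs retract_tuples[OF xs] by (simp add: alg_face_last retract_merge_at retract_alg_cyc)
qed

lemma conj_class_alg_cyc:
  assumes "set xs \<subseteq> carrier G" "xs \<noteq> []"
  shows "conj_class (lprod (alg_cyc xs)) = conj_class (lprod xs)"
proof -
  obtain ys b where xs: "xs = ys @ [b]" using assms(2) by (cases xs rule: rev_cases) auto
  then show ?thesis
    using lprod_alg_cyc[of ys b] assms(1) conj_class_conj_by[of "lprod xs" "inv b"] by (simp del: foldr_append)
qed

lemma conj_class_alg_face:
  assumes xs: "xs \<in> tuples (Suc (Suc n)) (carrier G)" and i: "i \<le> Suc n"
  shows "conj_class (lprod (alg_face G (Suc n) i xs)) = conj_class (lprod xs)"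
proof (cases "i = Suc n")
  case False
  then show ?thesis using assms by (simp add: alg_face_merge lprod_merge_at tuples_def)
next
  case True
  have "xs \<noteq> []" "set xs \<subseteq> carrier G" using xs by (auto simp: tuples_def)
  moreover have "set (alg_cyc xs) \<subseteq> carrier G" "length (alg_cyc xs) = Suc (Suc n)"
    using alg_cyc_tuples[OF xs] by (auto simp: tuples_def)
  ultimately show ?thesis
    using True xs by (simp add: alg_face_last lprod_merge_at conj_class_alg_cyc)
qed

section \<open>The prism homotopy\<close>

text \<open>
  The path that follows the straightened arrows for \<open>j\<close> steps, then moves from the representative to
  the original path along a conjugator, and follows the original arrows from there on.
\<close>

fun bend :: "nat \<Rightarrow> 'a \<Rightarrow> 'a list \<Rightarrow> 'a list"
  where "bend 0 h gs = conjugator h # gs"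
  | "bend (Suc j) h [] = []"
  | "bend (Suc j) h (g # gs) = straighten h g # bend j (conj_by h g) gs"

text \<open>
  The first entry closes the path, so that the product stays the same; it is unchanged except that it
  has to end at the representative, where the bent path starts.
\<close>

definition prism :: "nat \<Rightarrow> 'a list \<Rightarrow> 'a list"
  where "prism j xs =
    (let h = conj_by (lprod xs) (hd xs) in (hd xs \<otimes> inv (conjugator h)) # bend j h (tl xs))"

lemma bend_tuples:
  "h \<in> carrier G \<Longrightarrow> set gs \<subseteq> carrier G \<Longrightarrow> j \<le> length gs \<Longrightarrow>
    set (bend j h gs) \<subseteq> carrier G \<and> length (bend j h gs) = Suc (length gs)"
  by (induction j h gs rule: bend.induct) auto

lemma bend_last:
  "h \<in> carrier G \<Longrightarrow> set gs \<subseteq> carrier G \<Longrightarrow>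
    bend (length gs) h gs = walk h gs @ [conjugator (conj_by h (lprod gs))]"
proof (induction gs arbitrary: h)
  case Nil then show ?case by (simp add: conj_by_def)
qed (simp add: conj_by_mult)

lemma bend_append: "j \<le> length gs \<Longrightarrow> bend j h (gs @ ks) = bend j h gs @ ks"
  by (induction j h gs rule: bend.induct) auto

lemma merge_bend_lower:
  "h \<in> carrier G \<Longrightarrow> set gs \<subseteq> carrier G \<Longrightarrow> i < j \<Longrightarrow> Suc j \<le> length gs \<Longrightarrow>
    merge_at G i (bend (Suc j) h gs) = bend j h (merge_at G i gs)"
proof (induction i arbitrary: j h gs)
  case 0
  then obtain j' where j: "j = Suc j'" by (cases j) auto
  obtain x y zs where gs: "gs = x # y # zs" using 0 by (cases gs; cases "tl gs") auto
  show ?case using 0 by (simp add: j gs straighten_mult conj_by_mult)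
next
  case (Suc i)
  then obtain j' where j: "j = Suc j'" by (cases j) auto
  obtain x ys where gs: "gs = x # ys" using Suc by (cases gs) auto
  show ?case using Suc j gs by simp
qed

lemma merge_bend_upper:
  "j < i \<Longrightarrow> i < length gs \<Longrightarrow> merge_at G i (bend j h gs) = bend j h (merge_at G (i - 1) gs)"
proof (induction j arbitrary: i h gs)
  case 0
  then obtain i' where i: "i = Suc i'" by (cases i) auto
  then show ?case by simp
next
  case (Suc j)
  then obtain i' where i: "i = Suc i'" by (cases i) auto
  then obtain i'' where i': "i' = Suc i''" using Suc by (cases i') auto
  obtain x ys where gs: "gs = x # ys" using Suc by (cases gs) auto
  show ?case using Suc by (simp add: i i' gs)
qed

lemma merge_bend_diag:
  "h \<in> carrier G \<Longrightarrow> set gs \<subseteq> carrier G \<Longrightarrow> j < length gs \<Longrightarrow>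
    merge_at G j (bend (Suc j) h gs) = merge_at G j (bend j h gs)"
proof (induction j arbitrary: h gs)
  case 0
  then obtain x ys where "gs = x # ys" by (cases gs) auto
  then show ?case using 0 by (simp add: straighten_def m_assoc)
next
  case (Suc j)
  then obtain x ys where "gs = x # ys" by (cases gs) auto
  then show ?case using Suc by simp
qed

lemma prism_Cons:
  "prism j (g # gs) = (g \<otimes> inv (conjugator (conj_by (lprod (g # gs)) g))) # bend j (conj_by (lprod (g # gs)) g) gs"
  by (simp add: prism_def Let_def)

context
  fixes xs :: "'a list" and n :: nat
  assumes xs: "xs \<in> tuples (Suc n) (carrier G)"
begin

lemma prism_tuples: "j \<le> n \<Longrightarrow> prism j xs \<in> tuples (Suc (Suc n)) (carrier G)"
  using xs bend_tuples[of "conj_by (lprod xs) (hd xs)" "tl xs" j]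
  by (cases xs) (auto simp: tuples_def prism_Cons)

lemma prism_first: "alg_face G (Suc n) 0 (prism 0 xs) = xs"
  using xs by (cases xs) (auto simp: tuples_def prism_Cons alg_face_merge m_assoc)

lemma prism_last: "alg_face G (Suc n) (Suc n) (prism n xs) = retract xs"
proof -
  obtain g gs where x: "xs = g # gs" "length gs = n" using xs by (cases xs) (auto simp: tuples_def)
  then have c: "g \<in> carrier G" "set gs \<subseteq> carrier G" using xs by (auto simp: tuples_def)
  let ?P = "lprod xs" and ?h = "conj_by (lprod xs) g"
  have h: "?h \<in> carrier G" and P: "?P \<in> carrier G" using x c by auto
  have "conj_by ?h (lprod gs) = conj_by ?P (lprod xs)"
    using x c by (simp add: conj_by_mult)
  then have "conj_by ?h (lprod gs) = ?P" using P by (simp add: conj_by_self)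
  then have b: "bend n ?h gs = walk ?h gs @ [conjugator ?P]" using bend_last[OF h c(2)] x by simp
  have "prism n xs = (g \<otimes> inv (conjugator ?h)) # walk ?h gs @ [conjugator ?P]"
    using b x by (simp add: prism_Cons)
  moreover have "conjugator ?P \<otimes> (g \<otimes> inv (conjugator ?h)) = straighten ?P g"
    using c h P by (simp add: straighten_def m_assoc)
  ultimately have "alg_face G (Suc n) (Suc n) (prism n xs) = straighten ?P g # walk ?h gs"
    using x by (simp add: alg_face_wrap)
  then show ?thesis by (simp add: retract_def x)
qed

lemma prism_lower:
  assumes "i < j" "j \<le> n"
  shows "alg_face G (Suc n) i (prism j xs) = prism (j - 1) (alg_face G n i xs)"
proof -
  obtain g gs where x: "xs = g # gs" "length gs = n" using xs by (cases xs) (auto simp: tuples_def)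
  then have c: "g \<in> carrier G" "set gs \<subseteq> carrier G" using xs by (auto simp: tuples_def)
  let ?h = "conj_by (lprod xs) g"
  have h: "?h \<in> carrier G" using x c by auto
  obtain j' where j: "j = Suc j'" using assms by (cases j) auto
  show ?thesis
  proof (cases i)
    case 0
    obtain k ks where k: "gs = k # ks" using x assms by (cases gs) auto
    have "k \<in> carrier G" "set ks \<subseteq> carrier G" using c k by auto
    moreover have "conj_by (lprod xs) (g \<otimes> k) = conj_by ?h k" using x c k by (simp add: conj_by_mult)
    ultimately show ?thesis
      using 0 c assms x k j by (simp add: alg_face_merge prism_Cons straighten_def m_assoc)
  next
    case (Suc i')
    have "lprod (g # merge_at G i' gs) = lprod xs" using x c Suc assms by (simp add: lprod_merge_at)
    then show ?thesis
      using Suc assms x j merge_bend_lower[OF h c(2), of i' j'] by (simp add: alg_face_merge prism_Cons)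
  qed
qed

lemma prism_upper:
  assumes "Suc j < i" "i \<le> Suc n"
  shows "alg_face G (Suc n) i (prism j xs) = prism j (alg_face G n (i - 1) xs)"
proof -
  obtain g gs where x: "xs = g # gs" "length gs = n" using xs by (cases xs) (auto simp: tuples_def)
  then have c: "g \<in> carrier G" "set gs \<subseteq> carrier G" using xs by (auto simp: tuples_def)
  let ?h = "conj_by (lprod xs) g"
  have h: "?h \<in> carrier G" using x c by auto
  obtain i' where i: "i = Suc (Suc i')" using assms(1) by (cases i; cases "i - 1") auto
  show ?thesis
  proof (cases "i = Suc n")
    case False
    have "lprod (g # merge_at G i' gs) = lprod xs" using x c False i assms by (simp add: lprod_merge_at)
    then show ?thesis
      using False i assms x merge_bend_upper[of j "Suc i'" gs ?h] by (simp add: alg_face_merge prism_Cons)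
  next
    case True
    then have n: "n = Suc i'" using i by simp
    obtain ks b where ks: "gs = ks @ [b]" "length ks = i'" using x n by (cases gs rule: rev_cases) auto
    have kc: "set ks \<subseteq> carrier G" "b \<in> carrier G" using ks c by auto
    have jk: "j \<le> length ks" using assms True n ks by auto
    have len: "length (bend j ?h ks) = n" using bend_tuples[OF h kc(1) jk] ks n by simp
    have p: "prism j xs = (g \<otimes> inv (conjugator ?h)) # bend j ?h ks @ [b]"
      using x ks bend_append[OF jk] by (simp add: prism_Cons)
    have "alg_face G n (i - 1) xs = (b \<otimes> g) # ks" using x ks n i by (simp add: alg_face_wrap)
    moreover have "conj_by (lprod ((b \<otimes> g) # ks)) (b \<otimes> g) = ?h"
    proof -
      have "lprod xs = g \<otimes> lprod ks \<otimes> b"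
        using x ks kc c by (simp add: lprod_append m_assoc del: foldr_append)
      then show ?thesis using kc c by (simp add: conj_by_def inv_mult_group m_assoc)
    qed
    ultimately show ?thesis
      using p len True h c kc by (simp add: alg_face_wrap prism_Cons m_assoc)
  qed
qed

lemma prism_diag:
  assumes "j < n"
  shows "alg_face G (Suc n) (Suc j) (prism (Suc j) xs) = alg_face G (Suc n) (Suc j) (prism j xs)"
proof -
  obtain g gs where x: "xs = g # gs" "length gs = n" using xs by (cases xs) (auto simp: tuples_def)
  then have c: "g \<in> carrier G" "set gs \<subseteq> carrier G" using xs by (auto simp: tuples_def)
  have h: "conj_by (lprod xs) g \<in> carrier G" using x c by auto
  show ?thesis
    using merge_bend_diag[OF h c(2), of j] assms x by (simp add: alg_face_merge prism_Cons)
qed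

end

section \<open>Comparison with the Hopf cyclic set\<close>

lemma centralizer_simps:
  "x \<otimes>\<^bsub>centralizer G z\<^esub> y = x \<otimes> y" "\<one>\<^bsub>centralizer G z\<^esub> = \<one>"
  by (simp_all add: centralizer_def)

lemma centralizer_subgroup:
  assumes z: "z \<in> carrier G"
  shows "subgroup (carrier (centralizer G z)) G"
proof
  show "carrier (centralizer G z) \<subseteq> carrier G" by (rule centralizer_subset)
  show "\<one> \<in> carrier (centralizer G z)" using z by (simp add: centralizer_def)
  fix x assume x: "x \<in> carrier (centralizer G z)"
  then have "inv x \<otimes> z = inv x \<otimes> (z \<otimes> x) \<otimes> inv x" using z by (auto simp: centralizer_def m_assoc)
  also have "z \<otimes> x = x \<otimes> z" using x by (simp add: centralizer_def)
  also have "inv x \<otimes> (x \<otimes> z) \<otimes> inv x = z \<otimes> inv x"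
    using subsetD[OF centralizer_subset x] z by simp
  finally show "inv x \<in> carrier (centralizer G z)" using x by (simp add: centralizer_def)
  fix y assume y: "y \<in> carrier (centralizer G z)"
  have "x \<otimes> y \<otimes> z = x \<otimes> (z \<otimes> y)" using x y z by (auto simp: centralizer_def m_assoc)
  also have "\<dots> = z \<otimes> (x \<otimes> y)" using x y z by (auto simp: centralizer_def simp flip: m_assoc)
  finally show "x \<otimes> y \<in> carrier (centralizer G z)" using x y by (simp add: centralizer_def)
qed

lemma centralizer_group: "z \<in> carrier G \<Longrightarrow> group (centralizer G z)"
  using subgroup_imp_group[OF centralizer_subgroup] by (simp add: centralizer_def)

lemma centralizer_inv:
  assumes "z \<in> carrier G" "x \<in> carrier (centralizer G z)"
  shows "inv\<^bsub>centralizer G z\<^esub> x = inv x"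
  using m_inv_consistent[OF centralizer_subgroup[OF assms(1)] assms(2)] by (simp add: centralizer_def)

lemma lprod_centralizer:
  "z \<in> carrier G \<Longrightarrow> set xs \<subseteq> carrier (centralizer G z) \<Longrightarrow> lprod xs \<in> carrier (centralizer G z)"
  using group.lprod_closed[OF centralizer_group, of z xs]
  by (simp add: centralizer_def)

lemma merge_at_centralizer: "merge_at (centralizer G z) = merge_at G"
  by (simp add: merge_at_def[abs_def] centralizer_simps)

lemma tl_alg_face:
  assumes "length xs = Suc (Suc n)" "i \<le> Suc n"
  shows "tl (alg_face G (Suc n) i xs) = hopf_face (centralizer G z) (Suc n) i (tl xs)"
proof -
  obtain a b ys where x: "xs = a # ys @ [b]" "length ys = n" using two_elements assms(1) by metis
  show ?thesis
  proof (cases "i = Suc n")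
    case True
    then show ?thesis using x by (simp add: alg_face_wrap hopf_face_def)
  next
    case False
    then show ?thesis
    proof (cases i)
      case 0
      then show ?thesis using False assms x
        by (cases "ys @ [b]") (simp_all add: alg_face_merge hopf_face_def)
    next
      case (Suc i')
      then show ?thesis using False assms x
        by (simp add: alg_face_merge hopf_face_def merge_at_centralizer)
    qed
  qed
qed

text \<open>
  Inverse to dropping the first entry, on tuples in the centralizer of \<open>z\<close> with product \<open>z\<close>.
\<close>

definition complete :: "'a \<Rightarrow> 'a list \<Rightarrow> 'a list"
  where "complete z ys = (z \<otimes> inv (lprod ys)) # ys"

context
  fixes z assumes z: "z \<in> carrier G"
begin

lemma complete_tuples:
  assumes "ys \<in> tuples n (carrier (centralizer G z))"
  shows "complete z ys \<in> tuples (Suc n) (carrier (centralizer G z))" "lprod (complete z ys) = z"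
proof -
  interpret L: group "centralizer G z" by (rule centralizer_group[OF z])
  have ys: "set ys \<subseteq> carrier (centralizer G z)" using assms by (simp add: tuples_def)
  note c = lprod_centralizer[OF z ys]
  have "z \<in> carrier (centralizer G z)" using z by (simp add: centralizer_def)
  then have "z \<otimes>\<^bsub>centralizer G z\<^esub> inv\<^bsub>centralizer G z\<^esub> (lprod ys) \<in> carrier (centralizer G z)"
    using c by simp
  then show "complete z ys \<in> tuples (Suc n) (carrier (centralizer G z))"
    using assms c by (simp add: tuples_def complete_def centralizer_simps centralizer_inv[OF z])
  have "lprod ys \<in> carrier G" using c centralizer_subset by blast
  then show "lprod (complete z ys) = z" using z by (simp add: complete_def m_assoc)
qed

lemma complete_tl:
  assumes "xs \<in> tuples (Suc n) (carrier (centralizer G z))" "lprod xs = z"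
  shows "complete z (tl xs) = xs"
proof -
  obtain a ys where x: "xs = a # ys" using assms(1) by (cases xs) (auto simp: tuples_def)
  have "a \<in> carrier G" "set ys \<subseteq> carrier G" using assms(1) x centralizer_subset by (auto simp: tuples_def)
  then have "a = z \<otimes> inv (lprod ys)" using assms(2) x by (auto simp: m_assoc)
  then show ?thesis by (simp add: complete_def x)
qed

lemma tl_alg_cyc:
  assumes xs: "xs \<in> tuples (Suc n) (carrier (centralizer G z))" and P: "lprod xs = z"
  shows "tl (alg_cyc xs) = hopf_cyc (centralizer G z) z n (tl xs)"
proof (cases n)
  case 0
  then obtain a where "xs = [a]" using xs by (cases xs) (auto simp: tuples_def)
  then show ?thesis using 0 by (simp add: alg_cyc_def hopf_cyc_def)
next
  case (Suc m)
  obtain a b ys where x: "xs = a # ys @ [b]" using two_elements tuples_length[OF xs] Suc by metis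
  have t: "set (ys @ [b]) \<subseteq> carrier (centralizer G z)" using xs x by (auto simp: tuples_def)
  have "a = z \<otimes> inv (lprod (ys @ [b]))" using complete_tl[OF xs P] x by (simp add: complete_def)
  then show ?thesis
    using Suc x centralizer_inv[OF z lprod_centralizer[OF z t]]
    by (simp add: hopf_cyc_def centralizer_def)
qed

lemma lprod_alg_cyc_centralizer:
  assumes xs: "xs \<in> tuples (Suc n) (carrier (centralizer G z))" and P: "lprod xs = z"
  shows "lprod (alg_cyc xs) = z"
proof -
  obtain ys b where x: "xs = ys @ [b]" using xs by (cases xs rule: rev_cases) (auto simp: tuples_def)
  have b: "b \<in> carrier (centralizer G z)" and set: "set (ys @ [b]) \<subseteq> carrier G"
    using xs x centralizer_subset by (auto simp: tuples_def)
  interpret L: group "centralizer G z" by (rule centralizer_group[OF z])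
  have "inv b \<in> carrier (centralizer G z)" using L.inv_closed[OF b] centralizer_inv[OF z b] by simp
  then show ?thesis using lprod_alg_cyc[OF set] conj_by_centralizer[OF z] P x by simp
qed

lemma alg_face_centralizer:
  assumes xs: "xs \<in> tuples (Suc (Suc n)) (carrier (centralizer G z))" and P: "lprod xs = z" and i: "i \<le> Suc n"
  shows "alg_face G (Suc n) i xs \<in> tuples (Suc n) (carrier (centralizer G z))"
    and "lprod (alg_face G (Suc n) i xs) = z"
proof -
  interpret L: group "centralizer G z" by (rule centralizer_group[OF z])
  have "alg_face (centralizer G z) (Suc n) i xs = alg_face G (Suc n) i xs"
    by (simp add: alg_face_def merge_at_centralizer centralizer_simps)
  then show "alg_face G (Suc n) i xs \<in> tuples (Suc n) (carrier (centralizer G z))"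
    using L.alg_face_tuples[OF xs i] by simp
  have xG: "xs \<in> tuples (Suc (Suc n)) (carrier G)" using xs centralizer_subset by (auto simp: tuples_def)
  show "lprod (alg_face G (Suc n) i xs) = z"
  proof (cases "i = Suc n")
    case False
    then show ?thesis using i xG P by (simp add: alg_face_merge lprod_merge_at tuples_def)
  next
    case True
    have "set (alg_cyc xs) \<subseteq> carrier G" "length (alg_cyc xs) = Suc (Suc n)"
      using alg_cyc_tuples[OF xG] by (auto simp: tuples_def)
    then show ?thesis
      using True xG lprod_alg_cyc_centralizer[OF xs P] by (simp add: alg_face_last lprod_merge_at)
  qed
qed

end

end


section \<open>Group algebras\<close>

definition group_based :: "('r, 'k) ring_scheme \<Rightarrow> ('g, 'l) monoid_scheme \<Rightarrow> ('r, 'g \<Rightarrow> 'r, 'g) based_module"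
  where "group_based R G = \<lparr>Space = group_algebra R G, Idx = carrier G, Elt = gen R\<rparr>"

lemma group_algebra_simps:
  "carrier (group_algebra R G) = carrier (free_module R (carrier G))"
  "\<zero>\<^bsub>group_algebra R G\<^esub> = \<zero>\<^bsub>free_module R (carrier G)\<^esub>"
  "f \<oplus>\<^bsub>group_algebra R G\<^esub> h = f \<oplus>\<^bsub>free_module R (carrier G)\<^esub> h"
  "r \<odot>\<^bsub>group_algebra R G\<^esub> f = r \<odot>\<^bsub>free_module R (carrier G)\<^esub> f"
  by (simp_all add: group_algebra_def)

context cring
begin

lemma group_algebra_module: "module R (group_algebra R G)"
proof -
  interpret F: module R "free_module R (carrier G)" by (rule free_module_module)
  have "abelian_group (group_algebra R G)"
    by (rule abelian_groupI)
      (auto simp: group_algebra_simps F.M.a_ac intro: F.M.l_neg bexI[of _ "\<ominus>\<^bsub>free_module R (carrier G)\<^esub> _"])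
  then show ?thesis
    by (intro moduleI)
      (auto simp: group_algebra_simps cring_axioms F.smult_l_distr F.smult_r_distr F.smult_assoc1)
qed

lemma group_based_basis: "is_basis R (group_based R G)"
proof -
  interpret A: module R "group_algebra R G" by (rule group_algebra_module)
  have "submodule H R (free_module R (carrier G))" if H: "submodule H R (group_algebra R G)" for H
  proof -
    interpret F: module R "free_module R (carrier G)" by (rule free_module_module)
    note E = A.submoduleE[OF H] and Z = submodule_zero[OF A.module_axioms H]
    show ?thesis
    proof (rule F.submoduleI)
      fix a assume a: "a \<in> H"
      have "(\<ominus> \<one>) \<odot>\<^bsub>group_algebra R G\<^esub> a \<in> H" using E(4) a by simp
      moreover have "a \<in> carrier (free_module R (carrier G))" using E(1) a by (auto simp: group_algebra_simps)
      ultimately show "\<ominus>\<^bsub>free_module R (carrier G)\<^esub> a \<in> H"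
        by (simp add: F.minus_one_smult group_algebra_simps)
    qed (use E Z in \<open>auto simp: group_algebra_simps\<close>)
  qed
  then have "spanning R (group_algebra R G) (gen R ` carrier G)"
    unfolding spanning_def group_algebra_simps
    using free_module_span[of _ "carrier G"] gen_closed[of _ "carrier G"] by (auto simp: image_subset_iff)
  moreover have "(\<lambda>f. f) \<in> mod_hom R (group_algebra R G) (free_module R (carrier G))"
    by (auto simp: mod_hom_def group_algebra_simps)
  ultimately show ?thesis
    by (auto simp: is_basis_def group_based_def group_algebra_module)
qed

lemma group_algebra_supp:
  assumes "f \<in> carrier (group_algebra R G)"
  shows "finite {x. f x \<noteq> \<zero>}" "{x. f x \<noteq> \<zero>} \<subseteq> carrier G"
  using assms by (auto simp: group_algebra_simps free_module_carrier_iff)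

lemma group_algebra_val: "f \<in> carrier (group_algebra R G) \<Longrightarrow> f x \<in> carrier R"
  using free_module_val by (auto simp: group_algebra_simps)

text \<open>
  Summing over a fixed finite set that contains both supports makes bilinearity a termwise matter.
\<close>

lemma group_algebra_mult:
  assumes fh: "f \<in> carrier (group_algebra R G)" "h \<in> carrier (group_algebra R G)"
    and S: "finite S" "S \<subseteq> carrier G" "{x. f x \<noteq> \<zero>} \<subseteq> S" "{x. h x \<noteq> \<zero>} \<subseteq> S"
  shows "(f \<otimes>\<^bsub>group_algebra R G\<^esub> h) g =
    finsum R (\<lambda>p. f (fst p) \<otimes> h (snd p)) {p \<in> S \<times> S. fst p \<otimes>\<^bsub>G\<^esub> snd p = g}"
proof -
  note v = group_algebra_val[OF fh(1)] group_algebra_val[OF fh(2)]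
  have fin: "finite {p \<in> S \<times> S. fst p \<otimes>\<^bsub>G\<^esub> snd p = g}" using S by simp
  have "finsum R (\<lambda>p. f (fst p) \<otimes> h (snd p))
      {(x, y). x \<in> carrier G \<and> y \<in> carrier G \<and> f x \<noteq> \<zero> \<and> h y \<noteq> \<zero> \<and> x \<otimes>\<^bsub>G\<^esub> y = g} =
    finsum R (\<lambda>p. f (fst p) \<otimes> h (snd p)) {p \<in> S \<times> S. fst p \<otimes>\<^bsub>G\<^esub> snd p = g}"
    by (rule add.finprod_mono_neutral_cong_left[OF fin]) (use S v in auto)
  then show ?thesis by (simp add: group_algebra_def case_prod_unfold)
qed

lemma group_algebra_mult_closed:
  assumes G: "group G" and f: "f \<in> carrier (group_algebra R G)" and h: "h \<in> carrier (group_algebra R G)"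
  shows "f \<otimes>\<^bsub>group_algebra R G\<^esub> h \<in> carrier (group_algebra R G)"
proof -
  interpret G: group G by fact
  define S where "S = {x. f x \<noteq> \<zero>} \<union> {x. h x \<noteq> \<zero>}"
  have S: "finite S" "S \<subseteq> carrier G"
    using group_algebra_supp[OF f] group_algebra_supp[OF h] by (auto simp: S_def)
  have m: "(f \<otimes>\<^bsub>group_algebra R G\<^esub> h) g =
      finsum R (\<lambda>p. f (fst p) \<otimes> h (snd p)) {p \<in> S \<times> S. fst p \<otimes>\<^bsub>G\<^esub> snd p = g}" for g
    by (rule group_algebra_mult[OF f h S]) (auto simp: S_def)
  let ?I = "(\<lambda>p. fst p \<otimes>\<^bsub>G\<^esub> snd p) ` (S \<times> S)"
  have I: "finite ?I" by (intro finite_imageI finite_cartesian_product S(1))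
  have IG: "?I \<subseteq> carrier G" using S(2) by (auto intro!: G.m_closed)
  have z: "(f \<otimes>\<^bsub>group_algebra R G\<^esub> h) g = \<zero>" if "g \<notin> ?I" for g
  proof -
    have e: "{p \<in> S \<times> S. fst p \<otimes>\<^bsub>G\<^esub> snd p = g} = {}" using that by blast
    show ?thesis unfolding m e by simp
  qed
  have "(f \<otimes>\<^bsub>group_algebra R G\<^esub> h) g \<in> carrier R" for g
    unfolding m using group_algebra_val[OF f] group_algebra_val[OF h] by (intro finsum_closed) auto
  moreover have "finite {g. (f \<otimes>\<^bsub>group_algebra R G\<^esub> h) g \<noteq> \<zero>}"
    by (rule finite_subset[OF _ I]) (use z in blast)
  moreover have "(f \<otimes>\<^bsub>group_algebra R G\<^esub> h) g = \<zero>" if "g \<notin> carrier G" for g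
    using z IG that by blast
  ultimately show ?thesis by (simp add: group_algebra_simps free_module_carrier_iff)
qed

lemma group_algebra_mult_hom:
  assumes G: "group G" and a: "a \<in> carrier (group_algebra R G)"
  shows "(\<lambda>f. f \<otimes>\<^bsub>group_algebra R G\<^esub> a) \<in> mod_hom R (group_algebra R G) (group_algebra R G)"
    and "(\<lambda>f. a \<otimes>\<^bsub>group_algebra R G\<^esub> f) \<in> mod_hom R (group_algebra R G) (group_algebra R G)"
proof -
  let ?A = "group_algebra R G"
  interpret A: module R ?A by (rule group_algebra_module)
  note av = group_algebra_val[OF a]
  have add: "((f \<oplus>\<^bsub>?A\<^esub> h) \<otimes>\<^bsub>?A\<^esub> a) g = (f \<otimes>\<^bsub>?A\<^esub> a) g \<oplus> (h \<otimes>\<^bsub>?A\<^esub> a) g \<and>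
      (a \<otimes>\<^bsub>?A\<^esub> (f \<oplus>\<^bsub>?A\<^esub> h)) g = (a \<otimes>\<^bsub>?A\<^esub> f) g \<oplus> (a \<otimes>\<^bsub>?A\<^esub> h) g"
    if f: "f \<in> carrier ?A" and h: "h \<in> carrier ?A" for f h g
  proof -
    define S where "S = {x. f x \<noteq> \<zero>} \<union> {x. h x \<noteq> \<zero>} \<union> {x. a x \<noteq> \<zero>}"
    let ?I = "{p \<in> S \<times> S. fst p \<otimes>\<^bsub>G\<^esub> snd p = g}"
    have S: "finite S" "S \<subseteq> carrier G"
      using group_algebra_supp[OF f] group_algebra_supp[OF h] group_algebra_supp[OF a] by (auto simp: S_def)
    have fS: "{x. f x \<noteq> \<zero>} \<subseteq> S" and hS: "{x. h x \<noteq> \<zero>} \<subseteq> S" and aS: "{x. a x \<noteq> \<zero>} \<subseteq> S"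
      and fhS: "{x. (f \<oplus>\<^bsub>?A\<^esub> h) x \<noteq> \<zero>} \<subseteq> S"
      by (auto simp: S_def group_algebra_simps free_module_simps)
    note e = group_algebra_mult[OF _ _ S]
    note v = group_algebra_val[OF f] group_algebra_val[OF h] av
    have "finsum R (\<lambda>p. (f \<oplus>\<^bsub>?A\<^esub> h) (fst p) \<otimes> a (snd p)) ?I =
        finsum R (\<lambda>p. f (fst p) \<otimes> a (snd p) \<oplus> h (fst p) \<otimes> a (snd p)) ?I"
      using v by (intro finsum_cong') (auto simp: group_algebra_simps free_module_simps l_distr)
    moreover have "finsum R (\<lambda>p. a (fst p) \<otimes> (f \<oplus>\<^bsub>?A\<^esub> h) (snd p)) ?I =
        finsum R (\<lambda>p. a (fst p) \<otimes> f (snd p) \<oplus> a (fst p) \<otimes> h (snd p)) ?I"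
      using v by (intro finsum_cong') (auto simp: group_algebra_simps free_module_simps r_distr)
    ultimately show ?thesis
      unfolding e[OF f a fS aS] e[OF h a hS aS] e[OF a f aS fS] e[OF a h aS hS]
        e[OF A.M.a_closed[OF f h] a fhS aS] e[OF a A.M.a_closed[OF f h] aS fhS]
      using v by (simp add: Pi_iff)
  qed
  have smult: "((r \<odot>\<^bsub>?A\<^esub> f) \<otimes>\<^bsub>?A\<^esub> a) g = r \<otimes> (f \<otimes>\<^bsub>?A\<^esub> a) g \<and>
      (a \<otimes>\<^bsub>?A\<^esub> (r \<odot>\<^bsub>?A\<^esub> f)) g = r \<otimes> (a \<otimes>\<^bsub>?A\<^esub> f) g"
    if r: "r \<in> carrier R" and f: "f \<in> carrier ?A" for r f g
  proof -
    define S where "S = {x. f x \<noteq> \<zero>} \<union> {x. a x \<noteq> \<zero>}"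
    let ?I = "{p \<in> S \<times> S. fst p \<otimes>\<^bsub>G\<^esub> snd p = g}"
    have S: "finite S" "S \<subseteq> carrier G"
      using group_algebra_supp[OF f] group_algebra_supp[OF a] by (auto simp: S_def)
    have fS: "{x. f x \<noteq> \<zero>} \<subseteq> S" and aS: "{x. a x \<noteq> \<zero>} \<subseteq> S"
      and rfS: "{x. (r \<odot>\<^bsub>?A\<^esub> f) x \<noteq> \<zero>} \<subseteq> S"
      using r by (auto simp: S_def group_algebra_simps free_module_simps)
    note e = group_algebra_mult[OF _ _ S]
    have I: "finite ?I" using S by simp
    note v = group_algebra_val[OF f] av
    have "finsum R (\<lambda>p. (r \<odot>\<^bsub>?A\<^esub> f) (fst p) \<otimes> a (snd p)) ?I =
        finsum R (\<lambda>p. r \<otimes> (f (fst p) \<otimes> a (snd p))) ?I"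
      using v r by (intro finsum_cong') (auto simp: group_algebra_simps free_module_simps m_assoc)
    moreover have "finsum R (\<lambda>p. a (fst p) \<otimes> (r \<odot>\<^bsub>?A\<^esub> f) (snd p)) ?I =
        finsum R (\<lambda>p. r \<otimes> (a (fst p) \<otimes> f (snd p))) ?I"
      using v r by (intro finsum_cong') (auto simp: group_algebra_simps free_module_simps m_lcomm)
    ultimately show ?thesis
      unfolding e[OF f a fS aS] e[OF a f aS fS]
        e[OF A.smult_closed[OF r f] a rfS aS] e[OF a A.smult_closed[OF r f] aS rfS]
      using v r I by (simp add: finsum_rdistr Pi_iff)
  qed
  show "(\<lambda>f. f \<otimes>\<^bsub>?A\<^esub> a) \<in> mod_hom R ?A ?A"
    by (rule mod_homI; (rule ext)?)
      (use add smult group_algebra_mult_closed[OF G _ a] in \<open>simp_all add: group_algebra_simps(3,4) free_module_simps\<close>)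
  show "(\<lambda>f. a \<otimes>\<^bsub>?A\<^esub> f) \<in> mod_hom R ?A ?A"
    by (rule mod_homI; (rule ext)?)
      (use add smult group_algebra_mult_closed[OF G a] in \<open>simp_all add: group_algebra_simps(3,4) free_module_simps\<close>)
qed

lemma group_algebra_mult_gen:
  assumes "x \<in> carrier G" "y \<in> carrier G"
  shows "gen R x \<otimes>\<^bsub>group_algebra R G\<^esub> gen R y = gen R (x \<otimes>\<^bsub>G\<^esub> y)"
proof
  fix g
  have c: "gen R x \<in> carrier (group_algebra R G)" "gen R y \<in> carrier (group_algebra R G)"
    using gen_closed assms by (auto simp: group_algebra_simps)
  let ?I = "{p \<in> {x, y} \<times> {x, y}. fst p \<otimes>\<^bsub>G\<^esub> snd p = g}"
  have "(gen R x \<otimes>\<^bsub>group_algebra R G\<^esub> gen R y) g = finsum R (\<lambda>p. gen R x (fst p) \<otimes> gen R y (snd p)) ?I"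
    by (rule group_algebra_mult[OF c]) (use assms in \<open>auto simp: gen_def\<close>)
  also have "\<dots> = finsum R (\<lambda>p. if p = (x, y) then \<one> else \<zero>) ?I"
    by (rule finsum_cong') (auto simp: gen_def)
  also have "\<dots> = (if (x, y) \<in> ?I then \<one> else \<zero>)" by (rule finsum_delta) auto
  also have "\<dots> = gen R (x \<otimes>\<^bsub>G\<^esub> y) g" by (auto simp: gen_def)
  finally show "(gen R x \<otimes>\<^bsub>group_algebra R G\<^esub> gen R y) g = gen R (x \<otimes>\<^bsub>G\<^esub> y) g" .
qed

end

section \<open>The cyclic modules in terms of their bases\<close>

text \<open>
  A substitution that carries each slot linearly into a single slot preserves multilinearity.
\<close>

lemma multilinear_substitution:
  assumes M: "module R M"
    and \<phi>: "\<And>as. as \<in> tuples n (carrier M) \<Longrightarrow> \<phi> as \<in> tuples m (carrier M)"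
    and slot: "\<And>as k. as \<in> tuples n (carrier M) \<Longrightarrow> k < n \<Longrightarrow>
      \<exists>bs\<in>tuples m (carrier M). \<exists>k'<m. \<exists>L\<in>mod_hom R M M. \<forall>x\<in>carrier M. \<phi> (as[k := x]) = bs[k' := L x]"
  shows "multilinear R M n (tensor_power R M m) (\<lambda>as. pure_tensor R M (\<phi> as))"
  unfolding multilinear_def
proof (intro conjI ballI allI impI)
  show "(\<lambda>as. pure_tensor R M (\<phi> as)) \<in> tuples n (carrier M) \<rightarrow> carrier (tensor_power R M m)"
    using pure_tensor_closed[OF M] \<phi> by blast
  fix as k assume "as \<in> tuples n (carrier M)" "k < n"
  from slot[OF this] obtain bs k' L where
    L: "bs \<in> tuples m (carrier M)" "k' < m" "L \<in> mod_hom R M M"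
      "\<And>x. x \<in> carrier M \<Longrightarrow> \<phi> (as[k := x]) = bs[k' := L x]" by blast
  have "(\<lambda>y. pure_tensor R M (bs[k' := y])) \<in> mod_hom R M (tensor_power R M m)"
    using pure_tensor_multilinear[OF M, of m] L by (auto simp: multilinear_def)
  from mod_hom_cong[OF mod_hom_comp[OF L(3) this] M] L(4)
  show "(\<lambda>x. pure_tensor R M (\<phi> (as[k := x]))) \<in> mod_hom R M (tensor_power R M m)" by auto
qed

lemma merge_at_update:
  assumes "Suc j < length as" "k < length as"
  shows "merge_at A j (as[k := x]) =
    (if k < j then (merge_at A j as)[k := x]
     else if k = j then (merge_at A j as)[j := x \<otimes>\<^bsub>A\<^esub> as ! Suc j]
     else if k = Suc j then (merge_at A j as)[j := as ! j \<otimes>\<^bsub>A\<^esub> x]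
     else (merge_at A j as)[k - 1 := x])"
  using assms
proof (induction j arbitrary: as k)
  case 0
  obtain a as' where a: "as = a # as'" using 0 by (cases as) auto
  obtain b bs where b: "as' = b # bs" using 0 a by (cases as') auto
  show ?case by (cases k; cases "k - 1") (auto simp: a b)
next
  case (Suc j)
  obtain a as' where a: "as = a # as'" using Suc by (cases as) auto
  show ?case
  proof (cases k)
    case 0 then show ?thesis by (simp add: a)
  next
    case (Suc k')
    then have "k' - 1 = k' - Suc 0" by simp
    then show ?thesis using Suc.IH[of as' k'] Suc.prems Suc by (cases k') (auto simp: a)
  qed
qed

abbreviation tensor_group ::
  "('r, 'k) ring_scheme \<Rightarrow> ('g, 'l) monoid_scheme \<Rightarrow> nat \<Rightarrow> ('r, (('g \<Rightarrow> 'r) list \<Rightarrow> 'r) set, 'g list) based_module"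
  where "tensor_group R G n \<equiv> tensor_based R (group_based R G) n"

context
  fixes R :: "('r, 'k) ring_scheme" and G :: "('g, 'l) monoid_scheme"
  assumes R: "cring R" and G: "group G"
begin

interpretation R: cring R by (fact R)
interpretation G: group G by (fact G)

lemma alg_face_group_algebra_closed:
  "as \<in> tuples (Suc (Suc n)) (carrier (group_algebra R G)) \<Longrightarrow> i \<le> Suc n \<Longrightarrow>
    alg_face (group_algebra R G) (Suc n) i as \<in> tuples (Suc n) (carrier (group_algebra R G))"
proof -
  let ?A = "group_algebra R G"
  assume as: "as \<in> tuples (Suc (Suc n)) (carrier ?A)" and i: "i \<le> Suc n"
  show ?thesis
  proof (cases "i = Suc n")
    case False
    have "as ! i \<otimes>\<^bsub>?A\<^esub> as ! Suc i \<in> carrier ?A"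
      using R.group_algebra_mult_closed[OF G] tuples_nth[OF as] False i by simp
    then show ?thesis
      using as False i set_merge_at[of i as ?A] length_merge_at[of i as ?A]
      by (auto simp: alg_face_merge tuples_def)
  next
    case True
    obtain a b ys where "as = a # ys @ [b]" "length ys = n" using two_elements tuples_length[OF as] by metis
    then show ?thesis
      using True as R.group_algebra_mult_closed[OF G] by (auto simp: alg_face_wrap tuples_def)
  qed
qed

lemma alg_face_multilinear:
  assumes i: "i \<le> Suc n"
  shows "multilinear R (group_algebra R G) (Suc (Suc n)) (tensor_power R (group_algebra R G) (Suc n))
    (\<lambda>as. pure_tensor R (group_algebra R G) (alg_face (group_algebra R G) (Suc n) i as))"
    (is "multilinear R ?A _ _ _")
proof (rule multilinear_substitution[OF R.group_algebra_module])
  fix as assume as: "as \<in> tuples (Suc (Suc n)) (carrier ?A)"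
  show "alg_face ?A (Suc n) i as \<in> tuples (Suc n) (carrier ?A)" by (rule alg_face_group_algebra_closed[OF as i])
  fix k assume k: "k < Suc (Suc n)"
  note bs = alg_face_group_algebra_closed[OF as i]
  note len = tuples_length[OF as]
  have idh: "(\<lambda>x. x) \<in> mod_hom R ?A ?A" by (rule mod_hom_id)
  show "\<exists>bs\<in>tuples (Suc n) (carrier ?A). \<exists>k'<Suc n. \<exists>L\<in>mod_hom R ?A ?A.
      \<forall>x\<in>carrier ?A. alg_face ?A (Suc n) i (as[k := x]) = bs[k' := L x]"
  proof (cases "i = Suc n")
    case False
    then have j: "Suc i < length as" using i len by simp
    have f: "alg_face ?A (Suc n) i cs = merge_at ?A i cs" for cs using False i by (simp add: alg_face_merge)
    note m = merge_at_update[OF j, of k ?A]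
    note h = R.group_algebra_mult_hom[OF G tuples_nth[OF as]]
    consider "k < i" | "k = i" | "k = Suc i" | "Suc i < k" by linarith
    then show ?thesis
    proof cases
      case 1
      then show ?thesis using bs m k len idh i unfolding f by (intro bexI[OF _ bs[unfolded f]] exI[of _ k] conjI bexI[OF _ idh]) auto
    next
      case 2
      then show ?thesis using m k len i False unfolding f
        by (intro bexI[OF _ bs[unfolded f]] exI[of _ i] conjI bexI[OF _ h(1)[of "Suc i"]]) auto
    next
      case 3
      then show ?thesis using m k len i False unfolding f
        by (intro bexI[OF _ bs[unfolded f]] exI[of _ i] conjI bexI[OF _ h(2)[of i]]) auto
    next
      case 4
      then show ?thesis using m k len i False unfolding f
        by (intro bexI[OF _ bs[unfolded f]] exI[of _ "k - 1"] conjI bexI[OF _ idh]) auto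
    qed
  next
    case True
    obtain a b ys where x: "as = a # ys @ [b]" "length ys = n" using two_elements len by metis
    have ab: "a \<in> carrier ?A" "b \<in> carrier ?A" using as x by (auto simp: tuples_def)
    note h = R.group_algebra_mult_hom[OF G ab(1)] R.group_algebra_mult_hom[OF G ab(2)]
    have f: "alg_face ?A (Suc n) i as = (b \<otimes>\<^bsub>?A\<^esub> a) # ys" using True x by (simp add: alg_face_wrap)
    consider "k = 0" | k' where "k = Suc k'" "k' < n" | "k = Suc n" using k by (cases k) (auto simp: less_Suc_eq)
    then show ?thesis
    proof cases
      case 1
      then show ?thesis using x True
        by (intro bexI[OF _ bs] exI[of _ 0] conjI bexI[OF _ h(4)]) (auto simp: alg_face_wrap)
    next
      case 2
      then have "alg_face ?A (Suc n) i (as[k := y]) = ((b \<otimes>\<^bsub>?A\<^esub> a) # ys)[Suc k' := y]" for y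
        using x True alg_face_wrap[of "ys[k' := y]" n ?A a b] by (simp add: list_update_append)
      then show ?thesis using 2 f
        by (intro bexI[OF _ bs] exI[of _ "Suc k'"] conjI bexI[OF _ idh]) auto
    next
      case 3
      then have "alg_face ?A (Suc n) i (as[k := y]) = ((b \<otimes>\<^bsub>?A\<^esub> a) # ys)[0 := y \<otimes>\<^bsub>?A\<^esub> a]" for y
        using x True alg_face_wrap[of ys n ?A a y] by (simp add: list_update_append)
      then show ?thesis using 3 f
        by (intro bexI[OF _ bs] exI[of _ 0] conjI bexI[OF _ h(1)]) auto
    qed
  qed
qed

lemma alg_cyc_multilinear:
  "multilinear R (group_algebra R G) (Suc n) (tensor_power R (group_algebra R G) (Suc n))
    (\<lambda>as. pure_tensor R (group_algebra R G) (alg_cyc as))"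
    (is "multilinear R ?A _ _ _")
proof (rule multilinear_substitution[OF R.group_algebra_module])
  fix as assume as: "as \<in> tuples (Suc n) (carrier ?A)"
  show ac: "alg_cyc as \<in> tuples (Suc n) (carrier ?A)" by (rule alg_cyc_tuples[OF as])
  fix k assume k: "k < Suc n"
  have idh: "(\<lambda>x. x) \<in> mod_hom R ?A ?A" by (rule mod_hom_id)
  obtain ys b where x: "as = ys @ [b]" "length ys = n"
    using tuples_length[OF as] by (cases as rule: rev_cases) auto
  have f: "alg_cyc as = b # ys" by (simp add: x)
  show "\<exists>bs\<in>tuples (Suc n) (carrier ?A). \<exists>k'<Suc n. \<exists>L\<in>mod_hom R ?A ?A.
      \<forall>x\<in>carrier ?A. alg_cyc (as[k := x]) = bs[k' := L x]"
  proof (cases "k = n")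
    case True
    then show ?thesis using x f
      by (intro bexI[OF _ ac] exI[of _ 0] conjI bexI[OF _ idh]) auto
  next
    case False
    then show ?thesis using x f k
      by (intro bexI[OF _ ac] exI[of _ "Suc k"] conjI bexI[OF _ idh]) (auto simp: list_update_append)
  qed
qed

lemma tensor_group_basis: "is_basis R (tensor_group R G n)"
  by (rule tensor_based_basis[OF R.group_based_basis])

lemma tensor_group_simps:
  "Space (tensor_group R G n) = tensor_power R (group_algebra R G) n"
  "Idx (tensor_group R G n) = tuples n (carrier G)"
  "Elt (tensor_group R G n) = group_tensor R G"
  by (auto simp: tensor_based_def group_based_def group_tensor_def)

lemma algebra_cyclic_operators:
  shows algebra_Deg: "Deg (algebra_cyclic R (group_algebra R G)) n = Space (tensor_group R G (Suc n))"
    and algebra_operators: "cyclic_operators R (algebra_cyclic R (group_algebra R G))"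
    and algebra_Face: "xs \<in> tuples (Suc (Suc n)) (carrier G) \<Longrightarrow> i \<le> Suc n \<Longrightarrow>
      Face (algebra_cyclic R (group_algebra R G)) (Suc n) i (group_tensor R G xs) =
      group_tensor R G (alg_face G (Suc n) i xs)"
    and algebra_Cyc: "xs \<in> tuples (Suc n) (carrier G) \<Longrightarrow>
      Cyc (algebra_cyclic R (group_algebra R G)) n (group_tensor R G xs) = group_tensor R G (alg_cyc xs)"
proof -
  let ?A = "group_algebra R G" and ?C = "algebra_cyclic R (group_algebra R G)"
  note A = R.group_algebra_module[of G]
  note T = tensor_power_module[OF A]
  show deg: "Deg ?C n = Space (tensor_group R G (Suc n))" for n
    by (simp add: algebra_cyclic_def Let_def tensor_group_simps)
  have face: "Face ?C (Suc n) i = linear_extension R (tensor_power R ?A (Suc (Suc n))) (tensor_power R ?A (Suc n))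
      (tuples (Suc (Suc n)) (carrier ?A)) (pure_tensor R ?A) (pure_tensor R ?A \<circ> alg_face ?A (Suc n) i)" for n i
    by (simp add: algebra_cyclic_def Let_def)
  have cyc: "Cyc ?C n = linear_extension R (tensor_power R ?A (Suc n)) (tensor_power R ?A (Suc n))
      (tuples (Suc n) (carrier ?A)) (pure_tensor R ?A) (pure_tensor R ?A \<circ> alg_cyc)" for n
    by (simp add: algebra_cyclic_def Let_def)
  have fx: "\<exists>h\<in>mod_hom R (tensor_power R ?A (Suc (Suc n))) (tensor_power R ?A (Suc n)).
      \<forall>as\<in>tuples (Suc (Suc n)) (carrier ?A). h (pure_tensor R ?A as) = (pure_tensor R ?A \<circ> alg_face ?A (Suc n) i) as"
    if "i \<le> Suc n" for n i
    using tensor_power_lift[OF A T alg_face_multilinear[OF that]] by simp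
  have cx: "\<exists>h\<in>mod_hom R (tensor_power R ?A (Suc n)) (tensor_power R ?A (Suc n)).
      \<forall>as\<in>tuples (Suc n) (carrier ?A). h (pure_tensor R ?A as) = (pure_tensor R ?A \<circ> alg_cyc) as" for n
    using tensor_power_lift[OF A T alg_cyc_multilinear] by simp
  note fl = linear_extension_props[OF T T pure_tensor_spanning[OF A] fx]
  note cl = linear_extension_props[OF T T pure_tensor_spanning[OF A] cx]
  show "cyclic_operators R ?C"
    unfolding cyclic_operators_def deg tensor_group_simps face cyc
    by (intro conjI allI impI T fl(1) cl(1))
  have gA: "map (gen R) xs \<in> tuples m (carrier ?A)" if "xs \<in> tuples m (carrier G)" for xs m
    using that R.gen_closed[of _ "carrier G"] by (auto simp: tuples_def group_algebra_simps)
  have mg: "gen R x \<otimes>\<^bsub>?A\<^esub> gen R y = gen R (x \<otimes>\<^bsub>G\<^esub> y)" if "x \<in> carrier G" "y \<in> carrier G" for x y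
    by (rule R.group_algebra_mult_gen[OF that])
  have mm: "merge_at ?A j (map (gen R) xs) = map (gen R) (merge_at G j xs)"
    if "set xs \<subseteq> carrier G" "Suc j < length xs" for j xs
  proof -
    have "xs ! j \<in> carrier G" "xs ! Suc j \<in> carrier G" using that nth_mem by fastforce+
    then show ?thesis using that mg by (simp add: merge_at_def take_map drop_map)
  qed
  show "Face ?C (Suc n) i (group_tensor R G xs) = group_tensor R G (alg_face G (Suc n) i xs)"
    if xs: "xs \<in> tuples (Suc (Suc n)) (carrier G)" and i: "i \<le> Suc n"
  proof -
    have "alg_face ?A (Suc n) i (map (gen R) xs) = map (gen R) (alg_face G (Suc n) i xs)"
    proof (cases "i = Suc n")
      case False
      then show ?thesis using i xs mm[of xs i] by (simp add: alg_face_merge tuples_def)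
    next
      case True
      obtain a b ys where x: "xs = a # ys @ [b]" "length ys = n" using two_elements tuples_length[OF xs] by metis
      then have "a \<in> carrier G" "b \<in> carrier G" using xs by (auto simp: tuples_def)
      then show ?thesis using True x alg_face_wrap[of "map (gen R) ys" n ?A "gen R a" "gen R b"]
        by (simp add: alg_face_wrap mg)
    qed
    then have "(pure_tensor R ?A \<circ> alg_face ?A (Suc n) i) (map (gen R) xs) =
        pure_tensor R ?A (map (gen R) (alg_face G (Suc n) i xs))" by simp
    with fl(2)[OF i gA[OF xs]] show ?thesis
      unfolding face group_tensor_def by (rule trans)
  qed
  show "Cyc ?C n (group_tensor R G xs) = group_tensor R G (alg_cyc xs)"
    if xs: "xs \<in> tuples (Suc n) (carrier G)"
  proof -
    have "alg_cyc (map (gen R) xs) = map (gen R) (alg_cyc xs)"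
      using tuples_length[OF xs] by (cases xs rule: rev_cases) auto
    then have "(pure_tensor R ?A \<circ> alg_cyc) (map (gen R) xs) =
        pure_tensor R ?A (map (gen R) (alg_cyc xs))" by simp
    with cl(2)[OF gA[OF xs]] show ?thesis unfolding cyc group_tensor_def by (rule trans)
  qed
qed

lemma hopf_face_tuples:
  assumes "gs \<in> tuples (Suc n) (carrier G)" "i \<le> Suc n"
  shows "hopf_face G (Suc n) i gs \<in> tuples n (carrier G)"
proof -
  consider "i = 0" | "i = Suc n" | j where "i = Suc j" "j < n"
    using assms(2) by (cases i) (auto simp: le_less)
  then show ?thesis
  proof cases
    case 1
    then show ?thesis using assms(1) by (cases gs) (auto simp: hopf_face_def tuples_def)
  next
    case 2
    then show ?thesis using assms(1) by (auto simp: hopf_face_def tuples_def dest: in_set_butlastD)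
  next
    case 3
    have "gs ! j \<otimes>\<^bsub>G\<^esub> gs ! Suc j \<in> carrier G" using 3 tuples_nth[OF assms(1)] by simp
    then show ?thesis
      using 3 assms(1) set_merge_at[of j gs G] length_merge_at[of j gs G] by (auto simp: hopf_face_def tuples_def)
  qed
qed

lemma hopf_cyc_tuples:
  assumes "gs \<in> tuples n (carrier G)" "z \<in> carrier G"
  shows "hopf_cyc G z n gs \<in> tuples n (carrier G)"
  using assms by (auto simp: hopf_cyc_def tuples_def dest: in_set_butlastD)

lemma hopf_cyclic_operators:
  assumes z: "z \<in> carrier G"
  shows hopf_Deg: "Deg (hopf_cyclic R G z) n = Space (tensor_group R G n)"
    and hopf_operators: "cyclic_operators R (hopf_cyclic R G z)"
    and hopf_Face: "xs \<in> tuples (Suc n) (carrier G) \<Longrightarrow> i \<le> Suc n \<Longrightarrow>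
      Face (hopf_cyclic R G z) (Suc n) i (group_tensor R G xs) = group_tensor R G (hopf_face G (Suc n) i xs)"
    and hopf_Cyc: "xs \<in> tuples n (carrier G) \<Longrightarrow>
      Cyc (hopf_cyclic R G z) n (group_tensor R G xs) = group_tensor R G (hopf_cyc G z n xs)"
proof -
  let ?C = "hopf_cyclic R G z"
  show deg: "Deg ?C n = Space (tensor_group R G n)" for n
    by (simp add: hopf_cyclic_def Let_def tensor_group_simps)
  have ext: "linear_extension R (Space (tensor_group R G n)) (Space (tensor_group R G m)) (tuples n (carrier G))
        (group_tensor R G) (group_tensor R G \<circ> \<phi>) \<in> mod_hom R (Space (tensor_group R G n)) (Space (tensor_group R G m)) \<and>
      (\<forall>xs\<in>tuples n (carrier G). linear_extension R (Space (tensor_group R G n)) (Space (tensor_group R G m))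
        (tuples n (carrier G)) (group_tensor R G) (group_tensor R G \<circ> \<phi>) (group_tensor R G xs) = group_tensor R G (\<phi> xs))"
    if \<phi>: "\<And>xs. xs \<in> tuples n (carrier G) \<Longrightarrow> \<phi> xs \<in> tuples m (carrier G)" for n m \<phi>
  proof -
    note M = basis_module[OF tensor_group_basis]
    have sp: "spanning R (Space (tensor_group R G n)) (group_tensor R G ` tuples n (carrier G))"
      using basis_spanning[OF tensor_group_basis, of n] by (simp add: tensor_group_simps)
    have "group_tensor R G \<circ> \<phi> \<in> Idx (tensor_group R G n) \<rightarrow> carrier (Space (tensor_group R G m))"
      using basis_closed[OF tensor_group_basis, of _ m] \<phi> by (auto simp: tensor_group_simps)
    from basis_extend[OF tensor_group_basis M this]
    have "\<exists>h\<in>mod_hom R (Space (tensor_group R G n)) (Space (tensor_group R G m)).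
        \<forall>xs\<in>tuples n (carrier G). h (group_tensor R G xs) = (group_tensor R G \<circ> \<phi>) xs"
      by (simp add: tensor_group_simps)
    from linear_extension_props[OF M M sp this] show ?thesis unfolding comp_apply by blast
  qed
  note ef = ext[of "Suc n" "hopf_face G (Suc n) i" n for n i, OF hopf_face_tuples]
    and ec = ext[of n "hopf_cyc G z n" n for n, OF hopf_cyc_tuples[OF _ z]]
  have face: "Face ?C (Suc n) i = linear_extension R (Space (tensor_group R G (Suc n))) (Space (tensor_group R G n))
      (tuples (Suc n) (carrier G)) (group_tensor R G) (group_tensor R G \<circ> hopf_face G (Suc n) i)" for n i
    by (simp add: hopf_cyclic_def Let_def tensor_group_simps)
  have cyc: "Cyc ?C n = linear_extension R (Space (tensor_group R G n)) (Space (tensor_group R G n))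
      (tuples n (carrier G)) (group_tensor R G) (group_tensor R G \<circ> hopf_cyc G z n)" for n
    by (simp add: hopf_cyclic_def Let_def tensor_group_simps)
  show "cyclic_operators R ?C"
    unfolding cyclic_operators_def deg face cyc
    by (intro conjI allI impI basis_module[OF tensor_group_basis] ef[THEN conjunct1] ec[THEN conjunct1])
  show "Face ?C (Suc n) i (group_tensor R G xs) = group_tensor R G (hopf_face G (Suc n) i xs)"
    if "xs \<in> tuples (Suc n) (carrier G)" "i \<le> Suc n"
    unfolding face using ef[THEN conjunct2] that by blast
  show "Cyc ?C n (group_tensor R G xs) = group_tensor R G (hopf_cyc G z n xs)"
    if "xs \<in> tuples n (carrier G)"
    unfolding cyc using ec[THEN conjunct2] that by blast
qed

end


section \<open>Decomposition of the cyclic homology of a group algebra\<close>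

context conj_reps
begin

lemma rep_class:
  assumes "c \<in> conj_classes G"
  shows "rep c \<in> carrier G" "conj_class (rep c) = c" "base (rep c) = rep c"
    "rep c \<in> carrier (centralizer G (rep c))"
proof -
  obtain h where h: "h \<in> carrier G" "c = conj_class h" using assms conj_classes_eq by auto
  show 1: "rep c \<in> carrier G" using rep[OF assms] h conj_class_closed by blast
  show 2: "conj_class (rep c) = c" using conj_class_eq[OF h(1)] rep[OF assms] h(2) by simp
  show "base (rep c) = rep c" by (simp add: base_def 2)
  show "rep c \<in> carrier (centralizer G (rep c))" using 1 by (simp add: centralizer_def)
qed

lemma tl_tuples: "xs \<in> tuples (Suc n) A \<Longrightarrow> tl xs \<in> tuples n A"
  by (cases xs) (auto simp: tuples_def)

lemma prism_chain:
  assumes xs: "xs \<in> tuples (Suc n) (carrier G)"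
  shows "(\<Sum>j\<le>n. \<Sum>i\<le>Suc n. signed (i + j) (frag_of (alg_face G (Suc n) i (prism j xs)))) +
     (\<Sum>i\<le>n. \<Sum>j<n. signed (i + j) (frag_of (prism j (alg_face G n i xs)))) =
    frag_of xs - frag_of (retract xs)"
  using alternating_prism_sum[of n "\<lambda>i j. frag_of (alg_face G (Suc n) i (prism j xs))"
      "\<lambda>i j. frag_of (prism j (alg_face G n i xs))"]
  by (simp add: prism_lower[OF xs] prism_upper[OF xs] prism_diag[OF xs] prism_first[OF xs] prism_last[OF xs]
      del: sum.atMost_Suc sum.lessThan_Suc)

context
  fixes R :: "('r, 'k) ring_scheme"
  assumes R: "cring R"
begin

interpretation R: cring R by (fact R)

text \<open>
  Degree \<open>n\<close> of the two kinds of cyclic modules, with their bases of tuples.  A tuple has \<open>n + 1\<close> entries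
  in \<open>tensG n\<close> and \<open>n\<close> entries in \<open>tensL c n\<close>.
\<close>

abbreviation (input) "tensG n \<equiv> tensor_group R G (Suc n)"
abbreviation (input) "tensL c n \<equiv> tensor_group R (centralizer G (rep c)) n"
abbreviation (input) "cycG \<equiv> algebra_cyclic R (group_algebra R G)"
abbreviation (input) "cycL c \<equiv> hopf_cyclic R (centralizer G (rep c)) (rep c)"

lemma linearized: "linearized_cyclic_set (\<lambda>n. tuples (Suc n) (carrier G)) (alg_face G) (\<lambda>n. alg_cyc) R (\<lambda>n. tensG n) cycG"
  by (intro linearized_cyclic_set.intro linearized_cyclic_set_axioms.intro group_cyclic_set)
    (simp_all add: tensor_group_basis[OF R is_group] tensor_group_simps[OF R is_group] algebra_Deg[OF R is_group]
      algebra_operators[OF R is_group] algebra_Face[OF R is_group] algebra_Cyc[OF R is_group])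

interpretation X: linearized_cyclic_set "\<lambda>n. tuples (Suc n) (carrier G)" "alg_face G" "\<lambda>n. alg_cyc" R
  "\<lambda>n. tensG n" cycG
  by (rule linearized)

lemmas tensG_simps = tensor_group_simps[OF R is_group]

lemma Y_basis: "c \<in> conj_classes G \<Longrightarrow> is_basis R (tensL c n)"
  using tensor_group_basis[OF R centralizer_group] rep_class by blast

lemma tensL_simps:
  assumes "c \<in> conj_classes G"
  shows "Idx (tensL c n) = tuples n (carrier (centralizer G (rep c)))"
    and "Elt (tensL c n) = group_tensor R (centralizer G (rep c))"
  using tensor_group_simps[OF R centralizer_group] rep_class[OF assms] by auto

context
  fixes c assumes c: "c \<in> conj_classes G"
begin

lemmas zc = rep_class(1)[OF c]
lemmas L = centralizer_group[OF zc]
lemmas zL = rep_class(4)[OF c]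

lemma represents_hopf_Face:
  "i \<le> Suc n \<Longrightarrow> represents R (tensL c (Suc n)) (tensL c n) (Face (cycL c) (Suc n) i)
     (\<lambda>ys. frag_of (hopf_face (centralizer G (rep c)) (Suc n) i ys))"
  using Face_hom[OF hopf_operators[OF R L zL], of i n] hopf_Face[OF R L zL] hopf_face_tuples[OF R L]
  by (intro represents_basis_map Y_basis c) (simp_all add: tensL_simps[OF c] hopf_Deg[OF R L zL])

lemma represents_hopf_Cyc:
  "represents R (tensL c n) (tensL c n) (Cyc (cycL c) n)
     (\<lambda>ys. frag_of (hopf_cyc (centralizer G (rep c)) (rep c) n ys))"
  using Cyc_hom[OF hopf_operators[OF R L zL], of n] hopf_Cyc[OF R L zL] hopf_cyc_tuples[OF R L _ zL]
  by (intro represents_basis_map Y_basis c) (simp_all add: tensL_simps[OF c] hopf_Deg[OF R L zL])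

end

text \<open>
  The part of a tuple in the piece of the class \<open>c\<close>, straightened and without its redundant first entry.
\<close>

definition component_chain :: "'a set \<Rightarrow> 'a list \<Rightarrow> ('a list \<Rightarrow>\<^sub>0 int)"
  where "component_chain c xs = (if conj_class (lprod xs) = c then frag_of (tl (retract xs)) else 0)"

text \<open>
  Linear maps with prescribed matrices.  The matrix determines the map on the carrier, so that it does
  not matter which map is chosen.
\<close>

definition prism_map :: "nat \<Rightarrow> (('a \<Rightarrow> 'r) list \<Rightarrow> 'r) set \<Rightarrow> (('a \<Rightarrow> 'r) list \<Rightarrow> 'r) set"
  where "prism_map n = (SOME \<phi>. represents R (tensG n) (tensG (Suc n)) \<phi> (\<lambda>xs. \<Sum>j\<le>n. signed j (frag_of (prism j xs))))"

definition unit_map :: "nat \<Rightarrow> (('a \<Rightarrow> 'r) list \<Rightarrow> 'r) set \<Rightarrow> (('a \<Rightarrow> 'r) list \<Rightarrow> 'r) set"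
  where "unit_map n = (SOME \<phi>. represents R (tensG n) (tensG (Suc n)) \<phi> (\<lambda>xs. frag_of (\<one> # xs)))"

definition retract_map :: "nat \<Rightarrow> (('a \<Rightarrow> 'r) list \<Rightarrow> 'r) set \<Rightarrow> (('a \<Rightarrow> 'r) list \<Rightarrow> 'r) set"
  where "retract_map n = (SOME \<phi>. represents R (tensG n) (tensG n) \<phi> (\<lambda>xs. frag_of (retract xs)))"

definition component_map :: "'a set \<Rightarrow> nat \<Rightarrow> (('a \<Rightarrow> 'r) list \<Rightarrow> 'r) set \<Rightarrow> (('a \<Rightarrow> 'r) list \<Rightarrow> 'r) set"
  where "component_map c n = (SOME \<phi>. represents R (tensG n) (tensL c n) \<phi> (component_chain c))"

definition include_map :: "'a set \<Rightarrow> nat \<Rightarrow> (('a \<Rightarrow> 'r) list \<Rightarrow> 'r) set \<Rightarrow> (('a \<Rightarrow> 'r) list \<Rightarrow> 'r) set"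
  where "include_map c n = (SOME \<phi>. represents R (tensL c n) (tensG n) \<phi> (\<lambda>ys. frag_of (complete (rep c) ys)))"

lemma represents_prism:
  "represents R (tensG n) (tensG (Suc n)) (prism_map n) (\<lambda>xs. \<Sum>j\<le>n. signed j (frag_of (prism j xs)))"
  unfolding prism_map_def
  by (rule represents_some[OF X.basis X.basis])
    (auto simp: tensG_simps keys_signed intro!: keys_sum_subset prism_tuples)

lemma represents_unit: "represents R (tensG n) (tensG (Suc n)) (unit_map n) (\<lambda>xs. frag_of (\<one> # xs))"
  unfolding unit_map_def
  by (rule represents_some[OF X.basis X.basis]) (auto simp: tensG_simps tuples_def)

lemma represents_retract: "represents R (tensG n) (tensG n) (retract_map n) (\<lambda>xs. frag_of (retract xs))"
  unfolding retract_map_def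
  by (rule represents_some[OF X.basis X.basis]) (simp add: tensG_simps retract_tuples)

lemma retract_tl_tuples:
  assumes "xs \<in> tuples (Suc n) (carrier G)"
  shows "tl (retract xs) \<in> tuples n (carrier (centralizer G (rep (conj_class (lprod xs)))))"
  using tl_tuples[OF retract_centralizer[OF assms]] by (simp add: base_def)

lemma represents_component:
  "c \<in> conj_classes G \<Longrightarrow> represents R (tensG n) (tensL c n) (component_map c n) (component_chain c)"
  unfolding component_map_def
  by (rule represents_some[OF X.basis Y_basis])
    (auto simp: tensG_simps tensL_simps component_chain_def retract_tl_tuples)

lemma complete_tuples_G:
  assumes "c \<in> conj_classes G" "ys \<in> tuples n (carrier (centralizer G (rep c)))"
  shows "complete (rep c) ys \<in> tuples (Suc n) (carrier G)"
  using complete_tuples(1)[OF rep_class(1)[OF assms(1)] assms(2)] centralizer_subset by (auto simp: tuples_def)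

lemma represents_include:
  "c \<in> conj_classes G \<Longrightarrow> represents R (tensL c n) (tensG n) (include_map c n) (\<lambda>ys. frag_of (complete (rep c) ys))"
  unfolding include_map_def
  by (rule represents_some[OF Y_basis X.basis])
    (auto simp: tensG_simps tensL_simps complete_tuples_G)

lemma retract_cyclic_map: "cyclic_map R cycG cycG retract_map"
  unfolding cyclic_map_def
proof (intro conjI allI impI ballI)
  show "retract_map n \<in> mod_hom R (Deg cycG n) (Deg cycG n)" for n
    using represents_hom[OF represents_retract] by (simp add: X.Deg)
  fix n i m assume i: "i \<le> Suc n" and "m \<in> carrier (Deg cycG (Suc n))"
  then have m: "m \<in> carrier (Space (tensG (Suc n)))" by (simp add: X.Deg)
  show "retract_map n (Face cycG (Suc n) i m) = Face cycG (Suc n) i (retract_map (Suc n) m)"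
    by (rule represents_eq[OF represents_comp[OF X.represents_Face[OF i] represents_retract]
          represents_comp[OF represents_retract X.represents_Face[OF i]] _ m])
      (simp add: tensG_simps retract_alg_face i)
next
  fix n m assume "m \<in> carrier (Deg cycG n)"
  then have m: "m \<in> carrier (Space (tensG n))" by (simp add: X.Deg)
  have "retract (alg_cyc xs) = alg_cyc (retract xs)" if "xs \<in> tuples (Suc n) (carrier G)" for xs
    using that by (intro retract_alg_cyc) (auto simp: tuples_def)
  then show "retract_map n (Cyc cycG n m) = Cyc cycG n (retract_map n m)"
    by (intro represents_eq[OF represents_comp[OF X.represents_Cyc represents_retract]
          represents_comp[OF represents_retract X.represents_Cyc] _ m])
      (simp add: tensG_simps)
qed

lemma component_chain_face:
  assumes "xs \<in> tuples (Suc (Suc n)) (carrier G)" "i \<le> Suc n"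
  shows "component_chain c (alg_face G (Suc n) i xs) =
    frag_extend (\<lambda>ys. frag_of (hopf_face (centralizer G (rep c)) (Suc n) i ys)) (component_chain c xs)"
  using tl_alg_face[OF tuples_length[OF retract_tuples[OF assms(1)]] assms(2)] assms
  by (simp add: component_chain_def conj_class_alg_face retract_alg_face)

lemma component_chain_cyc:
  assumes c: "c \<in> conj_classes G" and xs: "xs \<in> tuples (Suc n) (carrier G)"
  shows "component_chain c (alg_cyc xs) =
    frag_extend (\<lambda>ys. frag_of (hopf_cyc (centralizer G (rep c)) (rep c) n ys)) (component_chain c xs)"
proof -
  have x: "set xs \<subseteq> carrier G" "xs \<noteq> []" using xs by (auto simp: tuples_def)
  show ?thesis
  proof (cases "conj_class (lprod xs) = c")
    case True
    then have b: "base (lprod xs) = rep c" by (simp add: base_def)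
    have "tl (alg_cyc (retract xs)) = hopf_cyc (centralizer G (rep c)) (rep c) n (tl (retract xs))"
      using retract_centralizer[OF xs] lprod_retract[OF x(1)] b by (intro tl_alg_cyc rep_class(1)[OF c]) simp_all
    then show ?thesis using True by (simp add: component_chain_def conj_class_alg_cyc[OF x] retract_alg_cyc[OF x])
  qed (simp add: component_chain_def conj_class_alg_cyc[OF x])
qed

lemma restrict_cyclic_map:
  assumes c: "c \<in> conj_classes G"
  shows "cyclic_map R cycG (cycL c) (component_map c)"
  unfolding cyclic_map_def
proof (intro conjI allI impI ballI)
  note L = centralizer_group[OF rep_class(1)[OF c]]
  note Y = Y_basis[OF c]
  note hd = hopf_Deg[OF R L rep_class(4)[OF c]]
  show "component_map c n \<in> mod_hom R (Deg cycG n) (Deg (cycL c) n)" for n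
    using represents_hom[OF represents_component[OF c]] by (simp add: X.Deg hd)
  fix n i m assume i: "i \<le> Suc n" and "m \<in> carrier (Deg cycG (Suc n))"
  then have m: "m \<in> carrier (Space (tensG (Suc n)))" by (simp add: X.Deg)
  show "component_map c n (Face cycG (Suc n) i m) = Face (cycL c) (Suc n) i (component_map c (Suc n) m)"
    by (rule represents_eq[OF represents_comp[OF X.represents_Face[OF i] represents_component[OF c]]
          represents_comp[OF represents_component[OF c] represents_hopf_Face[OF c i]] _ m])
      (simp add: tensG_simps component_chain_face i)
next
  note L = centralizer_group[OF rep_class(1)[OF c]]
  note Y = Y_basis[OF c]
  fix n m assume "m \<in> carrier (Deg cycG n)"
  then have m: "m \<in> carrier (Space (tensG n))" by (simp add: X.Deg)
  show "component_map c n (Cyc cycG n m) = Cyc (cycL c) n (component_map c n m)"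
    by (rule represents_eq[OF represents_comp[OF X.represents_Cyc represents_component[OF c]]
          represents_comp[OF represents_component[OF c] represents_hopf_Cyc[OF c]] _ m])
      (simp add: tensG_simps component_chain_cyc[OF c])
qed

lemma include_cyclic_map:
  assumes c: "c \<in> conj_classes G"
  shows "cyclic_map R (cycL c) cycG (include_map c)"
  unfolding cyclic_map_def
proof (intro conjI allI impI ballI)
  note zc = rep_class(1)[OF c]
  note L = centralizer_group[OF zc]
  note Y = Y_basis[OF c]
  note hd = hopf_Deg[OF R L rep_class(4)[OF c]]
  show "include_map c n \<in> mod_hom R (Deg (cycL c) n) (Deg cycG n)" for n
    using represents_hom[OF represents_include[OF c]] by (simp add: X.Deg hd)
  have f: "complete (rep c) (hopf_face (centralizer G (rep c)) (Suc n) i ys) =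
      alg_face G (Suc n) i (complete (rep c) ys)"
    if ys: "ys \<in> tuples (Suc n) (carrier (centralizer G (rep c)))" and i: "i \<le> Suc n" for n i ys
  proof -
    note t = complete_tuples[OF zc ys]
    have "tl (alg_face G (Suc n) i (complete (rep c) ys)) = hopf_face (centralizer G (rep c)) (Suc n) i ys"
      using tl_alg_face[OF tuples_length[OF t(1)] i] by (simp add: complete_def)
    with complete_tl[OF zc alg_face_centralizer[OF zc t i]] show ?thesis by simp
  qed
  have t: "complete (rep c) (hopf_cyc (centralizer G (rep c)) (rep c) n ys) = alg_cyc (complete (rep c) ys)"
    if ys: "ys \<in> tuples n (carrier (centralizer G (rep c)))" for n ys
  proof -
    note t = complete_tuples[OF zc ys]
    have "tl (alg_cyc (complete (rep c) ys)) = hopf_cyc (centralizer G (rep c)) (rep c) n ys"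
      using tl_alg_cyc[OF zc t] by (simp add: complete_def)
    with complete_tl[OF zc alg_cyc_tuples[OF t(1)] lprod_alg_cyc_centralizer[OF zc t]] show ?thesis by simp
  qed
  show "include_map c n (Face (cycL c) (Suc n) i m) = Face cycG (Suc n) i (include_map c (Suc n) m)"
    if i: "i \<le> Suc n" and m: "m \<in> carrier (Deg (cycL c) (Suc n))" for n i m
    by (rule represents_eq[OF represents_comp[OF represents_hopf_Face[OF c i] represents_include[OF c]]
          represents_comp[OF represents_include[OF c] X.represents_Face[OF i]] _ m[unfolded hd]])
      (simp add: tensL_simps[OF c] f i)
  show "include_map c n (Cyc (cycL c) n m) = Cyc cycG n (include_map c n m)"
    if m: "m \<in> carrier (Deg (cycL c) n)" for n m
    by (rule represents_eq[OF represents_comp[OF represents_hopf_Cyc[OF c] represents_include[OF c]]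
          represents_comp[OF represents_include[OF c] X.represents_Cyc] _ m[unfolded hd]])
      (simp add: tensL_simps[OF c] t)
qed

lemma component_chain_complete:
  assumes c: "c \<in> conj_classes G" and ys: "ys \<in> tuples n (carrier (centralizer G (rep c)))"
  shows "component_chain c' (complete (rep c) ys) = (if c' = c then frag_of ys else 0)"
proof -
  note t = complete_tuples[OF rep_class(1)[OF c] ys]
  have "retract (complete (rep c) ys) = complete (rep c) ys"
    using t rep_class[OF c] by (intro retract_centralizer_id[of "rep c"]) (auto simp: tuples_def)
  then show ?thesis using t rep_class(2)[OF c] by (auto simp: component_chain_def complete_def)
qed

lemma restrict_include:
  assumes c: "c \<in> conj_classes G" and m: "m \<in> carrier (Space (tensL c n))"
  shows "component_map c n (include_map c n m) = m"
  by (rule represents_eq[OF represents_comp[OF represents_include[OF c] represents_component[OF c]]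
        represents_id[OF Y_basis[OF c]] _ m])
    (simp add: tensL_simps[OF c] component_chain_complete[OF c])

lemma restrict_include_other:
  assumes c: "c \<in> conj_classes G" "c' \<in> conj_classes G" "c' \<noteq> c" and m: "m \<in> carrier (Space (tensL c n))"
  shows "component_map c' n (include_map c n m) = \<zero>\<^bsub>Space (tensL c' n)\<^esub>"
  by (rule represents_eq[OF represents_comp[OF represents_include[OF c(1)] represents_component[OF c(2)]]
        represents_const_zero[OF Y_basis[OF c(1)] Y_basis[OF c(2)]] _ m])
    (simp add: tensL_simps[OF c(1)] component_chain_complete[OF c(1)] c(3))

lemma restrict_retract:
  assumes c: "c \<in> conj_classes G" and m: "m \<in> carrier (Space (tensG n))"
  shows "component_map c n (retract_map n m) = component_map c n m"
proof (rule represents_eq[OF represents_comp[OF represents_retract represents_component[OF c]]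
        represents_component[OF c] _ m])
  fix xs assume "xs \<in> Idx (tensG n)"
  then have xs: "xs \<in> tuples (Suc n) (carrier G)" by (simp add: tensG_simps)
  then have s: "set xs \<subseteq> carrier G" by (simp add: tuples_def)
  have "conj_class (lprod (retract xs)) = conj_class (lprod xs)"
    using conj_class_eq[OF _ base_conj] s by (simp add: lprod_retract)
  then show "frag_extend (component_chain c) (frag_of (retract xs)) = component_chain c xs"
    by (simp add: component_chain_def retract_retract[OF xs])
qed

text \<open>
  Summing over all larger finite sets of classes, instead of just over the classes that occur, makes the
  statement stable under addition, so that it can be proved on basis elements.  It says that the
  retraction is the sum of the projections onto the pieces.
\<close>

lemma component_locally_finite:
  assumes m: "m \<in> carrier (Space (tensG n))"
  shows "\<exists>F. finite F \<and> F \<subseteq> conj_classes G \<and>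
    (\<forall>c\<in>conj_classes G - F. component_map c n m = \<zero>\<^bsub>Space (tensL c n)\<^esub>) \<and>
    (\<forall>F'. finite F' \<longrightarrow> F \<subseteq> F' \<longrightarrow> F' \<subseteq> conj_classes G \<longrightarrow>
      retract_map n m = finsum (Space (tensG n)) (\<lambda>c. include_map c n (component_map c n m)) F')"
    (is "\<exists>F. ?P F m")
proof -
  interpret M: module R "Space (tensG n)" by (rule basis_module[OF X.basis])
  let ?S = "\<lambda>F m. finsum (Space (tensG n)) (\<lambda>c. include_map c n (component_map c n m)) F"
  note rh = represents_hom[OF represents_retract, of n]
  have ch: "component_map c n \<in> mod_hom R (Space (tensG n)) (Space (tensL c n))" if "c \<in> conj_classes G" for c
    by (rule represents_hom[OF represents_component[OF that]])
  have Sh: "?S F \<in> mod_hom R (Space (tensG n)) (Space (tensG n))" if "finite F" "F \<subseteq> conj_classes G" for F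
    using that represents_hom[OF represents_comp[OF represents_component represents_include]]
    by (intro mod_hom_sum[OF M.module_axioms]) auto
  have YMod: "module R (Space (tensL c n))" if "c \<in> conj_classes G" for c
    by (rule basis_module[OF Y_basis[OF that]])
  show ?thesis
  proof (rule basis_induct[OF X.basis m])
    show "\<exists>F. ?P F \<zero>\<^bsub>Space (tensG n)\<^esub>"
      using represents_zero[OF represents_retract] mod_hom_zero[OF M.module_axioms M.module_axioms Sh]
        represents_zero[OF represents_component] by (intro exI[of _ "{}"]) simp
  next
    fix a b assume a: "a \<in> carrier (Space (tensG n))" and b: "b \<in> carrier (Space (tensG n))"
      and "\<exists>F. ?P F a" "\<exists>F. ?P F b"
    then obtain F F' where F: "?P F a" and F': "?P F' b" by (elim exE) (rule that)
    have "component_map c n (a \<oplus>\<^bsub>Space (tensG n)\<^esub> b) = \<zero>\<^bsub>Space (tensL c n)\<^esub>"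
      if "c \<in> conj_classes G - (F \<union> F')" for c
    proof -
      interpret N: module R "Space (tensL c n)" using that by (intro YMod) auto
      show ?thesis using mod_homD(2)[OF ch a b, of c] F F' that by auto
    qed
    moreover have "retract_map n (a \<oplus>\<^bsub>Space (tensG n)\<^esub> b) = ?S E (a \<oplus>\<^bsub>Space (tensG n)\<^esub> b)"
      if "finite E" "F \<union> F' \<subseteq> E" "E \<subseteq> conj_classes G" for E
      using F F' that mod_homD(2)[OF rh a b] mod_homD(2)[OF Sh[OF that(1,3)] a b] by auto
    ultimately show "\<exists>F. ?P F (a \<oplus>\<^bsub>Space (tensG n)\<^esub> b)"
      using F F' by (intro exI[of _ "F \<union> F'"]) auto
  next
    fix r a assume r: "r \<in> carrier R" and a: "a \<in> carrier (Space (tensG n))" and "\<exists>F. ?P F a"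
    then obtain F where F: "?P F a" by blast
    have "component_map c n (r \<odot>\<^bsub>Space (tensG n)\<^esub> a) = \<zero>\<^bsub>Space (tensL c n)\<^esub>"
      if "c \<in> conj_classes G - F" for c
      using mod_homD(3)[OF ch r a, of c] F that module.smult_r_null[OF YMod r, of c] by auto
    moreover have "retract_map n (r \<odot>\<^bsub>Space (tensG n)\<^esub> a) = ?S E (r \<odot>\<^bsub>Space (tensG n)\<^esub> a)"
      if "finite E" "F \<subseteq> E" "E \<subseteq> conj_classes G" for E
      using F that mod_homD(3)[OF rh r a] mod_homD(3)[OF Sh[OF that(1,3)] r a] by auto
    ultimately show "\<exists>F. ?P F (r \<odot>\<^bsub>Space (tensG n)\<^esub> a)" using F by (intro exI[of _ F]) auto
  next
    fix xs assume xI: "xs \<in> Idx (tensG n)"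
    then have xs: "xs \<in> tuples (Suc n) (carrier G)" by (simp add: tensG_simps)
    then have s: "set xs \<subseteq> carrier G" by (simp add: tuples_def)
    let ?c = "conj_class (lprod xs)" and ?e = "Elt (tensG n) xs"
    have c: "?c \<in> conj_classes G" using s by (simp add: conj_classes_eq)
    have jr: "include_map c n (component_map c n ?e) = (if c = ?c then retract_map n ?e else \<zero>\<^bsub>Space (tensG n)\<^esub>)"
      if cc: "c \<in> conj_classes G" for c
    proof -
      have "complete (rep ?c) (tl (retract xs)) = retract xs"
        using retract_centralizer[OF xs] lprod_retract[OF s]
        by (intro complete_tl[OF rep_class(1)[OF c]]) (simp_all add: base_def)
      then show ?thesis
        using represents_elt[OF represents_comp[OF represents_component[OF cc] represents_include[OF cc]] xI]
          represents_elt[OF represents_retract xI] realize_zero[OF X.basis]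
        by (simp add: component_chain_def)
    qed
    have "component_map c n ?e = \<zero>\<^bsub>Space (tensL c n)\<^esub>" if "c \<in> conj_classes G - {?c}" for c
      using represents_elt[OF represents_component[of c] xI] that realize_zero[OF Y_basis]
      by (auto simp: component_chain_def)
    moreover have "retract_map n ?e = ?S E ?e"
      if E: "finite E" "{?c} \<subseteq> E" "E \<subseteq> conj_classes G" for E
    proof -
      have re: "retract_map n ?e \<in> carrier (Space (tensG n))"
        by (rule represents_closed[OF represents_retract basis_closed[OF X.basis xI]])
      have "?S E ?e = finsum (Space (tensG n)) (\<lambda>c. if c = ?c then retract_map n ?e else \<zero>\<^bsub>Space (tensG n)\<^esub>) E"
        using jr[OF subsetD[OF E(3)]] re by (intro M.M.finsum_cong') auto
      then show ?thesis using M.M.finsum_delta[OF E(1) re, of ?c] E(2) by simp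
    qed
    ultimately show "\<exists>F. ?P F ?e" using c by (intro exI[of _ "{?c}"]) auto
  qed
qed

lemma prism_homotopy:
  assumes m: "m \<in> carrier (Space (tensG n))" and cyc: "\<And>k. n = Suc k \<Longrightarrow> bd R cycG n m = \<zero>\<^bsub>Space (tensG k)\<^esub>"
  shows "bd R cycG (Suc n) (prism_map n m) = m \<ominus>\<^bsub>Space (tensG n)\<^esub> retract_map n m"
proof -
  interpret M: module R "Space (tensG l)" for l by (rule basis_module[OF X.basis])
  let ?FH = "\<lambda>n xs. \<Sum>j\<le>n. signed j (frag_of (prism j xs))"
  have lhs: "represents R (tensG n) (tensG n) (\<lambda>m. bd R cycG (Suc n) (prism_map n m))
      (\<lambda>xs. frag_extend (X.chain_b (Suc n)) (?FH n xs))"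
    by (rule represents_comp[OF represents_prism X.represents_bd])
  have rhs: "represents R (tensG n) (tensG n) (\<lambda>m. m \<ominus>\<^bsub>Space (tensG n)\<^esub> retract_map n m)
      (\<lambda>xs. frag_of xs - frag_of (retract xs))"
    by (rule represents_diff[OF represents_id[OF X.basis] represents_retract])
  have bH: "frag_extend (X.chain_b (Suc n)) (?FH n xs) =
      (\<Sum>j\<le>n. \<Sum>i\<le>Suc n. signed (i + j) (frag_of (alg_face G (Suc n) i (prism j xs))))" for xs
    unfolding X.frag_extend_signed_sum[OF finite_atMost] X.chain_b_def signed_sum signed_signed
    by (simp add: add.commute del: sum.atMost_Suc)
  show ?thesis
  proof (cases n)
    case 0
    show ?thesis
    proof (rule represents_eq[OF lhs rhs _ m])
      fix xs assume "xs \<in> Idx (tensG n)"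
      then have xs: "xs \<in> tuples (Suc n) (carrier G)" by (simp add: tensG_simps)
      show "frag_extend (X.chain_b (Suc n)) (?FH n xs) = frag_of xs - frag_of (retract xs)"
        unfolding bH using prism_chain[OF xs] 0 by simp
    qed
  next
    case (Suc k)
    have hb: "represents R (tensG n) (tensG n) (\<lambda>m. prism_map k (bd R cycG n m)) (\<lambda>xs. frag_extend (?FH k) (X.chain_b n xs))"
      unfolding Suc by (rule represents_comp[OF X.represents_bd represents_prism])
    have "bd R cycG (Suc n) (prism_map n m) \<oplus>\<^bsub>Space (tensG n)\<^esub> prism_map k (bd R cycG n m) =
        m \<ominus>\<^bsub>Space (tensG n)\<^esub> retract_map n m"
    proof (rule represents_eq[OF represents_add[OF lhs hb] rhs])
      fix xs assume "xs \<in> Idx (tensG n)"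
      then have xs: "xs \<in> tuples (Suc n) (carrier G)" by (simp add: tensG_simps)
      have "frag_extend (?FH k) (X.chain_b n xs) =
          (\<Sum>i\<le>n. \<Sum>j<n. signed (i + j) (frag_of (prism j (alg_face G n i xs))))"
        unfolding X.chain_b_def X.frag_extend_signed_sum[OF finite_atMost] signed_sum signed_signed Suc lessThan_Suc_atMost ..
      then show "frag_extend (X.chain_b (Suc n)) (?FH n xs) + frag_extend (?FH k) (X.chain_b n xs) =
          frag_of xs - frag_of (retract xs)"
        unfolding bH using prism_chain[OF xs] by simp
    qed (rule m)
    moreover have "prism_map k (bd R cycG n m) = \<zero>\<^bsub>Space (tensG n)\<^esub>"
      using cyc[OF Suc] represents_zero[OF represents_prism[of k]]
      by (simp add: Suc)
    moreover have "bd R cycG (Suc n) (prism_map n m) \<in> carrier (Space (tensG n))"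
      by (rule represents_closed[OF lhs m])
    ultimately show ?thesis by simp
  qed
qed

lemma unit_homotopy:
  assumes m: "m \<in> carrier (Space (tensG n))" and cyc: "\<And>k. n = Suc k \<Longrightarrow> bd' R cycG n m = \<zero>\<^bsub>Space (tensG k)\<^esub>"
  shows "bd' R cycG (Suc n) (unit_map n m) = m"
proof -
  interpret M: module R "Space (tensG l)" for l by (rule basis_module[OF X.basis])
  have lhs: "represents R (tensG n) (tensG n) (\<lambda>m. bd' R cycG (Suc n) (unit_map n m))
      (\<lambda>xs. frag_extend (X.chain_b' (Suc n)) (frag_of (\<one> # xs)))"
    by (rule represents_comp[OF represents_unit X.represents_bd'])
  have bs: "X.chain_b' (Suc n) (\<one> # xs) + (\<Sum>i<n. signed i (frag_of (\<one> # alg_face G n i xs))) = frag_of xs"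
    if xs: "xs \<in> tuples (Suc n) (carrier G)" for xs
  proof -
    obtain y ys where y: "xs = y # ys" using xs by (cases xs) (auto simp: tuples_def)
    have "y \<in> carrier G" using xs y by (simp add: tuples_def)
    then have 0: "alg_face G (Suc n) 0 (\<one> # xs) = xs" by (simp add: alg_face_merge y)
    have "X.chain_b' (Suc n) (\<one> # xs) = frag_of xs + (\<Sum>i<n. signed (Suc i) (frag_of (alg_face G (Suc n) (Suc i) (\<one> # xs))))"
      unfolding X.chain_b'_def sum.lessThan_Suc_shift 0 by simp
    also have "(\<Sum>i<n. signed (Suc i) (frag_of (alg_face G (Suc n) (Suc i) (\<one> # xs)))) =
        - (\<Sum>i<n. signed i (frag_of (\<one> # alg_face G n i xs)))"
      unfolding sum_negf[symmetric] by (rule sum.cong) (simp_all add: alg_face_merge signed_Suc)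
    finally show ?thesis by simp
  qed
  show ?thesis
  proof (cases n)
    case 0
    show ?thesis
    proof (rule represents_eq[OF lhs represents_id[OF X.basis]])
      fix xs assume "xs \<in> Idx (tensG n)"
      then have xs: "xs \<in> tuples (Suc n) (carrier G)" by (simp add: tensG_simps)
      show "frag_extend (X.chain_b' (Suc n)) (frag_of (\<one> # xs)) = frag_of xs"
        using bs[OF xs] 0 by simp
    qed (rule m)
  next
    case (Suc k)
    have sb: "represents R (tensG n) (tensG n) (\<lambda>m. unit_map k (bd' R cycG n m))
        (\<lambda>xs. frag_extend (\<lambda>xs. frag_of (\<one> # xs)) (X.chain_b' n xs))"
      unfolding Suc by (rule represents_comp[OF X.represents_bd' represents_unit])
    have "bd' R cycG (Suc n) (unit_map n m) \<oplus>\<^bsub>Space (tensG n)\<^esub> unit_map k (bd' R cycG n m) = m"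
    proof (rule represents_eq[OF represents_add[OF lhs sb] represents_id[OF X.basis]])
      fix xs assume "xs \<in> Idx (tensG n)"
      then have xs: "xs \<in> tuples (Suc n) (carrier G)" by (simp add: tensG_simps)
      have "frag_extend (\<lambda>xs. frag_of (\<one> # xs)) (X.chain_b' n xs) =
          (\<Sum>i<n. signed i (frag_of (\<one> # alg_face G n i xs)))"
        unfolding X.chain_b'_def X.frag_extend_signed_sum[OF finite_lessThan] ..
      then show "frag_extend (X.chain_b' (Suc n)) (frag_of (\<one> # xs)) +
          frag_extend (\<lambda>xs. frag_of (\<one> # xs)) (X.chain_b' n xs) = frag_of xs"
        using bs[OF xs] by simp
    qed (rule m)
    moreover have "unit_map k (bd' R cycG n m) = \<zero>\<^bsub>Space (tensG n)\<^esub>"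
      using cyc[OF Suc] represents_zero[OF represents_unit[of k]]
      by (simp add: Suc)
    moreover have "bd' R cycG (Suc n) (unit_map n m) \<in> carrier (Space (tensG n))"
      by (rule represents_closed[OF lhs m])
    ultimately show ?thesis by simp
  qed
qed

text \<open>
  On cycles whose retraction vanishes the two homotopies provide primitives for \<open>b\<close> and for \<open>b'\<close>; in odd
  columns the sign of \<open>-b'\<close> moves to the primitive.
\<close>

lemma column_contraction:
  assumes m: "m \<in> carrier (Space (tensG q))" and ret: "retract_map q m = \<zero>\<^bsub>Space (tensG q)\<^esub>"
    and cyc: "\<And>k. q = Suc k \<Longrightarrow> vert R cycG p q m = \<zero>\<^bsub>Space (tensG k)\<^esub>"
  shows "\<exists>y\<in>carrier (Space (tensG (Suc q))). vert R cycG p (Suc q) y = m"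
proof (cases "even p")
  case True
  interpret M: module R "Space (tensG l)" for l by (rule basis_module[OF X.basis])
  have "bd R cycG (Suc q) (prism_map q m) = m \<ominus>\<^bsub>Space (tensG q)\<^esub> retract_map q m"
    using True cyc by (intro prism_homotopy[OF m]) (simp add: vert_def)
  then have "vert R cycG p (Suc q) (prism_map q m) = m" using True m by (simp add: vert_def ret M.M.diff_zero)
  then show ?thesis using represents_closed[OF represents_prism m] by blast
next
  case False
  interpret M: module R "Space (tensG l)" for l by (rule basis_module[OF X.basis])
  have bh: "bd' R cycG (Suc k) \<in> mod_hom R (Space (tensG (Suc k))) (Space (tensG k))" for k
    by (rule represents_hom[OF X.represents_bd'])
  have z: "bd' R cycG q m = \<zero>\<^bsub>Space (tensG k)\<^esub>" if q: "q = Suc k" for k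
  proof -
    have b: "bd' R cycG q m \<in> carrier (Space (tensG k))" using mod_homD(1)[OF bh, of m k] m q by simp
    have "\<ominus>\<^bsub>Space (tensG k)\<^esub> bd' R cycG q m = \<zero>\<^bsub>Space (tensG k)\<^esub>"
      using cyc[OF q] False q by (simp add: vert_def X.Deg)
    then show ?thesis using b by (metis M.M.minus_minus M.M.minus_equality M.M.l_zero M.M.zero_closed)
  qed
  note u = represents_closed[OF represents_unit m]
  have "vert R cycG p (Suc q) (\<ominus>\<^bsub>Space (tensG (Suc q))\<^esub> unit_map q m) = m"
    using False unit_homotopy[OF m z] m mod_hom_minus[OF M.module_axioms M.module_axioms bh u]
    by (simp add: vert_def X.Deg)
  then show ?thesis using u by (intro bexI[of _ "\<ominus>\<^bsub>Space (tensG (Suc q))\<^esub> unit_map q m"]) auto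
qed

text \<open>
  On the common kernel of the projections the retraction vanishes.  Subtracting its retraction from a
  primitive moves the primitive into the kernel without changing its boundary.
\<close>

lemma kernel_column_exact:
  assumes m: "m \<in> carrier (Space (tensG q))"
    and ker: "\<And>c. c \<in> conj_classes G \<Longrightarrow> component_map c q m = \<zero>\<^bsub>Space (tensL c q)\<^esub>"
    and cyc: "\<And>k. q = Suc k \<Longrightarrow> vert R cycG p q m = \<zero>\<^bsub>Space (tensG k)\<^esub>"
  shows "\<exists>y\<in>carrier (Space (tensG (Suc q))).
    (\<forall>c\<in>conj_classes G. component_map c (Suc q) y = \<zero>\<^bsub>Space (tensL c (Suc q))\<^esub>) \<and> vert R cycG p (Suc q) y = m"
proof -
  interpret M: module R "Space (tensG l)" for l by (rule basis_module[OF X.basis])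
  note rh = represents_hom[OF represents_retract]
  have ret: "retract_map q m = \<zero>\<^bsub>Space (tensG q)\<^esub>"
  proof -
    obtain F where F: "finite F" "F \<subseteq> conj_classes G"
      "retract_map q m = finsum (Space (tensG q)) (\<lambda>c. include_map c q (component_map c q m)) F"
      using component_locally_finite[OF m] by (elim exE conjE) (rule that, simp_all)
    have "finsum (Space (tensG q)) (\<lambda>c. include_map c q (component_map c q m)) F = \<zero>\<^bsub>Space (tensG q)\<^esub>"
      using F(2) ker represents_zero[OF represents_include] by (intro M.M.add.finprod_one_eqI) auto
    then show ?thesis using F(3) by simp
  qed
  obtain x where x: "x \<in> carrier (Space (tensG (Suc q)))" "vert R cycG p (Suc q) x = m"
    using column_contraction[OF m ret cyc] by blast
  let ?r = "retract_map (Suc q) x"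
  have r: "?r \<in> carrier (Space (tensG (Suc q)))" by (rule mod_homD(1)[OF rh x(1)])
  have vh: "vert R cycG p (Suc q) \<in> mod_hom R (Space (tensG (Suc q))) (Space (tensG q))"
    by (rule represents_hom[OF X.represents_vert])
  have "vert R cycG p (Suc q) ?r = retract_map q (vert R cycG p (Suc q) x)"
    using cyclic_map_bicomplex_map[OF X.operators X.operators retract_cyclic_map] x(1)
    by (simp add: bicomplex_map_def X.Deg)
  then have "vert R cycG p (Suc q) (x \<ominus>\<^bsub>Space (tensG (Suc q))\<^esub> ?r) = m"
    using mod_hom_diff[OF M.module_axioms M.module_axioms vh x(1) r] x(2) ret m by (simp add: M.M.diff_zero)
  moreover have "component_map c (Suc q) (x \<ominus>\<^bsub>Space (tensG (Suc q))\<^esub> ?r) = \<zero>\<^bsub>Space (tensL c (Suc q))\<^esub>"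
    if c: "c \<in> conj_classes G" for c
  proof -
    interpret N: module R "Space (tensL c (Suc q))" by (rule basis_module[OF Y_basis[OF c]])
    note h = represents_hom[OF represents_component[OF c]]
    show ?thesis
      using mod_hom_diff[OF M.module_axioms N.module_axioms h x(1) r] restrict_retract[OF c x(1)]
        N.M.diff_self[OF mod_homD(1)[OF h x(1)]] by simp
  qed
  ultimately show ?thesis using x(1) r by (intro bexI[of _ "x \<ominus>\<^bsub>Space (tensG (Suc q))\<^esub> ?r"]) auto
qed

theorem cyclic_homology_group_algebra:
  "\<exists>\<Phi>. \<forall>n. \<Phi> n \<in> mod_iso R (cyclic_homology R cycG n)
    (dsum_module (conj_classes G) (\<lambda>c. cyclic_homology R (cycL c) n))"
proof (rule homology_decomposition[where r = component_map and j = include_map])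
  have L: "group (centralizer G (rep c))" if "c \<in> conj_classes G" for c
    by (rule centralizer_group[OF rep_class(1)[OF that]])
  have D: "Deg (cycL c) n = Space (tensL c n)" if "c \<in> conj_classes G" for c n
    by (rule hopf_Deg[OF R L[OF that] rep_class(4)[OF that]])
  have O: "cyclic_operators R (cycL c)" if "c \<in> conj_classes G" for c
    by (rule hopf_operators[OF R L[OF that] rep_class(4)[OF that]])
  show C: "bicomplex R cycG" by (rule X.bicomplex)
  show r: "bicomplex_map R cycG (cycL c) (component_map c)" if "c \<in> conj_classes G" for c
    by (rule cyclic_map_bicomplex_map[OF X.operators O[OF that] restrict_cyclic_map[OF that]])
  show j: "bicomplex_map R (cycL c) cycG (include_map c)" if "c \<in> conj_classes G" for c
    by (rule cyclic_map_bicomplex_map[OF O[OF that] X.operators include_cyclic_map[OF that]])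
  show rj: "component_map c q (include_map c q y) = y"
    if "c \<in> conj_classes G" "y \<in> carrier (Deg (cycL c) q)" for c q y
    using restrict_include[OF that(1)] that(2) D[OF that(1)] by simp
  show "bicomplex R (cycL c)" if "c \<in> conj_classes G" for c
    by (rule retract_bicomplex[OF C O[OF that] r[OF that] j[OF that] rj[OF that]])
  show "component_map c' q (include_map c q y) = \<zero>\<^bsub>Deg (cycL c') q\<^esub>"
    if "c \<in> conj_classes G" "c' \<in> conj_classes G" "c' \<noteq> c" "y \<in> carrier (Deg (cycL c) q)" for c c' q y
    using restrict_include_other[OF that(1-3)] that(4) D[OF that(1)] D[OF that(2)] by simp
  show "finite {c \<in> conj_classes G. component_map c q x \<noteq> \<zero>\<^bsub>Deg (cycL c) q\<^esub>}"
    if x: "x \<in> carrier (Deg cycG q)" for q x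
  proof -
    obtain F where F: "finite F" "\<forall>c\<in>conj_classes G - F. component_map c q x = \<zero>\<^bsub>Space (tensL c q)\<^esub>"
      using component_locally_finite[OF x[unfolded X.Deg]] by blast
    show ?thesis by (rule finite_subset[OF _ F(1)]) (use F(2) in \<open>auto simp: D\<close>)
  qed
  show "\<exists>y\<in>carrier (Deg cycG (Suc q)). (\<forall>c\<in>conj_classes G. component_map c (Suc q) y = \<zero>\<^bsub>Deg (cycL c) (Suc q)\<^esub>) \<and>
      vert R cycG p (Suc q) y = x"
    if "x \<in> carrier (Deg cycG q)" "\<And>c. c \<in> conj_classes G \<Longrightarrow> component_map c q x = \<zero>\<^bsub>Deg (cycL c) q\<^esub>"
      "\<And>m. q = Suc m \<Longrightarrow> vert R cycG p q x = \<zero>\<^bsub>Deg cycG m\<^esub>" for p q x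
    using kernel_column_exact[of x q p] that by (simp add: X.Deg D)
qed

end

end

theorem theorem3p4:
  fixes R :: "('r, 'k) ring_scheme" and G :: "('g, 'l) monoid_scheme"
    and rep :: "'g set \<Rightarrow> 'g"
  assumes "cring R" and "group G"
    and "\<And>c. c \<in> conj_classes G \<Longrightarrow> rep c \<in> c"
  shows "\<exists>\<Phi>. \<forall>n. \<Phi> n \<in> mod_iso R
    (cyclic_homology R (algebra_cyclic R (group_algebra R G)) n)
    (dsum_module (conj_classes G)
      (\<lambda>c. cyclic_homology R (hopf_cyclic R (centralizer G (rep c)) (rep c)) n))"
proof -
  have "conj_reps G rep"
    using assms(2,3) by (simp add: conj_reps_def conj_reps_axioms_def)
  then show ?thesis
    using assms(1) by (rule conj_reps.cyclic_homology_group_algebra)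
qed

end
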